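(* Let $0<\alpha<1$, $\beta:=\frac1\alpha-1$, $\varphi\in C^1([0,1])$ and $\tau\in(\frac12,1]$. There is a constant $C=C_{\alpha,\|\varphi\|_{C^1}}$, depending on $\alpha$ and on the $C^1$ norm of $\varphi$ but not on the sequence of maps, such that for every sequence $(\alpha_j)_{j\ge1}$ with $0<\alpha_j\le\alpha$, with $\mathcal T^j:=T_{\alpha_j}\circ\cdots\circ T_{\alpha_1}$, every $t>0$ and every integer $n\ge2$: (a) if $\alpha>\frac12$, then $$m\Big\{x:\Big|\sum_{j=1}^n[\varphi(\mathcal T^jx)-m(\varphi\circ\mathcal T^j)]\Big|>n^\tau t\Big\}\le\frac{4}{2-\frac1\alpha}\,C\,n^{-\beta+2(1-\tau)}(\log n)^{\frac1\alpha}t^{-2};$$ (b) if $\alpha\le\frac12$, then $$m\Big\{x:\Big|\sum_{j=1}^n[\varphi(\mathcal T^jx)-m(\varphi\circ\mathcal T^j)]\Big|>n^\tau t\Big\}\le(4\beta)^\beta C^\beta(\log n)^{\frac2\alpha-1}n^{-\beta(2\tau-1)}t^{-2\beta}.$$ The same estimates hold with $m$ replaced by the measure $\widetilde m$, with each term centered as $\varphi(\mathcal T^jx)-\frac{1}{\widetilde m([0,1])}\widetilde m(\varphi\circ\mathcal T^j)$ (with a constant of the same kind).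
   Context: $m$ is Lebesgue measure on $[0,1]$, and $\mu(f)$ denotes $\int f\,d\mu$ for a measure $\mu$. For $\gamma\in(0,1)$ the intermittent map $T_\gamma:[0,1]\to[0,1]$ is $T_\gamma(x)=x+2^\gamma x^{1+\gamma}$ for $0\le x\le 1/2$ and $T_\gamma(x)=2x-1$ for $1/2<x\le1$. The measure $\widetilde m$ on $[0,1]$ is $d\widetilde m(x)=x^{-\alpha}\,dm(x)$ (a finite measure, not normalized). *)

theory Defs
  imports "HOL-Analysis.Analysis"
begin

definition intermittent_map :: "real \<Rightarrow> real \<Rightarrow> real" where
  "intermittent_map \<gamma> x =
     (if x \<le> 1/2 then x + 2 powr \<gamma> * x powr (1 + \<gamma>) else 2 * x - 1)"

text \<open>A sequence of parameters is indexed from 1; the value at 0 is never used.\<close>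

primrec seq_map :: "(nat \<Rightarrow> real) \<Rightarrow> nat \<Rightarrow> real \<Rightarrow> real" where
  "seq_map a 0 = id"
| "seq_map a (Suc j) = intermittent_map (a (Suc j)) \<circ> seq_map a j"

definition m01 :: "real measure" where
  "m01 = lebesgue_on {0..1}"

text \<open>The density takes the value 0 at the origin (0 powr anything is 0), a null set.\<close>

definition m_tilde :: "real \<Rightarrow> real measure" where
  "m_tilde \<alpha> = density m01 (\<lambda>x. ennreal (x powr (- \<alpha>)))"

text \<open>
  Functions in $C^1([0,1])$ are represented by total functions; only their values on the
  unit interval matter, and derivatives at the endpoints are one-sided.
\<close>

definition C1_unit :: "(real \<Rightarrow> real) \<Rightarrow> bool" where
  "C1_unit \<phi> \<longleftrightarrow> \<phi> differentiable_on {0..1} \<and>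
     continuous_on {0..1} (\<lambda>x. vector_derivative \<phi> (at x within {0..1}))"

definition C1_norm :: "(real \<Rightarrow> real) \<Rightarrow> real" where
  "C1_norm \<phi> = (SUP x\<in>{0..1}. \<bar>\<phi> x\<bar>) +
     (SUP x\<in>{0..1}. \<bar>vector_derivative \<phi> (at x within {0..1})\<bar>)"

end

theory Submission
  imports Defs
begin

text \<open>
  Let \<open>P\<close> be the transfer operator of an intermittent map. Decreasing densities bounded by a
  multiple of \<open>x\<^sup>-\<^sup>\<alpha>\<close> are preserved by every \<open>P\<close>, and also by subtracting a constant that keeps
  them nonnegative. If \<open>f\<close> is such a density with mass \<open>v\<close> in the right half, then \<open>P f \<ge> 2 v / 3\<close>.
  All mass visits the right half within \<open>k\<close> steps, except for a part of order \<open>k\<^sup>-\<^sup>\<beta>\<close> near the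
  neutral fixed point. Hence after \<open>k\<close> steps two densities of equal mass dominate a common
  constant density, carrying a fixed fraction of their mass up to an error \<open>k\<^sup>-\<^sup>\<beta>\<close>. Subtracting it,
  and repeating with \<open>k\<close> a small multiple of the elapsed time \<open>n\<close>, shows that the two densities
  merge at rate \<open>n\<^sup>-\<^sup>\<beta>\<close>.

  In reversed time the centered observables are adapted to an increasing filtration, and by the
  above the conditional expectation of the \<open>k\<close>-th one given the \<open>i\<close>-th iterate has \<open>L\<^sup>1\<close> norm
  \<open>O((i - k)\<^sup>-\<^sup>\<beta>)\<close>. Expanding \<open>\<bar>S\<bar>\<^sup>2\<^sup>q\<close> along the partial sums to second order bounds its
  expectation by \<open>n\<^sup>q\<close> times the \<open>q\<close>-th moment of the sums of these conditional expectations.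
  Markov's inequality with \<open>q = 1\<close> for \<open>\<alpha> > 1/2\<close> and with \<open>q = \<beta>\<close> for \<open>\<alpha> \<le> 1/2\<close> gives the claim.
  Both measures are covered by initial densities \<open>h\<close> that decrease and satisfy \<open>1 \<le> h \<le> x\<^sup>-\<^sup>\<alpha>\<close>.
\<close>

section \<open>Transfer operators\<close>

text \<open>A sequence of different maps has no common invariant density to compare with. Merging is
  therefore stated for arbitrary pairs of densities of equal mass, and a correlation is treated by
  writing a centered observable times the current density as a difference of two such densities. All
  densities live on the half-open interval: \<open>x powr (- \<alpha>)\<close> is unbounded near 0,
  and at 0 itself \<open>powr\<close> returns 0, which would destroy monotonicity there. Each map
  sends this interval into itself, and both branches are bijections onto it. The rate \<beta>
  survives the coupling because the constant A of the cone does not have to grow while mass is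
  removed: every stage has an error A * k^-\<beta>, and with k proportional to n such a recursion
  has solutions of order n^-\<beta>. Time is reversed because an iterate determines all later ones
  but not the earlier ones, so the information carried by the orbit shrinks as time advances. The
  logarithms for small \<alpha> have one source, the harmonic sum: it arises from Hoelder weights
  1/d over the time distance d, and again from the decay d^-\<beta> when the moment is tuned to q =
  \<beta>.\<close>

definition unit_borel :: "real measure" where
  "unit_borel = restrict_space lborel {0<..1}"

lemma space_unit_borel [simp]: "space unit_borel = {0<..1}"
  by (simp add: unit_borel_def space_restrict_space)

lemma emeasure_unit_borel: "A \<in> sets unit_borel \<Longrightarrow> emeasure unit_borel A = emeasure lborel A"
  by (simp add: unit_borel_def emeasure_restrict_space sets_restrict_space_iff)

lemma sets_unit_borel: "A \<in> sets unit_borel \<longleftrightarrow> A \<in> sets borel \<and> A \<subseteq> {0<..1}"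
  by (auto simp: unit_borel_def sets_restrict_space_iff)

lemma finite_measure_unit_borel: "finite_measure unit_borel"
  by (rule finite_measureI) (simp add: unit_borel_def emeasure_restrict_space space_restrict_space)

lemma measure_unit_borel_space [simp]: "measure unit_borel {0<..1} = 1"
  by (simp add: measure_def emeasure_unit_borel sets_unit_borel)

lemma integrable_const_unit_borel [simp]: "integrable unit_borel (\<lambda>x. c::real)"
  by (rule finite_measure.integrable_const[OF finite_measure_unit_borel])

lemma borel_measurable_unit_borel: "f \<in> borel_measurable borel \<Longrightarrow> f \<in> borel_measurable unit_borel"
  unfolding unit_borel_def by (rule measurable_restrict_space1) simp

lemma antimono_measurable_unit_borel:
  fixes f :: "real \<Rightarrow> real"
  assumes "antimono_on {0<..1} f"
  shows "f \<in> borel_measurable unit_borel"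
proof -
  have "mono_on {0<..1} (\<lambda>x. - f x)"
    using assms by (auto simp: monotone_on_def)
  hence "(\<lambda>x. - f x) \<in> borel_measurable (restrict_space borel {0<..1})"
    by (rule borel_measurable_mono_on_fnc)
  hence "(\<lambda>x. - f x) \<in> borel_measurable unit_borel"
    by (subst measurable_cong_sets[of _ "restrict_space borel {0<..1::real}" _ borel])
       (auto simp: unit_borel_def sets_restrict_space)
  thus ?thesis by (simp add: borel_measurable_uminus_eq)
qed

lemma measurable_unit_borel_selfI:
  assumes "f \<in> borel_measurable unit_borel" "\<And>x. x \<in> {0<..1} \<Longrightarrow> f x \<in> {0<..1}"
  shows "f \<in> measurable unit_borel unit_borel"
proof -
  have "f \<in> measurable unit_borel (restrict_space borel {0<..1})"
    using assms by (intro measurable_restrict_space2) auto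
  thus ?thesis
    by (subst measurable_cong_sets[of _ unit_borel _ "restrict_space borel {0<..1::real}"])
       (auto simp: unit_borel_def sets_restrict_space)
qed

section \<open>The map, its two branches, and change of variables along a branch\<close>

definition map_deriv :: "real \<Rightarrow> real \<Rightarrow> real" where
  "map_deriv \<gamma> y = 1 + (1 + \<gamma>) * (2 * y) powr \<gamma>"

lemma intermittent_map_left:
  assumes "0 < \<gamma>" "0 \<le> x" "x \<le> 1/2"
  shows "intermittent_map \<gamma> x = x * (1 + (2 * x) powr \<gamma>)"
  using assms by (simp add: intermittent_map_def powr_mult powr_add algebra_simps)

lemma intermittent_map_right: "1/2 < x \<Longrightarrow> intermittent_map \<gamma> x = 2 * x - 1"
  by (simp add: intermittent_map_def)

lemma map_deriv_ge_1: "0 < \<gamma> \<Longrightarrow> 1 \<le> map_deriv \<gamma> y"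
  by (simp add: map_deriv_def)

lemma map_deriv_le_3:
  assumes "0 < \<gamma>" "\<gamma> < 1" "0 \<le> y" "y \<le> 1/2" shows "map_deriv \<gamma> y \<le> 3"
proof -
  have "(2*y) powr \<gamma> \<le> 1" using assms by (intro powr_le1) auto
  hence "(1+\<gamma>) * (2*y) powr \<gamma> \<le> 2 * 1" using assms by (intro mult_mono) auto
  thus ?thesis by (simp add: map_deriv_def)
qed

lemma map_deriv_mono:
  assumes "0 < \<gamma>" "0 \<le> x" "x \<le> y" shows "map_deriv \<gamma> x \<le> map_deriv \<gamma> y"
  using assms by (auto simp: map_deriv_def intro!: mult_left_mono powr_mono2)

lemma has_derivative_left_branch:
  assumes "0 < \<gamma>" "0 \<le> y"
  shows "((\<lambda>x. x + 2 powr \<gamma> * x powr (1 + \<gamma>)) has_real_derivative map_deriv \<gamma> y) (at y)"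
proof (cases "y = 0")
  case False
  thus ?thesis using assms
    by (auto intro!: derivative_eq_intros simp: map_deriv_def powr_mult)
next
  case True
  have "((\<lambda>h. ((0+h) powr (1+\<gamma>) - 0 powr (1+\<gamma>)) / h) \<longlongrightarrow> 0) (at 0)"
  proof (rule Lim_null_comparison)
    show "\<forall>\<^sub>F h in at 0. norm (((0+h) powr (1+\<gamma>) - 0 powr (1+\<gamma>)) / h) \<le> \<bar>h\<bar> powr \<gamma>"
    proof (rule always_eventually, rule allI)
      fix h :: real
      \<comment> \<open>The derivative at 0 is two-sided, as the substitution rule asks on a closed
        interval. So negative \<open>h\<close> occur, and there \<open>powr\<close> depends only on
        the absolute value of its base.\<close>
      have "h powr (1+\<gamma>) = \<bar>h\<bar> powr (1+\<gamma>)" by (simp add: powr_def ln_real_def)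
      also have "\<dots> = \<bar>h\<bar> * \<bar>h\<bar> powr \<gamma>" by (simp add: powr_add)
      finally show "norm (((0+h) powr (1+\<gamma>) - 0 powr (1+\<gamma>)) / h) \<le> \<bar>h\<bar> powr \<gamma>"
        by (simp add: abs_mult)
    qed
    show "((\<lambda>h. \<bar>h\<bar> powr \<gamma>) \<longlongrightarrow> 0) (at 0)"
      using assms by (auto intro!: tendsto_eq_intros)
  qed
  hence "((\<lambda>x. x powr (1+\<gamma>)) has_real_derivative 0) (at 0)"
    by (simp add: DERIV_def)
  hence "((\<lambda>x. x + 2 powr \<gamma> * x powr (1 + \<gamma>)) has_real_derivative (1 + 2 powr \<gamma> * 0)) (at 0)"
    by (intro DERIV_add DERIV_ident DERIV_cmult)
  thus ?thesis using True assms by (simp add: map_deriv_def)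
qed

lemma continuous_on_map_deriv: "0 < \<gamma> \<Longrightarrow> continuous_on {0..1/2} (map_deriv \<gamma>)"
  unfolding map_deriv_def by (intro continuous_intros continuous_on_powr') auto

lemma map_deriv_measurable [measurable]: "map_deriv \<gamma> \<in> borel_measurable borel"
  unfolding map_deriv_def[abs_def] by measurable

lemma intermittent_map_measurable [measurable]: "intermittent_map \<gamma> \<in> borel_measurable borel"
  unfolding intermittent_map_def[abs_def] by measurable

lemma intermittent_map_strict_mono:
  assumes "0 < \<gamma>" "0 \<le> x" "x < y" "y \<le> 1/2"
  shows "intermittent_map \<gamma> x < intermittent_map \<gamma> y"
proof -
  have "x powr (1+\<gamma>) \<le> y powr (1+\<gamma>)" using assms by (intro powr_mono2) auto
  thus ?thesis using assms by (simp add: intermittent_map_def add_less_le_mono)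
qed

lemma intermittent_map_half [simp]: "0 < \<gamma> \<Longrightarrow> intermittent_map \<gamma> (1/2) = 1"
  by (simp add: intermittent_map_left)

lemma intermittent_map_bounds:
  assumes "0 < \<gamma>" "x \<in> {0<..1}" shows "intermittent_map \<gamma> x \<in> {0<..1}"
proof (cases "x \<le> 1/2")
  case True
  have "0 < intermittent_map \<gamma> x" using True assms by (simp add: intermittent_map_left add_pos_nonneg)
  moreover have "intermittent_map \<gamma> x \<le> intermittent_map \<gamma> (1/2)"
    using True assms intermittent_map_strict_mono[of \<gamma> x "1/2"] by (cases "x = 1/2") fastforce+
  ultimately show ?thesis using assms by simp
qed (use assms in \<open>auto simp: intermittent_map_right\<close>)

lemma intermittent_map_measurable_unit [measurable]:
  "0 < \<gamma> \<Longrightarrow> intermittent_map \<gamma> \<in> measurable unit_borel unit_borel"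
  by (intro measurable_unit_borel_selfI borel_measurable_unit_borel intermittent_map_measurable intermittent_map_bounds)

lemma bij_betw_left_branch:
  assumes "0 < \<gamma>"
  shows "bij_betw (intermittent_map \<gamma>) {0<..1/2} {0<..1}"
proof (rule bij_betw_imageI)
  show "inj_on (intermittent_map \<gamma>) {0<..1/2}"
  proof (rule linorder_inj_onI)
    fix x y :: real assume "x < y" "x \<in> {0<..1/2}" "y \<in> {0<..1/2}"
    thus "intermittent_map \<gamma> x \<noteq> intermittent_map \<gamma> y"
      using intermittent_map_strict_mono[OF assms, of x y] by auto
  qed auto
  show "intermittent_map \<gamma> ` {0<..1/2} = {0<..1}"
  proof (intro equalityI subsetI)
    fix z assume "z \<in> intermittent_map \<gamma> ` {0<..1/2}"
    thus "z \<in> {0<..1}" using intermittent_map_bounds[OF assms] by fastforce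
  next
    fix z :: real assume z: "z \<in> {0<..1}"
    have "continuous_on {0..1/2} (\<lambda>x. x + 2 powr \<gamma> * x powr (1 + \<gamma>))"
      using assms by (intro continuous_intros continuous_on_powr') auto
    hence c: "continuous_on {0..1/2} (intermittent_map \<gamma>)"
      by (rule continuous_on_eq) (auto simp: intermittent_map_def)
    have "\<exists>x\<ge>0. x \<le> 1/2 \<and> intermittent_map \<gamma> x = z"
      using z assms by (intro IVT' c) (auto simp: intermittent_map_left)
    then obtain x where x: "0 \<le> x" "x \<le> 1/2" "intermittent_map \<gamma> x = z" by blast
    have "x \<noteq> 0" using x z by (auto simp: intermittent_map_def)
    thus "z \<in> intermittent_map \<gamma> ` {0<..1/2}" using x by auto
  qed
qed

definition left_inv :: "real \<Rightarrow> real \<Rightarrow> real" where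
  "left_inv \<gamma> = the_inv_into {0<..1/2} (intermittent_map \<gamma>)"

lemma left_inv_range: "0 < \<gamma> \<Longrightarrow> x \<in> {0<..1} \<Longrightarrow> left_inv \<gamma> x \<in> {0<..1/2}"
  unfolding left_inv_def
  by (rule the_inv_into_into) (use bij_betw_left_branch in \<open>auto simp: bij_betw_def\<close>)

lemma intermittent_map_left_inv: "0 < \<gamma> \<Longrightarrow> x \<in> {0<..1} \<Longrightarrow> intermittent_map \<gamma> (left_inv \<gamma> x) = x"
  unfolding left_inv_def
  by (rule f_the_inv_into_f) (use bij_betw_left_branch in \<open>auto simp: bij_betw_def\<close>)

lemma left_inv_intermittent_map: "0 < \<gamma> \<Longrightarrow> y \<in> {0<..1/2} \<Longrightarrow> left_inv \<gamma> (intermittent_map \<gamma> y) = y"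
  unfolding left_inv_def
  by (rule the_inv_into_f_f) (use bij_betw_left_branch in \<open>auto simp: bij_betw_def\<close>)

lemma left_inv_mono:
  assumes "0 < \<gamma>" "x \<in> {0<..1}" "y \<in> {0<..1}" "x \<le> y"
  shows "left_inv \<gamma> x \<le> left_inv \<gamma> y"
proof (rule ccontr)
  assume "\<not> ?thesis"
  hence "intermittent_map \<gamma> (left_inv \<gamma> y) < intermittent_map \<gamma> (left_inv \<gamma> x)"
    using left_inv_range[OF assms(1,2)] left_inv_range[OF assms(1,3)]
    by (intro intermittent_map_strict_mono assms) auto
  thus False using assms by (simp add: intermittent_map_left_inv)
qed

lemma left_inv_measurable [measurable]:
  assumes "0 < \<gamma>" shows "left_inv \<gamma> \<in> measurable unit_borel unit_borel"
proof (rule measurable_unit_borel_selfI)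
  have "antimono_on {0<..1} (\<lambda>x. - left_inv \<gamma> x)"
    using left_inv_mono[OF assms] by (auto simp: monotone_on_def)
  hence "(\<lambda>x. - (- left_inv \<gamma> x)) \<in> borel_measurable unit_borel"
    by (intro borel_measurable_uminus antimono_measurable_unit_borel)
  thus "left_inv \<gamma> \<in> borel_measurable unit_borel" by simp
  fix x :: real assume "x \<in> {0<..1}"
  thus "left_inv \<gamma> x \<in> {0<..1}" using left_inv_range[OF assms, of x] by auto
qed

text \<open>Substitution along one full branch, phrased as an image measure so that integrability
  and integrals transfer together. The formula \<open>h\<close> stands in for the map because
  derivatives are wanted on the closed interval, and at 1/2 the map jumps.\<close>

lemma unit_borel_distr_branch:
  fixes h g' :: "real \<Rightarrow> real"
  assumes \<gamma>: "0 < \<gamma>" and I: "I \<subseteq> {0<..1}" "{a<..b} \<subseteq> I" "I \<subseteq> {a..b}" "a < b" and Ib: "I \<in> sets borel"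
    and h: "h a = 0" "h b = 1" "\<And>x. x \<in> I \<Longrightarrow> intermittent_map \<gamma> x = h x"
    and d: "\<And>x. x \<in> {a..b} \<Longrightarrow> (h has_real_derivative g' x) (at x)"
    and c: "continuous_on {a..b} g'" and nn: "\<And>x. x \<in> {a..b} \<Longrightarrow> 0 \<le> g' x"
    and [measurable]: "g' \<in> borel_measurable borel"
  shows "unit_borel = distr (density unit_borel (\<lambda>y. ennreal (g' y * indicator I y))) unit_borel (intermittent_map \<gamma>)"
proof (rule measure_eqI)
  note [measurable] = intermittent_map_measurable_unit[OF \<gamma>] Ib
  have gm[measurable]: "(\<lambda>y. ennreal (g' y * indicator I y)) \<in> borel_measurable unit_borel"
    by (rule borel_measurable_unit_borel) (intro measurable_compose[OF _ measurable_ennreal] borel_measurable_times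
        borel_measurable_indicator Ib assms)
  fix A assume A[measurable]: "A \<in> sets unit_borel"
  hence [measurable]: "A \<in> sets borel" and A01: "A \<subseteq> {0<..1}" by (auto simp: sets_unit_borel)
  let ?M = "density unit_borel (\<lambda>y. ennreal (g' y * indicator I y))"
  have [measurable]: "intermittent_map \<gamma> \<in> measurable ?M unit_borel" by simp
  have "emeasure (distr ?M unit_borel (intermittent_map \<gamma>)) A
     = emeasure ?M (intermittent_map \<gamma> -` A \<inter> space ?M)"
    by (rule emeasure_distr) auto
  also have "\<dots> = (\<integral>\<^sup>+ x. ennreal (g' x * indicator I x) * indicator (intermittent_map \<gamma> -` A \<inter> space ?M) x \<partial>unit_borel)"
    by (rule emeasure_density) (use measurable_sets[OF intermittent_map_measurable_unit[OF \<gamma>] A] in auto)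
  also have "\<dots> = (\<integral>\<^sup>+ x. (ennreal (g' x * indicator I x) * indicator (intermittent_map \<gamma> -` A \<inter> space ?M) x) * indicator {0<..1} x \<partial>lborel)"
    unfolding unit_borel_def by (subst nn_integral_restrict_space) (auto simp: space_restrict_space)
  also have "\<dots> = (\<integral>\<^sup>+ x. ennreal (indicator A (h x) * g' x * indicator {a..b} x) \<partial>lborel)"
  proof (rule nn_integral_cong_AE)
    \<comment> \<open>The branch domain \<open>I\<close> and the closed interval can differ only in
      the left endpoint.\<close>
    have "AE x in lborel. x \<noteq> a" by (rule AE_lborel_singleton)
    thus "AE x in lborel. (ennreal (g' x * indicator I x) * indicator (intermittent_map \<gamma> -` A \<inter> space ?M) x) * indicator {0<..1} x
        = ennreal (indicator A (h x) * g' x * indicator {a..b} x)"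
    proof eventually_elim
      case (elim x)
      show ?case
      proof (cases "x \<in> I")
        case True
        thus ?thesis using I h(3)[OF True] by (auto simp: indicator_def)
      next
        case False
        hence "x \<notin> {a..b}" using subsetD[OF I(2), of x] elim by fastforce
        thus ?thesis using False by simp
      qed
    qed
  qed
  also have "\<dots> = (\<integral>\<^sup>+ x. ennreal (indicator A x * indicator {h a..h b} x) \<partial>lborel)"
  proof (rule nn_integral_substitution[symmetric])
    show "set_borel_measurable borel {h a..h b} (indicat_real A)"
      unfolding set_borel_measurable_def by measurable
  qed (use d c nn I in auto)
  also have "\<dots> = (\<integral>\<^sup>+ x. indicator A x \<partial>lborel)"
    by (rule nn_integral_cong) (use A01 in \<open>auto simp: indicator_def h(1,2)\<close>)
  also have "\<dots> = emeasure unit_borel A" by (simp add: emeasure_unit_borel[OF A])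
  finally show "emeasure unit_borel A = emeasure (distr ?M unit_borel (intermittent_map \<gamma>)) A" ..
qed simp

lemma unit_borel_distr_left:
  assumes "0 < \<gamma>"
  shows "unit_borel = distr (density unit_borel (\<lambda>y. ennreal (map_deriv \<gamma> y * indicator {0<..1/2} y)))
      unit_borel (intermittent_map \<gamma>)"
proof (rule unit_borel_distr_branch[where a=0 and b="1/2" and h="\<lambda>x. x + 2 powr \<gamma> * x powr (1 + \<gamma>)"])
  show "1/2 + 2 powr \<gamma> * (1/2) powr (1 + \<gamma>) = 1"
    using intermittent_map_half[OF assms] by (simp add: intermittent_map_def)
  show "0 \<le> map_deriv \<gamma> x" for x
    using map_deriv_ge_1[OF assms, of x] by linarith
qed (use assms has_derivative_left_branch continuous_on_map_deriv in
    \<open>auto simp: intermittent_map_def\<close>)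

lemma unit_borel_distr_right:
  assumes "0 < \<gamma>"
  shows "unit_borel = distr (density unit_borel (\<lambda>y. ennreal (2 * indicator {1/2<..1} y)))
      unit_borel (intermittent_map \<gamma>)"
proof (rule unit_borel_distr_branch[where a="1/2" and b=1 and h="\<lambda>x. 2 * x - 1" and g'="\<lambda>_. 2"])
  show "((\<lambda>x. 2 * x - 1) has_real_derivative 2) (at x)" for x :: real
    by (auto intro!: derivative_eq_intros)
qed (use assms in \<open>auto simp: intermittent_map_def\<close>)

section \<open>The transfer operator and its iterates along a sequence of maps\<close>

definition transfer :: "real \<Rightarrow> (real \<Rightarrow> real) \<Rightarrow> real \<Rightarrow> real" where
  "transfer \<gamma> f x = f (left_inv \<gamma> x) / map_deriv \<gamma> (left_inv \<gamma> x) + f ((x + 1) / 2) / 2"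

lemma measurable_right_inv [measurable]: "(\<lambda>x. (x + 1) / 2) \<in> measurable unit_borel unit_borel"
  by (rule measurable_unit_borel_selfI) (auto intro!: borel_measurable_unit_borel)

lemma transfer_measurable:
  assumes "0 < \<gamma>" and [measurable]: "f \<in> borel_measurable unit_borel"
  shows "transfer \<gamma> f \<in> borel_measurable unit_borel"
proof -
  note [measurable] = left_inv_measurable[OF assms(1)]
  have [measurable]: "map_deriv \<gamma> \<in> borel_measurable unit_borel"
    by (rule borel_measurable_unit_borel) measurable
  show ?thesis unfolding transfer_def[abs_def] by measurable
qed

lemma branch_integral:
  fixes F w :: "real \<Rightarrow> real"
  assumes eq: "unit_borel = distr (density unit_borel (\<lambda>y. ennreal (w y))) unit_borel T"
    and T: "T \<in> measurable unit_borel unit_borel"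
    and w: "w \<in> borel_measurable unit_borel" "\<And>y. y \<in> {0<..1} \<Longrightarrow> 0 \<le> w y"
    and F: "F \<in> borel_measurable unit_borel"
  shows "integrable unit_borel F \<longleftrightarrow> integrable unit_borel (\<lambda>y. w y * F (T y))"
    and "integral\<^sup>L unit_borel F = (\<integral>y. w y * F (T y) \<partial>unit_borel)"
proof -
  let ?M = "density unit_borel (\<lambda>y. ennreal (w y))"
  have T': "T \<in> measurable ?M unit_borel" using T by simp
  have FT: "(\<lambda>y. F (T y)) \<in> borel_measurable unit_borel" using T F by measurable
  have w': "AE y in unit_borel. 0 \<le> w y" using w(2) by (intro AE_I2) auto
  have "integrable unit_borel F \<longleftrightarrow> integrable (distr ?M unit_borel T) F"
    using eq by simp
  also have "\<dots> \<longleftrightarrow> integrable ?M (\<lambda>y. F (T y))" by (rule integrable_distr_eq[OF T' F])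
  also have "\<dots> \<longleftrightarrow> integrable unit_borel (\<lambda>y. w y *\<^sub>R F (T y))"
    by (rule integrable_density[OF FT w(1) w'])
  finally show "integrable unit_borel F \<longleftrightarrow> integrable unit_borel (\<lambda>y. w y * F (T y))" by simp
  have "integral\<^sup>L unit_borel F = integral\<^sup>L (distr ?M unit_borel T) F"
    using eq by simp
  also have "\<dots> = integral\<^sup>L ?M (\<lambda>y. F (T y))" by (rule integral_distr[OF T' F])
  also have "\<dots> = (\<integral>y. w y *\<^sub>R F (T y) \<partial>unit_borel)"
    by (rule integral_density[OF FT w(1) w'])
  finally show "integral\<^sup>L unit_borel F = (\<integral>y. w y * F (T y) \<partial>unit_borel)" by simp
qed

text \<open>Change of variables along each branch turns the two summands of \<open>transfer\<close>
  into the integrals of \<open>f y * g (intermittent_map \<gamma> y)\<close> over the left and the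
  right half.\<close>

lemma transfer_duality:
  assumes \<gamma>: "0 < \<gamma>" and f[measurable]: "f \<in> borel_measurable unit_borel"
    and g[measurable]: "g \<in> borel_measurable unit_borel"
    and int: "integrable unit_borel (\<lambda>y. f y * g (intermittent_map \<gamma> y))"
  shows "integrable unit_borel (\<lambda>x. transfer \<gamma> f x * g x)"
    and "(\<integral>x. transfer \<gamma> f x * g x \<partial>unit_borel) = (\<integral>y. f y * g (intermittent_map \<gamma> y) \<partial>unit_borel)"
proof -
  note [measurable] = left_inv_measurable[OF \<gamma>] intermittent_map_measurable_unit[OF \<gamma>]
  have md[measurable]: "map_deriv \<gamma> \<in> borel_measurable unit_borel"
    by (rule borel_measurable_unit_borel) measurable
  have ind[measurable]: "indicat_real {0<..1/2} \<in> borel_measurable unit_borel"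
    "indicat_real {1/2<..1} \<in> borel_measurable unit_borel"
    by (intro borel_measurable_unit_borel; measurable)+
  define F1 where "F1 x = f (left_inv \<gamma> x) / map_deriv \<gamma> (left_inv \<gamma> x) * g x" for x
  define F2 where "F2 x = f ((x + 1) / 2) / 2 * g x" for x
  define H where "H y = f y * g (intermittent_map \<gamma> y)" for y
  have mF: "F1 \<in> borel_measurable unit_borel" "F2 \<in> borel_measurable unit_borel"
    unfolding F1_def[abs_def] F2_def[abs_def] by measurable
  have e1: "map_deriv \<gamma> y * indicator {0<..1/2} y * F1 (intermittent_map \<gamma> y) = indicator {0<..1/2} y * H y"
    for y
    using left_inv_intermittent_map[OF \<gamma>, of y] map_deriv_ge_1[OF \<gamma>, of y]
    by (auto simp: indicator_def F1_def H_def)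
  have e2: "2 * indicator {1/2<..1} y * F2 (intermittent_map \<gamma> y) = indicator {1/2<..1} y * H y" for y
    by (auto simp: indicator_def F2_def H_def intermittent_map_right)
  have "0 \<le> map_deriv \<gamma> y * indicator {0<..1/2} y" for y
    using map_deriv_ge_1[OF \<gamma>, of y] by auto
  note b1 = branch_integral[OF unit_borel_distr_left[OF \<gamma>] intermittent_map_measurable_unit[OF \<gamma>] _ this,
      of F1, unfolded e1, OF borel_measurable_times[OF md ind(1)] mF(1)]
  note b2 = branch_integral[OF unit_borel_distr_right[OF \<gamma>] intermittent_map_measurable_unit[OF \<gamma>],
      of F2, unfolded e2, OF borel_measurable_times[OF borel_measurable_const ind(2)] _ mF(2)]
  have half: "{0<..1/2} \<subseteq> {0<..1::real}" "{1/2<..1} \<subseteq> {0<..1::real}" by auto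
  have i1: "integrable unit_borel (\<lambda>y. indicator {0<..1/2} y * H y)"
    and i2: "integrable unit_borel (\<lambda>y. indicator {1/2<..1} y * H y)"
    using integrable_mult_indicator[OF _ int, of "{0<..1/2}"]
      integrable_mult_indicator[OF _ int, of "{1/2<..1}"]
    using half by (simp_all add: H_def sets_unit_borel)
  have F1: "integrable unit_borel F1"
    using b1(1) i1 by blast
  have F2: "integrable unit_borel F2"
    using b2(1) i2 by simp
  have eq: "transfer \<gamma> f x * g x = F1 x + F2 x" for x
    by (simp add: transfer_def F1_def F2_def algebra_simps)
  show "integrable unit_borel (\<lambda>x. transfer \<gamma> f x * g x)"
    unfolding eq using F1 F2 by (rule Bochner_Integration.integrable_add)
  have "(\<integral>x. transfer \<gamma> f x * g x \<partial>unit_borel) = integral\<^sup>L unit_borel F1 + integral\<^sup>L unit_borel F2"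
    unfolding eq using F1 F2 by (rule Bochner_Integration.integral_add)
  also have "integral\<^sup>L unit_borel F1 = (\<integral>y. indicator {0<..1/2} y * H y \<partial>unit_borel)"
    by (rule b1(2))
  also have "integral\<^sup>L unit_borel F2 = (\<integral>y. indicator {1/2<..1} y * H y \<partial>unit_borel)"
    by (rule b2(2)) simp
  also have "(\<integral>y. indicator {0<..1/2} y * H y \<partial>unit_borel) + (\<integral>y. indicator {1/2<..1} y * H y \<partial>unit_borel)
     = (\<integral>y. indicator {0<..1/2} y * H y + indicator {1/2<..1} y * H y \<partial>unit_borel)"
    using i1 i2 by (rule Bochner_Integration.integral_add[symmetric])
  also have "\<dots> = integral\<^sup>L unit_borel H"
    by (rule Bochner_Integration.integral_cong) (auto simp: indicator_def)
  finally show "(\<integral>x. transfer \<gamma> f x * g x \<partial>unit_borel) = (\<integral>y. f y * g (intermittent_map \<gamma> y) \<partial>unit_borel)"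
    unfolding H_def .
qed

primrec transfers :: "(nat \<Rightarrow> real) \<Rightarrow> nat \<Rightarrow> (real \<Rightarrow> real) \<Rightarrow> real \<Rightarrow> real" where
  "transfers a 0 f = f"
| "transfers a (Suc j) f = transfer (a (Suc j)) (transfers a j f)"

lemma transfers_measurable:
  assumes "\<And>j. 1 \<le> j \<Longrightarrow> 0 < a j" "f \<in> borel_measurable unit_borel"
  shows "transfers a n f \<in> borel_measurable unit_borel"
  by (induction n) (use assms in \<open>simp_all add: transfer_measurable\<close>)

lemma seq_map_measurable [measurable]: "seq_map a n \<in> borel_measurable borel"
  by (induction n) (auto simp: id_def comp_def intro: measurable_compose[OF _ intermittent_map_measurable])

lemma seq_map_unit_measurable:
  assumes "\<And>j. 1 \<le> j \<Longrightarrow> 0 < a j"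
  shows "seq_map a n \<in> measurable unit_borel unit_borel"
proof (induction n)
  case (Suc n)
  show ?case unfolding seq_map.simps
    by (rule measurable_comp[OF Suc intermittent_map_measurable_unit]) (use assms in simp)
qed (simp add: id_def)

lemma seq_map_unit:
  assumes "\<And>j. 1 \<le> j \<Longrightarrow> 0 < a j" "x \<in> {0<..1}"
  shows "seq_map a n x \<in> {0<..1}"
  using measurable_space[OF seq_map_unit_measurable[of a n]] assms by simp

lemma transfers_duality:
  assumes a: "\<And>j. 1 \<le> j \<Longrightarrow> 0 < a j" and f[measurable]: "f \<in> borel_measurable unit_borel"
    and g: "g \<in> borel_measurable unit_borel"
    and int: "integrable unit_borel (\<lambda>y. f y * g (seq_map a n y))"
  shows "integrable unit_borel (\<lambda>x. transfers a n f x * g x)"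
    and "(\<integral>x. transfers a n f x * g x \<partial>unit_borel) = (\<integral>y. f y * g (seq_map a n y) \<partial>unit_borel)"
proof -
  have "integrable unit_borel (\<lambda>x. transfers a n f x * g x) \<and>
     (\<integral>x. transfers a n f x * g x \<partial>unit_borel) = (\<integral>y. f y * g (seq_map a n y) \<partial>unit_borel)"
    using g int
  proof (induction n arbitrary: g)
    case (Suc n g)
    have an: "0 < a (Suc n)" using a by simp
    have m: "(\<lambda>y. g (intermittent_map (a (Suc n)) y)) \<in> borel_measurable unit_borel"
      using intermittent_map_measurable_unit[OF an] Suc.prems(1) by measurable
    note IH = Suc.IH[OF m]
    have i: "integrable unit_borel (\<lambda>y. f y * g (intermittent_map (a (Suc n)) (seq_map a n y)))"
      using Suc.prems(2) by simp
    note d = transfer_duality[OF an transfers_measurable[OF a f] Suc.prems(1)]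
    show ?case using IH[OF i] d by simp
  qed auto
  thus "integrable unit_borel (\<lambda>x. transfers a n f x * g x)"
    and "(\<integral>x. transfers a n f x * g x \<partial>unit_borel) = (\<integral>y. f y * g (seq_map a n y) \<partial>unit_borel)"
    by auto
qed

text \<open>A later block of maps is again an orbit, for the shifted parameters. This is why the
  estimates below are proved for all sequences at once.\<close>

lemma seq_map_add: "seq_map a (k + n) x = seq_map (\<lambda>j. a (j + k)) n (seq_map a k x)"
  by (induction n) (auto simp: add_ac)

lemma transfers_add: "transfers a (k + n) f = transfers (\<lambda>j. a (j + k)) n (transfers a k f)"
  by (induction n) (auto simp: add_ac)

lemma seq_map_Suc_front: "seq_map a (Suc n) x = seq_map (\<lambda>j. a (Suc j)) n (intermittent_map (a 1) x)"
  using seq_map_add[of a 1 n x] by simp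

lemma transfers_Suc_front: "transfers a (Suc n) f = transfers (\<lambda>j. a (Suc j)) n (transfer (a 1) f)"
  using transfers_add[of a 1 n f] by simp

lemma transfer_lincomb: "transfer \<gamma> (\<lambda>x. c * f x + d * g x) = (\<lambda>x. c * transfer \<gamma> f x + d * transfer \<gamma> g x)"
  by (simp add: transfer_def fun_eq_iff add_divide_distrib distrib_left)

lemma transfers_lincomb:
  "transfers a n (\<lambda>x. c * f x + d * g x) = (\<lambda>x. c * transfers a n f x + d * transfers a n g x)"
  by (induction n) (simp_all add: transfer_lincomb)

lemma transfers_add_const:
  "transfers a n (\<lambda>x. f x + c) x = transfers a n f x + c * transfers a n (\<lambda>_. 1) x"
  using transfers_lincomb[of a n 1 f c "\<lambda>_. 1"] by (simp add: fun_eq_iff)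

lemma transfers_diff:
  "transfers a n (\<lambda>x. f x - g x) x = transfers a n f x - transfers a n g x"
  using transfers_lincomb[of a n 1 f "-1" g] by (simp add: fun_eq_iff)

lemma transfer_mono:
  assumes "0 < \<gamma>" "\<And>x. x \<in> {0<..1} \<Longrightarrow> f x \<le> g x" "x \<in> {0<..1}"
  shows "transfer \<gamma> f x \<le> transfer \<gamma> g x"
  using assms(2)[of "left_inv \<gamma> x"] assms(2)[of "(x+1)/2"] left_inv_range[OF assms(1,3)] assms(3)
    map_deriv_ge_1[OF assms(1), of "left_inv \<gamma> x"]
  unfolding transfer_def by (intro add_mono divide_right_mono) auto

lemma transfers_mono:
  assumes "\<And>j. 1 \<le> j \<Longrightarrow> 0 < a j" "\<And>x. x \<in> {0<..1} \<Longrightarrow> f x \<le> g x" "x \<in> {0<..1}"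
  shows "transfers a n f x \<le> transfers a n g x"
  using assms(3) by (induction n arbitrary: x) (use assms in \<open>auto intro!: transfer_mono\<close>)

section \<open>Loss of memory\<close>

lemma indicator_unit_borel_measurable [measurable]:
  "A \<in> sets borel \<Longrightarrow> indicat_real A \<in> borel_measurable unit_borel"
  by (intro borel_measurable_unit_borel borel_measurable_indicator)

lemma integral_indicator_unit_borel:
  assumes "0 \<le> s" "s \<le> t" "t \<le> 1"
  shows "(\<integral>x. indicat_real {s<..t} x \<partial>unit_borel) = t - s"
proof -
  have sub: "{s<..t} \<subseteq> {0<..1}" using assms by auto
  hence "{s<..t} \<in> sets unit_borel" by (simp add: sets_unit_borel)
  moreover have "measure unit_borel {s<..t} = t - s"
    using assms calculation by (simp add: measure_def emeasure_unit_borel)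
  ultimately show ?thesis
    using Int_absorb2[OF sub] by (simp only: Bochner_Integration.integral_indicator space_unit_borel)
qed

lemma integrable_bounded_mult_unit_borel:
  fixes f g :: "real \<Rightarrow> real"
  assumes "integrable unit_borel f" "g \<in> borel_measurable unit_borel"
    "\<And>x. x \<in> {0<..1} \<Longrightarrow> \<bar>g x\<bar> \<le> B"
  shows "integrable unit_borel (\<lambda>x. f x * g x)"
proof (rule Bochner_Integration.integrable_bound)
  show "integrable unit_borel (\<lambda>x. B * \<bar>f x\<bar>)" using assms by simp
  show "(\<lambda>x. f x * g x) \<in> borel_measurable unit_borel" using assms by measurable
  show "AE x in unit_borel. norm (f x * g x) \<le> norm (B * \<bar>f x\<bar>)"
  proof (intro AE_I2)
    fix x assume "x \<in> space unit_borel"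
    hence "\<bar>g x\<bar> \<le> \<bar>B\<bar>" using assms(3)[of x] by simp
    hence "\<bar>f x\<bar> * \<bar>g x\<bar> \<le> \<bar>f x\<bar> * \<bar>B\<bar>" by (rule mult_left_mono) simp
    thus "norm (f x * g x) \<le> norm (B * \<bar>f x\<bar>)" by (simp add: abs_mult mult.commute)
  qed
qed

lemma integral_mono_unit_borel:
  fixes f g :: "real \<Rightarrow> real"
  assumes "integrable unit_borel f" "integrable unit_borel g" "\<And>x. x \<in> {0<..1} \<Longrightarrow> f x \<le> g x"
  shows "integral\<^sup>L unit_borel f \<le> integral\<^sup>L unit_borel g"
  using assms by (intro integral_mono) auto

lemma has_bochner_integral_powr_unit_borel:
  fixes \<alpha> :: real
  assumes "\<alpha> < 1" "0 \<le> z" "z \<le> 1"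
  shows "has_bochner_integral unit_borel (\<lambda>x. x powr (- \<alpha>) * indicator {0<..z} x) (z powr (1 - \<alpha>) / (1 - \<alpha>))"
proof -
  have "((\<lambda>x. x powr (- \<alpha>)) has_integral (z powr (- \<alpha> + 1) / (- \<alpha> + 1))) {0..z}"
    using assms by (intro has_integral_powr_from_0) auto
  hence "((\<lambda>x. if x \<in> {0..z} then x powr (- \<alpha>) else 0) has_integral (z powr (1 - \<alpha>) / (1 - \<alpha>))) UNIV"
    by (simp add: has_integral_restrict_UNIV add.commute del: atLeastAtMost_iff)
  hence "has_bochner_integral lborel (\<lambda>x. if x \<in> {0..z} then x powr (- \<alpha>) else 0) (z powr (1 - \<alpha>) / (1 - \<alpha>))"
    by (intro has_bochner_integral_nn_integral nn_integral_has_integral_lborel)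
       (use assms in \<open>auto intro!: divide_nonneg_pos\<close>)
  also have "?this \<longleftrightarrow> has_bochner_integral lborel (\<lambda>x. indicator {0<..1} x *\<^sub>R (x powr (- \<alpha>) * indicator {0<..z} x)) (z powr (1 - \<alpha>) / (1 - \<alpha>))"
    by (rule has_bochner_integral_cong) (use assms in \<open>auto simp: indicator_def\<close>)
  finally show ?thesis
    unfolding unit_borel_def by (subst has_bochner_integral_restrict_space) auto
qed

lemma integrable_powr_unit_borel:
  assumes "\<alpha> < 1" shows "integrable unit_borel (\<lambda>x. x powr (- \<alpha>))"
proof -
  have "integrable unit_borel (\<lambda>x. x powr (- \<alpha>) * indicator {0<..1} x)"
    using has_bochner_integral_powr_unit_borel[of \<alpha> 1] assms by (auto simp: has_bochner_integral_iff)
  also have "?this \<longleftrightarrow> ?thesis"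
    by (rule Bochner_Integration.integrable_cong) auto
  finally show ?thesis .
qed

lemma integral_powr_unit_borel:
  assumes "\<alpha> < 1" "0 \<le> z" "z \<le> 1"
  shows "(\<integral>x. x powr (- \<alpha>) * indicator {0<..z} x \<partial>unit_borel) = z powr (1 - \<alpha>) / (1 - \<alpha>)"
  using has_bochner_integral_powr_unit_borel[OF assms] by (rule has_bochner_integral_integral_eq)

section \<open>The cone of decreasing densities\<close>

locale intermittent_family =
  fixes \<alpha> :: real
  assumes alpha_pos: "0 < \<alpha>" and alpha_less_1: "\<alpha> < 1"
begin

definition admissible :: "(nat \<Rightarrow> real) \<Rightarrow> bool" where
  "admissible a \<longleftrightarrow> (\<forall>j\<ge>1. 0 < a j \<and> a j \<le> \<alpha>)"

lemma admissible_shift: "admissible a \<Longrightarrow> admissible (\<lambda>j. a (j + k))"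
  by (simp add: admissible_def)

lemma admissible_pos: "admissible a \<Longrightarrow> 1 \<le> j \<Longrightarrow> 0 < a j"
  by (simp add: admissible_def)

text \<open>Its inverse is the gain that the left branch leaves in
  \<open>cone_left_branch_bound\<close>. In \<open>transfer_cone\<close> this gain has to absorb the
  contribution of the right branch, which is at most the mass.\<close>

definition cone_const :: real where "cone_const = 6 / (1 - \<alpha>)"

lemma cone_const_ge_1: "1 \<le> cone_const"
  using alpha_pos alpha_less_1 by (simp add: cone_const_def)

text \<open>
  Membership is preserved when a constant is subtracted: the bound by \<open>A x\<^sup>-\<^sup>\<alpha>\<close> is absolute,
  not relative to the mass of the function.
\<close>

definition decr_cone :: "real \<Rightarrow> (real \<Rightarrow> real) \<Rightarrow> bool" where
  "decr_cone A f \<longleftrightarrow> antimono_on {0<..1} f \<and> (\<forall>x\<in>{0<..1}. 0 \<le> f x \<and> f x \<le> A * x powr (- \<alpha>)) \<and>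
     cone_const * integral\<^sup>L unit_borel f \<le> A"

lemma coneI:
  assumes "\<And>x y. 0 < x \<Longrightarrow> x \<le> y \<Longrightarrow> y \<le> 1 \<Longrightarrow> f y \<le> f x"
    "\<And>x. x \<in> {0<..1} \<Longrightarrow> 0 \<le> f x" "\<And>x. x \<in> {0<..1} \<Longrightarrow> f x \<le> A * x powr (- \<alpha>)"
    "cone_const * integral\<^sup>L unit_borel f \<le> A"
  shows "decr_cone A f"
  using assms by (auto simp: decr_cone_def monotone_on_def)

lemma
  assumes "decr_cone A f"
  shows cone_antimono: "0 < x \<Longrightarrow> x \<le> y \<Longrightarrow> y \<le> 1 \<Longrightarrow> f y \<le> f x"
    and cone_nonneg: "x \<in> {0<..1} \<Longrightarrow> 0 \<le> f x"
    and cone_bound: "x \<in> {0<..1} \<Longrightarrow> f x \<le> A * x powr (- \<alpha>)"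
    and cone_mass: "cone_const * integral\<^sup>L unit_borel f \<le> A"
    and cone_measurable: "f \<in> borel_measurable unit_borel"
  using assms by (auto simp: decr_cone_def monotone_on_def intro!: antimono_measurable_unit_borel)

lemma cone_integrable:
  assumes "decr_cone A f" shows "integrable unit_borel f"
proof (rule Bochner_Integration.integrable_bound)
  show "integrable unit_borel (\<lambda>x. A * x powr (- \<alpha>))"
    using integrable_powr_unit_borel[OF alpha_less_1] by simp
  show "f \<in> borel_measurable unit_borel" by (rule cone_measurable[OF assms])
  show "AE x in unit_borel. norm (f x) \<le> norm (A * x powr (- \<alpha>))"
    using cone_nonneg[OF assms] cone_bound[OF assms] by (intro AE_I2) force
qed

lemma cone_integral_nonneg: "decr_cone A f \<Longrightarrow> 0 \<le> integral\<^sup>L unit_borel f"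
  by (intro Bochner_Integration.integral_nonneg_AE AE_I2) (simp add: cone_nonneg)

lemma cone_A_nonneg: "decr_cone A f \<Longrightarrow> 0 \<le> A"
  using cone_bound[of A f 1] cone_nonneg[of A f 1] by simp

lemma cone_integrable_indicator:
  "decr_cone A f \<Longrightarrow> B \<in> sets borel \<Longrightarrow> integrable unit_borel (\<lambda>x. f x * indicator B x)"
  by (rule integrable_bounded_mult_unit_borel[OF cone_integrable, of _ _ _ 1])
     (auto simp: indicator_le_1)

text \<open>A decreasing function is at least \<open>f z\<close> on all of (0, z]. With z = 1/2 this
  bounds every value on the right half by twice the mass.\<close>

lemma cone_average_left:
  assumes "decr_cone A f" "z \<in> {0<..1}" shows "z * f z \<le> integral\<^sup>L unit_borel f"
proof -
  have "z * f z = (\<integral>x. f z * indicator {0<..z} x \<partial>unit_borel)"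
    using assms integral_indicator_unit_borel[of 0 z] by simp
  also have "\<dots> \<le> integral\<^sup>L unit_borel f"
    using assms cone_antimono[OF assms(1), of _ z] cone_nonneg[OF assms(1)]
    by (intro integral_mono_unit_borel cone_integrable[OF assms(1)]
        integrable_bounded_mult_unit_borel[where B=1]) (auto split: split_indicator)
  finally show ?thesis .
qed

lemma cone_average_right:
  assumes "decr_cone A f" "z \<in> {0<..1}"
  shows "(\<integral>x. f x * indicator {z<..1} x \<partial>unit_borel) \<le> (1 - z) * f z"
proof -
  have "(\<integral>x. f x * indicator {z<..1} x \<partial>unit_borel) \<le> (\<integral>x. f z * indicator {z<..1} x \<partial>unit_borel)"
    using assms cone_antimono[OF assms(1), of z]
    by (intro integral_mono_unit_borel cone_integrable_indicator[OF assms(1)]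
        integrable_bounded_mult_unit_borel[where B=1]) (auto split: split_indicator)
  also have "\<dots> = (1 - z) * f z"
    using assms integral_indicator_unit_borel[of z 1] by simp
  finally show ?thesis .
qed

lemma cone_diff_const:
  assumes "decr_cone A f" "0 \<le> c" "\<And>x. x \<in> {0<..1} \<Longrightarrow> c \<le> f x"
  shows "decr_cone A (\<lambda>x. f x - c)" and "(\<integral>x. f x - c \<partial>unit_borel) = integral\<^sup>L unit_borel f - c"
proof -
  show i: "(\<integral>x. f x - c \<partial>unit_borel) = integral\<^sup>L unit_borel f - c"
    using cone_integrable[OF assms(1)] by simp
  have "cone_const * integral\<^sup>L unit_borel f - cone_const * c \<le> A"
    using cone_mass[OF assms(1)] mult_nonneg_nonneg[of cone_const c] cone_const_ge_1 assms(2) by linarith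
  thus "decr_cone A (\<lambda>x. f x - c)"
    using cone_antimono[OF assms(1)] cone_bound[OF assms(1)] assms(2,3) i
    by (intro coneI) (force simp: right_diff_distrib)+
qed

text \<open>This is how an observable enters the cone: after a decomposition into decreasing
  factors, an observable times a density stays in a cone whose constant grows only by the bound of
  the factor.\<close>

lemma cone_mult:
  assumes f: "decr_cone A f" and u: "\<And>x y. 0 < x \<Longrightarrow> x \<le> y \<Longrightarrow> y \<le> 1 \<Longrightarrow> u y \<le> u x"
    and u0: "\<And>x. x \<in> {0<..1} \<Longrightarrow> 0 \<le> u x" and uc: "\<And>x. x \<in> {0<..1} \<Longrightarrow> u x \<le> c"
  shows "decr_cone (c * A) (\<lambda>x. u x * f x)"
proof (rule coneI)
  have c: "0 \<le> c" using u0[of 1] uc[of 1] by simp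
  fix x :: real assume x: "x \<in> {0<..1}"
  show "0 \<le> u x * f x" using u0[OF x] cone_nonneg[OF f x] by simp
  have "u x * f x \<le> c * (A * x powr (- \<alpha>))"
    using uc[OF x] cone_bound[OF f x] cone_nonneg[OF f x] c by (intro mult_mono) auto
  thus "u x * f x \<le> c * A * x powr (- \<alpha>)" by simp
next
  fix x y :: real assume xy: "0 < x" "x \<le> y" "y \<le> 1"
  show "u y * f y \<le> u x * f x"
    using xy u0[of x] by (intro mult_mono u cone_antimono[OF f] cone_nonneg[OF f]) auto
next
  have c: "0 \<le> c" using u0[of 1] uc[of 1] by simp
  have um: "u \<in> borel_measurable unit_borel"
    using u by (intro antimono_measurable_unit_borel) (auto simp: monotone_on_def)
  have i: "integrable unit_borel (\<lambda>x. f x * u x)"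
    using u0 uc by (intro integrable_bounded_mult_unit_borel[OF cone_integrable[OF f] um, of c]) auto
  have "(\<integral>x. u x * f x \<partial>unit_borel) \<le> (\<integral>x. c * f x \<partial>unit_borel)"
  proof (rule integral_mono_unit_borel)
    show "integrable unit_borel (\<lambda>x. u x * f x)" using i by (simp add: mult.commute)
    show "u x * f x \<le> c * f x" if "x \<in> {0<..1}" for x
      using uc[OF that] cone_nonneg[OF f that] by (rule mult_right_mono)
  qed (use cone_integrable[OF f] in simp)
  hence "cone_const * (\<integral>x. u x * f x \<partial>unit_borel) \<le> c * (cone_const * integral\<^sup>L unit_borel f)"
    using cone_const_ge_1 mult_left_mono[of "\<integral>x. u x * f x \<partial>unit_borel" "c * integral\<^sup>L unit_borel f" cone_const]
    by (simp add: mult_ac)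
  also have "\<dots> \<le> c * A" using cone_mass[OF f] c by (rule mult_left_mono)
  finally show "cone_const * (\<integral>x. u x * f x \<partial>unit_borel) \<le> c * A" .
qed

lemma integral_transfer:
  assumes "0 < \<gamma>" "integrable unit_borel f"
  shows "integral\<^sup>L unit_borel (transfer \<gamma> f) = integral\<^sup>L unit_borel f"
  using transfer_duality(2)[OF assms(1) borel_measurable_integrable[OF assms(2)], of "\<lambda>_. 1"] assms(2)
  by simp

text \<open>With \<open>u = (2 y)\<^sup>\<gamma>\<close>, the point \<open>y\<close> is mapped to \<open>y (1 + u)\<close> with derivative \<open>1 + (1 + \<gamma>) u\<close>.\<close>

lemma cone_left_branch_bound:
  assumes "0 < \<gamma>" "\<gamma> \<le> \<alpha>" "0 < y" "y \<le> 1/2"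
  shows "y powr (- \<alpha>) / map_deriv \<gamma> y + 1 / cone_const \<le> (intermittent_map \<gamma> y) powr (- \<alpha>)"
proof -
  define u where "u = (2 * y) powr \<gamma>"
  have u: "0 < u" "u \<le> 1" using assms by (auto simp: u_def intro!: powr_le1)
  have g1: "\<gamma> < 1" using assms alpha_less_1 by simp
  \<comment> \<open>Young's inequality against the number 1 is Bernoulli's inequality for an
    exponent below 1.\<close>
  have "(1 + u) powr \<alpha> * 1 powr (1 - \<alpha>) \<le> \<alpha> * (1 + u) + (1 - \<alpha>) * 1"
    using alpha_pos alpha_less_1 u by (intro Youngs_inequality_0) auto
  hence *: "(1 + u) powr \<alpha> \<le> 1 + \<alpha> * u" by (simp add: algebra_simps)
  \<comment> \<open>Here \<gamma> \<le> \<alpha> enters: the exponent \<gamma> - \<alpha> is not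
    positive, so this quantity stays at least 1 as y tends to 0, and the gain below is bounded away
    from 0.\<close>
  have "2 powr \<alpha> * (2 * y) powr (\<gamma> - \<alpha>) = y powr (- \<alpha>) * u"
    using assms by (simp add: u_def powr_mult powr_diff powr_minus field_simps)
  moreover have "1 * 1 \<le> 2 powr \<alpha> * (2 * y) powr (\<gamma> - \<alpha>)"
  proof (rule mult_mono)
    show "1 \<le> 2 powr \<alpha>" using alpha_pos by (simp add: ge_one_powr_ge_zero)
    have "1 powr (\<gamma> - \<alpha>) \<le> (2 * y) powr (\<gamma> - \<alpha>)" using assms by (intro powr_mono2') auto
    thus "1 \<le> (2 * y) powr (\<gamma> - \<alpha>)" by simp
  qed auto
  ultimately have yu: "1 \<le> y powr (- \<alpha>) * u" by simp
  define p q where "p = 1 + \<alpha> * u" and "q = 1 + (1 + \<gamma>) * u"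
  have p: "0 < p" "p \<le> 2"
    using u alpha_pos alpha_less_1 mult_mono[of \<alpha> 1 u 1] by (auto simp: p_def add_pos_nonneg)
  have q: "0 < q" "q \<le> 3"
    using u assms g1 mult_mono[of "1 + \<gamma>" 2 u 1] by (auto simp: q_def add_pos_nonneg)
  \<comment> \<open>The gain is the difference of \<open>y powr (- \<alpha>)\<close> divided by p
    and by q, where q - p = (1 + \<gamma> - \<alpha>) * u. The bounds 2 for p and 3 for q produce
    the 6 of \<open>cone_const\<close>.\<close>
  have "(1 - \<alpha>) / 6 \<le> (1 - \<alpha>) * (y powr (- \<alpha>) * u) / (p * q)"
  proof (rule frac_le)
    show "1 - \<alpha> \<le> (1 - \<alpha>) * (y powr (- \<alpha>) * u)"
      using yu alpha_less_1 by (simp add: mult_le_cancel_left1)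
    show "p * q \<le> 6" using mult_mono[OF p(2) q(2)] p q by simp
  qed (use p q alpha_less_1 yu in auto)
  also have "\<dots> \<le> y powr (- \<alpha>) * ((1 + \<gamma> - \<alpha>) * u) / (p * q)"
    using assms u p q by (intro divide_right_mono) (auto simp: mult_ac intro!: mult_mono)
  also have "\<dots> = y powr (- \<alpha>) / p - y powr (- \<alpha>) / q"
    using p q by (simp add: divide_simps) (simp add: p_def q_def algebra_simps)
  also have "y powr (- \<alpha>) / p \<le> y powr (- \<alpha>) / (1 + u) powr \<alpha>"
    using * u p by (intro divide_left_mono) (auto simp: p_def)
  also have "\<dots> = (intermittent_map \<gamma> y) powr (- \<alpha>)"
    using assms unfolding u_def
    by (subst intermittent_map_left) (simp_all add: powr_mult powr_minus_divide)
  finally have "y powr (- \<alpha>) / q + (1 - \<alpha>) / 6 \<le> (intermittent_map \<gamma> y) powr (- \<alpha>)" by linarith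
  moreover have "1 / cone_const = (1 - \<alpha>) / 6" by (simp add: cone_const_def)
  ultimately show ?thesis by (simp only: map_deriv_def q_def u_def)
qed

text \<open>Monotonicity survives because both inverse branches and the derivative increase. For the
  envelope, the right branch contributes at most half of f(1/2), hence at most the mass, hence at
  most A / \<open>cone_const\<close>; the left branch maps the envelope below itself by exactly this
  margin.\<close>

lemma transfer_cone:
  assumes g: "0 < \<gamma>" "\<gamma> \<le> \<alpha>" and f: "decr_cone A f"
  shows "decr_cone A (transfer \<gamma> f)"
proof (rule coneI)
  show "cone_const * integral\<^sup>L unit_borel (transfer \<gamma> f) \<le> A"
    using cone_mass[OF f] integral_transfer[OF g(1) cone_integrable[OF f]] by simp
next
  fix x y :: real assume xy: "0 < x" "x \<le> y" "y \<le> 1"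
  have r: "left_inv \<gamma> x \<in> {0<..1/2}" "left_inv \<gamma> y \<in> {0<..1/2}" "left_inv \<gamma> x \<le> left_inv \<gamma> y"
    using xy left_inv_range[OF g(1)] left_inv_mono[OF g(1)] by auto
  have "f (left_inv \<gamma> y) / map_deriv \<gamma> (left_inv \<gamma> y) \<le> f (left_inv \<gamma> x) / map_deriv \<gamma> (left_inv \<gamma> x)"
  proof (rule frac_le)
    show "f (left_inv \<gamma> y) \<le> f (left_inv \<gamma> x)" using r by (intro cone_antimono[OF f]) auto
    show "0 \<le> f (left_inv \<gamma> x)" using r by (intro cone_nonneg[OF f]) auto
    show "0 < map_deriv \<gamma> (left_inv \<gamma> x)" using map_deriv_ge_1[OF g(1), of "left_inv \<gamma> x"] by simp
    show "map_deriv \<gamma> (left_inv \<gamma> x) \<le> map_deriv \<gamma> (left_inv \<gamma> y)"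
      using r g by (intro map_deriv_mono) auto
  qed
  moreover have "f ((y + 1) / 2) \<le> f ((x + 1) / 2)" using xy by (intro cone_antimono[OF f]) auto
  ultimately show "transfer \<gamma> f y \<le> transfer \<gamma> f x" unfolding transfer_def by simp
next
  fix x :: real assume x: "x \<in> {0<..1}"
  define y where "y = left_inv \<gamma> x"
  have y: "0 < y" "y \<le> 1/2" using left_inv_range[OF g(1) x] by (auto simp: y_def)
  have d: "1 \<le> map_deriv \<gamma> y" by (rule map_deriv_ge_1[OF g(1)])
  show "0 \<le> transfer \<gamma> f x"
    unfolding transfer_def y_def[symmetric] using x y d
    by (intro add_nonneg_nonneg divide_nonneg_nonneg cone_nonneg[OF f]) auto
  have "f ((x + 1) / 2) / 2 \<le> 1/2 * f (1/2)"
    using cone_antimono[OF f, of "1/2" "(x+1)/2"] x by simp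
  also have "\<dots> \<le> integral\<^sup>L unit_borel f" by (rule cone_average_left[OF f]) simp
  also have "\<dots> \<le> A / cone_const"
    using cone_mass[OF f] cone_const_ge_1 by (simp add: field_simps)
  finally have 2: "f ((x + 1) / 2) / 2 \<le> A / cone_const" .
  have 1: "f y / map_deriv \<gamma> y \<le> A * y powr (- \<alpha>) / map_deriv \<gamma> y"
    using d y by (intro divide_right_mono cone_bound[OF f]) auto
  have "transfer \<gamma> f x \<le> A * (y powr (- \<alpha>) / map_deriv \<gamma> y + 1 / cone_const)"
    unfolding transfer_def y_def[symmetric] using add_mono[OF 1 2] by (simp only: distrib_left) simp
  also have "\<dots> \<le> A * (intermittent_map \<gamma> y) powr (- \<alpha>)"
    using cone_left_branch_bound[OF g y] cone_A_nonneg[OF f] by (intro mult_left_mono)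
  also have "intermittent_map \<gamma> y = x" unfolding y_def by (rule intermittent_map_left_inv[OF g(1) x])
  finally show "transfer \<gamma> f x \<le> A * x powr (- \<alpha>)" .
qed

lemma transfers_cone:
  assumes "admissible a" "decr_cone A f"
  shows "decr_cone A (transfers a n f)"
  by (induction n) (use assms in \<open>simp_all add: admissible_def transfer_cone\<close>)

lemma integral_transfers:
  assumes "admissible a" "integrable unit_borel f"
  shows "integral\<^sup>L unit_borel (transfers a n f) = integral\<^sup>L unit_borel f"
proof -
  have "0 < a j" if "1 \<le> j" for j using assms(1) that by (rule admissible_pos)
  note d = transfers_duality(2)[OF this borel_measurable_integrable[OF assms(2)], where g="\<lambda>_. 1" and n=n]
  show ?thesis using d assms(2) by simp
qed

section \<open>Escape from the neutral fixed point\<close>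

definition staying :: "(nat \<Rightarrow> real) \<Rightarrow> nat \<Rightarrow> real set" where
  "staying a k = {x. \<forall>i<k. seq_map a i x \<le> 1/2}"

lemma staying_borel [measurable]: "staying a k \<in> sets borel"
proof -
  have "staying a k = (\<Inter>i\<in>{..<k}. {x. seq_map a i x \<le> 1/2}) \<inter> UNIV"
    by (auto simp: staying_def)
  also have "\<dots> \<in> sets borel"
    by (cases "k = 0") (auto intro!: sets.finite_INT borel_measurable_le)
  finally show ?thesis .
qed

lemma staying_Suc_iff:
  "x \<in> staying a (Suc k) \<longleftrightarrow> x \<le> 1/2 \<and> intermittent_map (a 1) x \<in> staying (\<lambda>j. a (Suc j)) k"
  unfolding staying_def mem_Collect_eq
  by (subst All_less_Suc2) (simp add: seq_map_Suc_front del: seq_map.simps(2))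

text \<open>In the coordinate \<open>(2 * x) powr (- \<alpha>)\<close> the neutral fixed point lies
  at infinity and the left branch moves every point towards it by no more than a negative amount: it
  is close to a translation. A smaller \<gamma> pushes a point further, as
  \<open>(2 * x) powr \<gamma>\<close> is then larger, so \<alpha> is the worst case.\<close>

lemma escape_step:
  assumes "0 < \<gamma>" "\<gamma> \<le> \<alpha>" "0 < x" "x \<le> 1/2"
  shows "(2 * intermittent_map \<gamma> x) powr (- \<alpha>) \<le> (2 * x) powr (- \<alpha>) - \<alpha> / 2"
proof -
  define s where "s = (2 * x) powr \<alpha>"
  have s: "0 < s" "s \<le> 1" using assms alpha_pos by (auto simp: s_def intro!: powr_le1)
  have "s \<le> (2 * x) powr \<gamma>" unfolding s_def using assms by (intro powr_mono') auto
  hence "x * (1 + s) \<le> intermittent_map \<gamma> x"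
    using assms by (simp add: intermittent_map_left)
  hence "(2 * intermittent_map \<gamma> x) powr (- \<alpha>) \<le> (2 * x * (1 + s)) powr (- \<alpha>)"
    using assms s alpha_pos by (intro powr_mono2') auto
  also have "\<dots> = (1 / s) * (1 / (1 + s)) powr \<alpha>"
    by (simp add: powr_mult s_def powr_minus_divide powr_divide)
  also have "\<dots> \<le> (1 / s) * (1 - \<alpha> / 2 * s)"
  proof (rule mult_left_mono)
    \<comment> \<open>Young's inequality against 1 once more. The linear bound 1/(1 + s) \<le> 1 -
      s/2 on the unit interval is the origin of the 2 in \<open>\<alpha> / 2\<close>.\<close>
    have "(1 / (1 + s)) powr \<alpha> * 1 powr (1 - \<alpha>) \<le> \<alpha> * (1 / (1 + s)) + (1 - \<alpha>) * 1"
      using s alpha_pos alpha_less_1 by (intro Youngs_inequality_0) auto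
    also have "1 / (1 + s) \<le> 1 - s / 2"
    proof -
      have "s * s \<le> s" using mult_left_mono[of s 1 s] s by simp
      thus ?thesis using s by (simp add: field_simps)
    qed
    finally show "(1 / (1 + s)) powr \<alpha> \<le> 1 - \<alpha> / 2 * s"
      using alpha_pos by (simp add: algebra_simps)
  qed (use s in auto)
  also have "\<dots> = (2 * x) powr (- \<alpha>) - \<alpha> / 2"
    using s by (simp add: right_diff_distrib powr_minus_divide s_def)
  finally show ?thesis .
qed

lemma escape_bound:
  assumes a: "admissible a" and x: "x \<in> {0<..1}" and k: "x \<in> staying a k"
  shows "\<alpha> / 2 * real k \<le> (2 * x) powr (- \<alpha>)"
proof -
  have "(2 * seq_map a i x) powr (- \<alpha>) \<le> (2 * x) powr (- \<alpha>) - \<alpha> / 2 * real i" if "i \<le> k" for i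
    using that
  proof (induction i)
    case (Suc i)
    have "seq_map a i x \<in> {0<..1}" using a x by (intro seq_map_unit) (auto simp: admissible_def)
    moreover have "seq_map a i x \<le> 1/2" using k Suc.prems by (simp add: staying_def)
    ultimately have "(2 * seq_map a (Suc i) x) powr (- \<alpha>) \<le> (2 * seq_map a i x) powr (- \<alpha>) - \<alpha> / 2"
      using a by (simp add: escape_step admissible_def)
    moreover have "(2 * seq_map a i x) powr (- \<alpha>) \<le> (2 * x) powr (- \<alpha>) - \<alpha> / 2 * real i"
      using Suc by simp
    moreover have "\<alpha> / 2 * real (Suc i) = \<alpha> / 2 + \<alpha> / 2 * real i" by (simp add: field_simps)
    ultimately show ?case by linarith
  qed simp
  from this[of k] show ?thesis using powr_ge_zero[of "2 * seq_map a k x" "- \<alpha>"] by linarith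
qed

definition decay_exp :: real where "decay_exp = 1 / \<alpha> - 1"

lemma decay_exp_pos: "0 < decay_exp"
  using alpha_pos alpha_less_1 by (simp add: decay_exp_def)

text \<open>By \<open>escape_bound\<close> the staying points lie in an interval (0, z] with z of
  order k^(-1/\<alpha>). Integrating the envelope A * x^-\<alpha> over it gives order z^(1 -
  \<alpha>), that is k to the power -(1/\<alpha> - 1): the decay exponent originates here.\<close>

lemma staying_mass:
  assumes a: "admissible a" and f: "decr_cone A f" and k: "1 \<le> k"
  shows "(\<integral>x. f x * indicator (staying a k) x \<partial>unit_borel)
     \<le> A * ((\<alpha> / 2) powr (- decay_exp) / (1 - \<alpha>)) * real k powr (- decay_exp)"
proof -
  define w where "w = (\<alpha> / 2 * real k) powr (- (1 / \<alpha>))"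
  define z where "z = min 1 w"
  have k0: "0 < \<alpha> / 2 * real k" using alpha_pos k by simp
  have w: "0 < w" unfolding w_def using alpha_pos k by simp
  have z: "0 < z" "z \<le> 1" "z \<le> w" using w by (auto simp: z_def)
  have A: "0 \<le> A" by (rule cone_A_nonneg[OF f])
  have xz: "x \<le> z" if x: "x \<in> {0<..1}" "x \<in> staying a k" for x
  proof -
    have "((2 * x) powr (- \<alpha>)) powr (- (1 / \<alpha>)) \<le> w"
      unfolding w_def using escape_bound[OF a x] k0 alpha_pos by (intro powr_mono2') auto
    moreover have "((2 * x) powr (- \<alpha>)) powr (- (1 / \<alpha>)) = 2 * x"
      using x alpha_pos by (simp add: powr_powr)
    ultimately show ?thesis using x by (simp add: z_def)
  qed
  have "(\<integral>x. f x * indicator (staying a k) x \<partial>unit_borel)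
      \<le> (\<integral>x. A * (x powr (- \<alpha>) * indicator {0<..z} x) \<partial>unit_borel)"
  proof (rule integral_mono_unit_borel)
    show "integrable unit_borel (\<lambda>x. A * (x powr (- \<alpha>) * indicator {0<..z} x))"
      using has_bochner_integral_powr_unit_borel[OF alpha_less_1, of z] z
      by (auto simp: has_bochner_integral_iff)
    show "integrable unit_borel (\<lambda>x. f x * indicator (staying a k) x)"
      by (rule cone_integrable_indicator[OF f staying_borel])
    fix x :: real assume x: "x \<in> {0<..1}"
    show "f x * indicator (staying a k) x \<le> A * (x powr (- \<alpha>) * indicator {0<..z} x)"
      using cone_bound[OF f x] xz[OF x] x A by (auto split: split_indicator)
  qed
  also have "\<dots> = A * (z powr (1 - \<alpha>) / (1 - \<alpha>))"
    using integral_powr_unit_borel[OF alpha_less_1, of z] z by simp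
  also have "\<dots> \<le> A * (w powr (1 - \<alpha>) / (1 - \<alpha>))"
    using z A alpha_less_1 by (intro mult_left_mono divide_right_mono powr_mono2) auto
  also have "w powr (1 - \<alpha>) = (\<alpha> / 2 * real k) powr (- decay_exp)"
    using alpha_pos by (simp add: w_def powr_powr decay_exp_def field_simps)
  also have "\<dots> = (\<alpha> / 2) powr (- decay_exp) * real k powr (- decay_exp)"
    by (rule powr_mult)
  finally show ?thesis by (simp add: field_simps)
qed

section \<open>Lower bounds for iterated densities\<close>

lemma transfers_nonneg:
  assumes "admissible a" "\<And>x. x \<in> {0<..1} \<Longrightarrow> 0 \<le> f x" "x \<in> {0<..1}"
  shows "0 \<le> transfers a n f x"
proof -
  have "transfers a n (\<lambda>x. f x - f x) x \<le> transfers a n f x"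
    using assms by (intro transfers_mono) (auto simp: admissible_def)
  thus ?thesis unfolding transfers_diff by simp
qed

text \<open>Among all preimages of x only the one along left branches is kept, and every step costs
  at most the factor 3 bounding the derivative. The point of this choice is that the kept preimage
  is close to 0 for large k, where a decreasing density is largest.\<close>

lemma transfers_left_orbit:
  assumes a: "admissible a" and f: "\<And>x. x \<in> {0<..1} \<Longrightarrow> 0 \<le> f x" and x: "x \<in> {0<..1}"
  shows "\<exists>y\<in>{0<..1}. y \<in> staying a k \<and> seq_map a k y = x \<and> f y / 3 ^ k \<le> transfers a k f x"
  using x
proof (induction k arbitrary: x)
  case 0
  thus ?case by (auto simp: staying_def)
next
  case (Suc k)
  define \<gamma> where "\<gamma> = a (Suc k)"
  have g: "0 < \<gamma>" "\<gamma> < 1" using a alpha_less_1 by (auto simp: \<gamma>_def admissible_def intro: le_less_trans)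
  define z where "z = left_inv \<gamma> x"
  have z: "z \<in> {0<..1/2}" unfolding z_def by (rule left_inv_range[OF g(1) Suc.prems])
  hence "z \<in> {0<..1}" by auto
  from Suc.IH[OF this] obtain y where y: "y \<in> {0<..1}" "y \<in> staying a k" "seq_map a k y = z"
    "f y / 3 ^ k \<le> transfers a k f z" by blast
  have nn: "0 \<le> transfers a k f z" "0 \<le> transfers a k f ((x + 1) / 2)"
    using z Suc.prems by (auto intro!: transfers_nonneg[OF a f])
  have "f y / 3 ^ Suc k \<le> transfers a k f z / 3" using y(4) by (simp add: field_simps)
  also have "\<dots> \<le> transfers a k f z / map_deriv \<gamma> z"
    using map_deriv_ge_1[OF g(1), of z] map_deriv_le_3[OF g, of z] z nn
    by (intro divide_left_mono) auto
  also have "\<dots> \<le> transfers a (Suc k) f x"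
    using nn by (simp add: transfer_def z_def \<gamma>_def)
  finally have "f y / 3 ^ Suc k \<le> transfers a (Suc k) f x" .
  moreover have "seq_map a (Suc k) y = x"
    using intermittent_map_left_inv[OF g(1) Suc.prems] y(3) by (simp add: z_def \<gamma>_def)
  moreover have "y \<in> staying a (Suc k)"
    using y(2,3) z by (auto simp: staying_def less_Suc_eq)
  ultimately show ?case using y(1) by blast
qed

lemma decr_cone_1: "decr_cone cone_const (\<lambda>_. 1)"
proof (rule coneI)
  fix x :: real assume x: "x \<in> {0<..1}"
  have "1 powr (- \<alpha>) \<le> x powr (- \<alpha>)" using x alpha_pos by (intro powr_mono2') auto
  hence "1 * 1 \<le> cone_const * x powr (- \<alpha>)" using cone_const_ge_1 by (intro mult_mono) auto
  thus "1 \<le> cone_const * x powr (- \<alpha>)" by simp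
qed (use cone_const_ge_1 in auto)

text \<open>A density in the cone with mass 1 cannot be concentrated near 0, because the envelope is
  integrable, so it is bounded below at some fixed \<delta> and hence on (0, \<delta>]. Pulling any
  x back along left branches for a fixed number K of steps lands in that interval, at the price of
  the factor 3^K.\<close>

lemma transfers_one_lower_bound:
  "\<exists>c>0. c \<le> 1 \<and> (\<forall>a k x. admissible a \<longrightarrow> x \<in> {0<..1} \<longrightarrow> c \<le> transfers a k (\<lambda>_. 1) x)"
proof -
  \<comment> \<open>Chosen so that the envelope with constant \<open>cone_const\<close> has integral
    exactly 1/2 over (0, \<delta>].\<close>
  define \<delta> where "\<delta> = ((1 - \<alpha>) / (2 * cone_const)) powr (1 / (1 - \<alpha>))"
  have r: "0 < (1 - \<alpha>) / (2 * cone_const)" "(1 - \<alpha>) / (2 * cone_const) \<le> 1"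
    using alpha_pos alpha_less_1 cone_const_ge_1 by auto
  have d: "0 < \<delta>" "\<delta> \<le> 1" using r alpha_less_1 by (auto simp: \<delta>_def intro!: powr_le1)
  have d2: "\<delta> powr (1 - \<alpha>) = (1 - \<alpha>) / (2 * cone_const)"
    using r alpha_less_1 by (simp add: \<delta>_def powr_powr del: divide_powr_uminus)
      (use cone_const_ge_1 in simp)
  \<comment> \<open>By \<open>escape_bound\<close>, staying in the left half for K steps then forces
    the starting point below \<delta>.\<close>
  obtain K :: nat where "(2 * \<delta>) powr (- \<alpha>) / (\<alpha> / 2) < real K"
    using reals_Archimedean2 by blast
  hence K: "(2 * \<delta>) powr (- \<alpha>) < \<alpha> / 2 * real K" using alpha_pos by (simp add: field_simps)
  have stay: "y \<le> \<delta>" if "admissible a" "y \<in> {0<..1}" "y \<in> staying a K" for a y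
  proof (rule ccontr)
    assume "\<not> ?thesis"
    hence "(2 * y) powr (- \<alpha>) \<le> (2 * \<delta>) powr (- \<alpha>)" using d alpha_pos by (intro powr_mono2') auto
    thus False using escape_bound[OF that] K by linarith
  qed
  have "1 / (2 * 3 ^ K) \<le> transfers a k (\<lambda>_. 1) x" if a: "admissible a" and x: "x \<in> {0<..1}" for a k x
  proof (cases "k \<le> K")
    case True
    have "1 / (2 * 3 ^ K) \<le> 1 / (3 ^ k :: real)"
    proof (rule divide_left_mono)
      have "(3::real) ^ k \<le> 1 * 3 ^ K" using power_increasing[OF True, of "3::real"] by simp
      also have "\<dots> \<le> 2 * 3 ^ K" by (rule mult_right_mono) auto
      finally show "(3::real) ^ k \<le> 2 * 3 ^ K" .
    qed auto
    thus ?thesis using transfers_left_orbit[OF a _ x, of "\<lambda>_. 1" k] by auto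
  next
    case False
    \<comment> \<open>The last K maps are reserved for pulling x back to (0, \<delta>]. The earlier
      ones matter only through the cone and the mass, which they preserve.\<close>
    define f where "f = transfers a (k - K) (\<lambda>_. 1)"
    let ?a = "\<lambda>j. a (j + (k - K))"
    have f: "decr_cone cone_const f" unfolding f_def by (rule transfers_cone[OF a decr_cone_1])
    have "1 = integral\<^sup>L unit_borel f" unfolding f_def by (subst integral_transfers[OF a]) auto
    also have "\<dots> = (\<integral>x. f x * indicator {0<..\<delta>} x + f x * indicator {\<delta><..1} x \<partial>unit_borel)"
      by (rule Bochner_Integration.integral_cong) (use d in \<open>auto split: split_indicator\<close>)
    also have "\<dots> = (\<integral>x. f x * indicator {0<..\<delta>} x \<partial>unit_borel) + (\<integral>x. f x * indicator {\<delta><..1} x \<partial>unit_borel)"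
      by (intro Bochner_Integration.integral_add cone_integrable_indicator[OF f]) auto
    also have "(\<integral>x. f x * indicator {0<..\<delta>} x \<partial>unit_borel)
        \<le> (\<integral>x. cone_const * (x powr (- \<alpha>) * indicator {0<..\<delta>} x) \<partial>unit_borel)"
    proof (rule integral_mono_unit_borel)
      show "integrable unit_borel (\<lambda>x. cone_const * (x powr (- \<alpha>) * indicator {0<..\<delta>} x))"
        using has_bochner_integral_powr_unit_borel[OF alpha_less_1, of \<delta>] d
        by (auto simp: has_bochner_integral_iff)
    qed (use cone_bound[OF f] cone_integrable_indicator[OF f] in \<open>auto split: split_indicator\<close>)
    also have "\<dots> = 1 / 2"
      using integral_powr_unit_borel[OF alpha_less_1, of \<delta>] d d2 cone_const_ge_1 alpha_less_1 by simp
    also have "(\<integral>x. f x * indicator {\<delta><..1} x \<partial>unit_borel) \<le> (1 - \<delta>) * f \<delta>"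
      using d by (intro cone_average_right[OF f]) auto
    also have "\<dots> \<le> f \<delta>" using d cone_nonneg[OF f, of \<delta>] by (simp add: mult_left_le_one_le)
    finally have fd: "1 / 2 \<le> f \<delta>" by simp
    obtain y where y: "y \<in> {0<..1}" "y \<in> staying ?a K" "f y / 3 ^ K \<le> transfers ?a K f x"
      using transfers_left_orbit[OF admissible_shift[OF a], of f x "k - K" K] cone_nonneg[OF f] x by blast
    have "y \<le> \<delta>" by (rule stay[OF admissible_shift[OF a] y(1,2)])
    hence "f \<delta> \<le> f y" using y d by (intro cone_antimono[OF f]) auto
    hence "(1 / 2) / 3 ^ K \<le> f y / 3 ^ K" using fd by (intro divide_right_mono) auto
    also note y(3)
    also have "transfers ?a K f x = transfers a k (\<lambda>_. 1) x"
      using transfers_add[of a "k - K" K "\<lambda>_. 1"] False by (simp add: f_def)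
    finally show ?thesis by simp
  qed
  moreover have "1 / (2 * 3 ^ K) \<le> (1::real)"
  proof -
    have "(1::real) \<le> 2 * 3 ^ K" using one_le_power[of "3::real" K] by linarith
    thus ?thesis by (simp only: divide_le_eq_1) simp
  qed
  ultimately show ?thesis by (intro exI[of _ "1 / (2 * 3 ^ K)"]) auto
qed

text \<open>The bound is uniform over sequences, times and points. Choosing it once as a number
  depending on \<alpha> alone makes the final constant independent of the maps.\<close>

definition floor_const :: real where
  "floor_const = (SOME c. 0 < c \<and> c \<le> 1 \<and> (\<forall>a k x. admissible a \<longrightarrow> x \<in> {0<..1} \<longrightarrow> c \<le> transfers a k (\<lambda>_. 1) x))"

lemma floor_const:
  shows floor_const_pos: "0 < floor_const" and floor_const_le_1: "floor_const \<le> 1"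
    and floor_const_le: "admissible a \<Longrightarrow> x \<in> {0<..1} \<Longrightarrow> floor_const \<le> transfers a k (\<lambda>_. 1) x"
proof -
  have "0 < floor_const \<and> floor_const \<le> 1 \<and>
      (\<forall>a k x. admissible a \<longrightarrow> x \<in> {0<..1} \<longrightarrow> floor_const \<le> transfers a k (\<lambda>_. 1) x)"
    unfolding floor_const_def by (rule someI_ex) (use transfers_one_lower_bound in blast)
  thus "0 < floor_const" "floor_const \<le> 1"
    "admissible a \<Longrightarrow> x \<in> {0<..1} \<Longrightarrow> floor_const \<le> transfers a k (\<lambda>_. 1) x" by blast+
qed

text \<open>The image is decreasing, hence smallest at 1. The left preimage of 1 is 1/2, where the
  derivative is at most 3, and f(1/2) is at least twice the mass of f on the right half.\<close>

lemma transfer_lower_bound: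
  assumes g: "0 < \<gamma>" "\<gamma> \<le> \<alpha>" and f: "decr_cone A f" and x: "x \<in> {0<..1}"
  shows "2/3 * (\<integral>x. f x * indicator {1/2<..1} x \<partial>unit_borel) \<le> transfer \<gamma> f x"
proof -
  have "2/3 * (\<integral>x. f x * indicator {1/2<..1} x \<partial>unit_borel) \<le> 2/3 * ((1 - 1/2) * f (1/2))"
    by (intro mult_left_mono cone_average_right[OF f]) auto
  also have "\<dots> = f (1/2) / 3" by simp
  also have "\<dots> \<le> f (1/2) / map_deriv \<gamma> (1/2)"
    using map_deriv_ge_1[OF g(1), of "1/2"] map_deriv_le_3[OF g(1), of "1/2"] g alpha_less_1
      cone_nonneg[OF f, of "1/2"] by (intro divide_left_mono) auto
  also have "\<dots> \<le> transfer \<gamma> f 1"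
  proof -
    have "left_inv \<gamma> 1 = 1/2"
      using left_inv_intermittent_map[OF g(1), of "1/2"] intermittent_map_half[OF g(1)] by fastforce
    thus ?thesis using cone_nonneg[OF f, of 1] unfolding transfer_def by (simp only:) simp
  qed
  also have "\<dots> \<le> transfer \<gamma> f x"
    using x by (intro cone_antimono[OF transfer_cone[OF g f]]) auto
  finally show ?thesis .
qed

text \<open>
  The number \<open>s\<close> is the total mass split off as constant densities during the first \<open>k\<close> steps. A
  visit of mass \<open>v\<close> to the right half allows a constant of size at least \<open>2 v / 3\<close> to be split
  off one step later, so only mass that never visits the right half escapes.
\<close>

lemma split_off_constants:
  assumes "admissible a" "decr_cone A f"
  shows "\<exists>s\<ge>0. integral\<^sup>L unit_borel f \<le> (\<integral>x. f x * indicator (staying a k) x \<partial>unit_borel) + 5/2 * s \<and>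
     (\<forall>x\<in>{0<..1}. floor_const * s \<le> transfers a k f x)"
  using assms
proof (induction k arbitrary: a f)
  case 0
  thus ?case by (intro exI[of _ 0]) (auto simp: staying_def cone_nonneg)
next
  case (Suc k)
  note f = Suc.prems(2)
  define \<gamma> where "\<gamma> = a 1"
  have g: "0 < \<gamma>" "\<gamma> \<le> \<alpha>" using Suc.prems by (auto simp: \<gamma>_def admissible_def)
  let ?a = "\<lambda>j. a (Suc j)"
  have a': "admissible ?a" using admissible_shift[OF Suc.prems(1), of 1] by simp
  define R where "R = (\<integral>x. f x * indicator {1/2<..1} x \<partial>unit_borel)"
  \<comment> \<open>Since R + c = 5/2 * c, the factor 5/2 of the claim pays both for the mass R that
    starts in the right half and for the mass c that is now removed.\<close>
  define c where "c = 2/3 * R"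
  have "0 \<le> R" unfolding R_def
    by (intro Bochner_Integration.integral_nonneg_AE AE_I2) (simp add: cone_nonneg[OF f])
  hence c: "0 \<le> c" by (simp add: c_def)
  define f1 where "f1 x = transfer \<gamma> f x - c" for x
  have Pf: "decr_cone A (transfer \<gamma> f)" by (rule transfer_cone[OF g f])
  have c_le: "c \<le> transfer \<gamma> f x" if "x \<in> {0<..1}" for x
    unfolding c_def R_def by (rule transfer_lower_bound[OF g f that])
  have f1: "decr_cone A f1" "integral\<^sup>L unit_borel f1 = integral\<^sup>L unit_borel (transfer \<gamma> f) - c"
    using cone_diff_const[OF Pf c c_le] by (auto simp: f1_def[abs_def])
  obtain s where s: "0 \<le> s"
    "integral\<^sup>L unit_borel f1 \<le> (\<integral>x. f1 x * indicator (staying ?a k) x \<partial>unit_borel) + 5/2 * s"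
    "\<And>x. x \<in> {0<..1} \<Longrightarrow> floor_const * s \<le> transfers ?a k f1 x"
    using Suc.IH[OF a' f1(1)] by blast
  have "(\<integral>x. f1 x * indicator (staying ?a k) x \<partial>unit_borel)
      \<le> (\<integral>x. transfer \<gamma> f x * indicator (staying ?a k) x \<partial>unit_borel)"
    using c by (intro integral_mono_unit_borel cone_integrable_indicator[OF f1(1)] cone_integrable_indicator[OF Pf])
      (auto simp: f1_def split: split_indicator)
  also have "\<dots> = (\<integral>x. f x * indicator (staying ?a k) (intermittent_map \<gamma> x) \<partial>unit_borel)"
  proof (rule transfer_duality(2)[OF g(1) cone_measurable[OF f]])
    show "integrable unit_borel (\<lambda>y. f y * indicat_real (staying ?a k) (intermittent_map \<gamma> y))"
    proof (rule integrable_bounded_mult_unit_borel[OF cone_integrable[OF f], where B=1])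
      show "(\<lambda>y. indicat_real (staying ?a k) (intermittent_map \<gamma> y)) \<in> borel_measurable unit_borel"
        by (rule borel_measurable_unit_borel) measurable
    qed (simp add: indicator_le_1)
  qed measurable
  \<comment> \<open>A point whose image stays for k steps either stays itself for one step more or
    starts in the right half.\<close>
  also have "\<dots> \<le> (\<integral>x. f x * indicator (staying a (Suc k)) x + f x * indicator {1/2<..1} x \<partial>unit_borel)"
  proof (rule integral_mono_unit_borel)
    show "integrable unit_borel (\<lambda>y. f y * indicat_real (staying ?a k) (intermittent_map \<gamma> y))"
    proof (rule integrable_bounded_mult_unit_borel[OF cone_integrable[OF f], where B=1])
      show "(\<lambda>y. indicat_real (staying ?a k) (intermittent_map \<gamma> y)) \<in> borel_measurable unit_borel"
        by (rule borel_measurable_unit_borel) measurable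
    qed (simp add: indicator_le_1)
    show "integrable unit_borel (\<lambda>x. f x * indicator (staying a (Suc k)) x + f x * indicator {1/2<..1} x)"
      by (intro Bochner_Integration.integrable_add cone_integrable_indicator[OF f]) auto
    fix x :: real assume x: "x \<in> {0<..1}"
    show "f x * indicat_real (staying ?a k) (intermittent_map \<gamma> x)
        \<le> f x * indicator (staying a (Suc k)) x + f x * indicator {1/2<..1} x"
      using cone_nonneg[OF f x] x by (auto simp: staying_Suc_iff \<gamma>_def split: split_indicator)
  qed
  also have "\<dots> = (\<integral>x. f x * indicator (staying a (Suc k)) x \<partial>unit_borel) + R"
    unfolding R_def by (intro Bochner_Integration.integral_add cone_integrable_indicator[OF f]) auto
  finally have "integral\<^sup>L unit_borel f \<le> (\<integral>x. f x * indicator (staying a (Suc k)) x \<partial>unit_borel) + 5/2 * (s + c)"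
    using s(2) f1(2) integral_transfer[OF g(1) cone_integrable[OF f]] by (simp add: c_def algebra_simps)
  moreover have "floor_const * (s + c) \<le> transfers a (Suc k) f x" if x: "x \<in> {0<..1}" for x
  proof -
    have "transfers a (Suc k) f x = transfers ?a k (\<lambda>x. f1 x + c) x"
      unfolding transfers_Suc_front by (simp add: f1_def \<gamma>_def)
    also have "\<dots> = transfers ?a k f1 x + c * transfers ?a k (\<lambda>_. 1) x"
      by (rule transfers_add_const)
    \<comment> \<open>The constant c removed at this step does not remain constant under the later
      maps; \<open>floor_const\<close> bounds from below what they make of it.\<close>
    also have "\<dots> \<ge> floor_const * s + c * floor_const"
      using s(3)[OF x] c floor_const_le[OF a' x, of k] by (intro add_mono mult_left_mono)
    finally show ?thesis by (simp add: algebra_simps)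
  qed
  ultimately show ?case using s(1) c by (intro exI[of _ "s + c"]) auto
qed

section \<open>Coupling of two densities of equal mass\<close>

definition tail_const :: real where "tail_const = (\<alpha> / 2) powr (- decay_exp) / (1 - \<alpha>)"

lemma transfers_lower_bound:
  assumes a: "admissible a" and f: "decr_cone A f" and k: "1 \<le> k" and x: "x \<in> {0<..1}"
  shows "2/5 * floor_const * (integral\<^sup>L unit_borel f - A * tail_const * real k powr (- decay_exp)) \<le> transfers a k f x"
proof -
  obtain s where s: "0 \<le> s"
    "integral\<^sup>L unit_borel f \<le> (\<integral>x. f x * indicator (staying a k) x \<partial>unit_borel) + 5/2 * s"
    "floor_const * s \<le> transfers a k f x"
    using split_off_constants[OF a f, of k] x by blast
  have "2/5 * (integral\<^sup>L unit_borel f - A * tail_const * real k powr (- decay_exp)) \<le> s"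
    using staying_mass[OF a f k] s(2) by (simp add: tail_const_def)
  hence "floor_const * (2/5 * (integral\<^sup>L unit_borel f - A * tail_const * real k powr (- decay_exp))) \<le> floor_const * s"
    using floor_const_pos by (intro mult_left_mono) auto
  also note s(3)
  finally show ?thesis by (simp add: algebra_simps)
qed

text \<open>Removing one and the same constant from both images leaves their difference unchanged
  and lowers both masses equally. The remainders lie in the cone with the same A, so the step can be
  iterated.\<close>

lemma coupling_step:
  assumes a: "admissible a" and F: "decr_cone A F" and G: "decr_cone A G"
    and eq: "integral\<^sup>L unit_borel F = integral\<^sup>L unit_borel G" and k: "1 \<le> k"
  shows "\<exists>F' G'. decr_cone A F' \<and> decr_cone A G' \<and> integral\<^sup>L unit_borel F' = integral\<^sup>L unit_borel G' \<and>
     integral\<^sup>L unit_borel F' \<le> (1 - 2/5 * floor_const) * integral\<^sup>L unit_borel F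
        + 2/5 * floor_const * A * tail_const * real k powr (- decay_exp) \<and>
     (\<lambda>x. transfers a k F x - transfers a k G x) = (\<lambda>x. F' x - G' x)"
proof -
  \<comment> \<open>When the mass is already below the error term the lower bound is negative, and
    nothing is removed.\<close>
  define c where "c = max 0 (2/5 * floor_const * (integral\<^sup>L unit_borel F - A * tail_const * real k powr (- decay_exp)))"
  have cF: "c \<le> transfers a k F x" if "x \<in> {0<..1}" for x
    unfolding c_def using transfers_lower_bound[OF a F k that] transfers_nonneg[OF a cone_nonneg[OF F] that]
    by simp
  have cG: "c \<le> transfers a k G x" if "x \<in> {0<..1}" for x
    unfolding c_def eq using transfers_lower_bound[OF a G k that] transfers_nonneg[OF a cone_nonneg[OF G] that]
    by simp
  have c0: "0 \<le> c" by (simp add: c_def)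
  note F' = cone_diff_const[OF transfers_cone[OF a F] c0 cF]
  note G' = cone_diff_const[OF transfers_cone[OF a G] c0 cG]
  have "2/5 * floor_const * (integral\<^sup>L unit_borel F - A * tail_const * real k powr (- decay_exp)) \<le> c"
    by (simp add: c_def)
  hence "integral\<^sup>L unit_borel F - c \<le> (1 - 2/5 * floor_const) * integral\<^sup>L unit_borel F
        + 2/5 * floor_const * A * tail_const * real k powr (- decay_exp)"
    by (simp add: algebra_simps)
  thus ?thesis
    using F' G' eq integral_transfers[OF a cone_integrable[OF F]] integral_transfers[OF a cone_integrable[OF G]]
    by (intro exI[of _ "\<lambda>x. transfers a k F x - c"] exI[of _ "\<lambda>x. transfers a k G x - c"]) auto
qed

text \<open>For the remaining mass v, \<open>coupling_step\<close> reads v(n) \<le> (1 - \<kappa>)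
  v(n - k) + \<kappa> A \<open>tail_const\<close> k^-\<beta>. A fixed k would leave an error that
  does not decay. With k about \<epsilon> n the error has the right order, and for small \<epsilon>
  the loss in passing from n to n - k is outweighed by the factor 1 - \<kappa>.\<close>

lemma coupling:
  "\<exists>D>0. \<forall>a A f g n. admissible a \<longrightarrow> decr_cone A f \<longrightarrow> decr_cone A g \<longrightarrow>
     integral\<^sup>L unit_borel f = integral\<^sup>L unit_borel g \<longrightarrow> 1 \<le> n \<longrightarrow>
     (\<exists>F G. decr_cone A F \<and> decr_cone A G \<and> integral\<^sup>L unit_borel F = integral\<^sup>L unit_borel G \<and>
       integral\<^sup>L unit_borel F \<le> A * D * real n powr (- decay_exp) \<and>
       (\<lambda>x. transfers a n f x - transfers a n g x) = (\<lambda>x. F x - G x))"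
proof -
  let ?b = decay_exp
  define \<kappa> where "\<kappa> = 2/5 * floor_const"
  have kap: "0 < \<kappa>" "\<kappa> < 1" using floor_const_pos floor_const_le_1 by (auto simp: \<kappa>_def)
  have tc: "0 < tail_const" using alpha_pos alpha_less_1 by (simp add: tail_const_def)
  \<comment> \<open>With this q and the next \<epsilon>, (1 - \<kappa>)(1 - \<epsilon>)^-\<beta>
    equals 1 - \<kappa>/2. Half of the gain \<kappa> pays for the shorter time n - k, and the other
    half is kept for the error term.\<close>
  define q where "q = (1 - \<kappa>) / (1 - \<kappa> / 2)"
  have q: "0 < q" "q < 1" using kap by (auto simp: q_def field_simps)
  define \<epsilon> where "\<epsilon> = 1 - q powr (1 / ?b)"
  have eps: "0 < \<epsilon>" "\<epsilon> < 1" using q decay_exp_pos powr_less_mono2[of "1 / ?b" q 1] by (auto simp: \<epsilon>_def)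
  have epsq: "(1 - \<kappa>) * (1 - \<epsilon>) powr (- ?b) = 1 - \<kappa> / 2"
  proof -
    have "(1 - \<epsilon>) powr (- ?b) = 1 / q"
      using q decay_exp_pos by (simp add: \<epsilon>_def powr_powr powr_minus_divide)
    thus ?thesis using kap by (simp add: q_def field_simps)
  qed
  obtain N :: nat where N: "1 / \<epsilon> < real N" using reals_Archimedean2 by blast
  have N1: "1 \<le> N" using N eps by (cases N) (auto simp: field_simps)
  \<comment> \<open>The first entry covers n \<le> N, where the mass is at most A. The second keeps
    the error of one step within the share \<kappa>/2 of the target. Beyond N one has \<epsilon> n
    \<ge> 1, so the block length k is at least 1.\<close>
  define D where "D = max (real N powr ?b) (2 * tail_const * (\<epsilon> / 2) powr (- ?b))"
  have D1: "real N powr ?b \<le> D" and D2: "2 * tail_const * (\<epsilon> / 2) powr (- ?b) \<le> D"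
    by (auto simp: D_def)
  have "0 < real N powr ?b" using N1 by simp
  hence D0: "0 < D" using D1 by linarith
  have "\<exists>F G. decr_cone A F \<and> decr_cone A G \<and> integral\<^sup>L unit_borel F = integral\<^sup>L unit_borel G \<and>
       integral\<^sup>L unit_borel F \<le> A * D * real n powr (- ?b) \<and>
       (\<lambda>x. transfers a n f x - transfers a n g x) = (\<lambda>x. F x - G x)"
    if a: "admissible a" and f: "decr_cone A f" and g: "decr_cone A g"
      and eq: "integral\<^sup>L unit_borel f = integral\<^sup>L unit_borel g" and "1 \<le> n" for a A f g n
    using \<open>1 \<le> n\<close>
  proof (induction n rule: less_induct)
    case (less n)
    have A: "0 \<le> A" by (rule cone_A_nonneg[OF f])
    show ?case
    proof (cases "n \<le> N")
      case True
      have "integral\<^sup>L unit_borel f \<le> cone_const * integral\<^sup>L unit_borel f"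
        using cone_const_ge_1 mult_right_mono[OF _ cone_integral_nonneg[OF f], of 1 cone_const] by simp
      also have "\<dots> \<le> A * 1" using cone_mass[OF f] by simp
      also have "1 \<le> D * real n powr (- ?b)"
      proof -
        have "real n powr ?b \<le> real N powr ?b" using True decay_exp_pos by (intro powr_mono2) auto
        also note D1
        finally show ?thesis using less.prems by (simp add: powr_minus_divide)
      qed
      hence "A * 1 \<le> A * (D * real n powr (- ?b))" by (rule mult_left_mono[OF _ A])
      finally have "integral\<^sup>L unit_borel f \<le> A * D * real n powr (- ?b)" by simp
      thus ?thesis
        using transfers_cone[OF a f, of n] transfers_cone[OF a g, of n] eq
          integral_transfers[OF a cone_integrable[OF f], of n] integral_transfers[OF a cone_integrable[OF g], of n]
        by (intro exI[of _ "transfers a n f"] exI[of _ "transfers a n g"]) simp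
    next
      case False
      define k where "k = nat \<lfloor>\<epsilon> * real n\<rfloor>"
      define m where "m = n - k"
      have en: "1 \<le> \<epsilon> * real n"
      proof -
        have "1 / \<epsilon> < real n" using N False by linarith
        thus ?thesis using eps by (simp add: field_simps)
      qed
      have k: "1 \<le> k" using en by (simp add: k_def le_nat_iff le_floor_iff)
      have rk: "real k \<le> \<epsilon> * real n" "\<epsilon> * real n < real k + 1" using en by (auto simp: k_def)
      have k2: "\<epsilon> / 2 * real n \<le> real k" using rk k by linarith
      have "\<epsilon> * real n < real n" using eps less.prems by simp
      hence kn: "k < n" using rk by linarith
      have m: "1 \<le> m" "m < n" "m + k = n" using k kn by (auto simp: m_def)
      have rm: "(1 - \<epsilon>) * real n \<le> real m" using rk kn by (simp add: m_def algebra_simps)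
      obtain F G where FG: "decr_cone A F" "decr_cone A G" "integral\<^sup>L unit_borel F = integral\<^sup>L unit_borel G"
        "integral\<^sup>L unit_borel F \<le> A * D * real m powr (- ?b)"
        "(\<lambda>x. transfers a m f x - transfers a m g x) = (\<lambda>x. F x - G x)"
        using less.IH[OF m(2,1)] by blast
      let ?a = "\<lambda>j. a (j + m)"
      obtain F' G' where FG': "decr_cone A F'" "decr_cone A G'" "integral\<^sup>L unit_borel F' = integral\<^sup>L unit_borel G'"
        "integral\<^sup>L unit_borel F' \<le> (1 - \<kappa>) * integral\<^sup>L unit_borel F + \<kappa> * A * tail_const * real k powr (- ?b)"
        "(\<lambda>x. transfers ?a k F x - transfers ?a k G x) = (\<lambda>x. F' x - G' x)"
        using coupling_step[OF admissible_shift[OF a] FG(1,2,3) k] unfolding \<kappa>_def by blast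
      have "(\<lambda>x. transfers a n f x - transfers a n g x) = transfers ?a k (\<lambda>x. transfers a m f x - transfers a m g x)"
        unfolding m(3)[symmetric] transfers_add by (simp add: transfers_diff fun_eq_iff)
      also have "\<dots> = (\<lambda>x. F' x - G' x)"
        unfolding FG(5) using FG'(5) by (simp add: transfers_diff fun_eq_iff)
      finally have e: "(\<lambda>x. transfers a n f x - transfers a n g x) = (\<lambda>x. F' x - G' x)" .
      have p1: "real m powr (- ?b) \<le> (1 - \<epsilon>) powr (- ?b) * real n powr (- ?b)"
      proof -
        have "real m powr (- ?b) \<le> ((1 - \<epsilon>) * real n) powr (- ?b)"
          using rm eps less.prems decay_exp_pos by (intro powr_mono2') auto
        thus ?thesis by (simp add: powr_mult)
      qed
      have p2: "real k powr (- ?b) \<le> (\<epsilon> / 2) powr (- ?b) * real n powr (- ?b)"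
      proof -
        have "real k powr (- ?b) \<le> (\<epsilon> / 2 * real n) powr (- ?b)"
          using k2 eps less.prems decay_exp_pos by (intro powr_mono2') auto
        also have "\<dots> = (\<epsilon> / 2) powr (- ?b) * real n powr (- ?b)" by (rule powr_mult)
        finally show ?thesis .
      qed
      have "(1 - \<kappa>) * integral\<^sup>L unit_borel F \<le> (1 - \<kappa>) * (A * D * real m powr (- ?b))"
        using FG(4) kap by (intro mult_left_mono) auto
      also have "\<dots> \<le> (1 - \<kappa>) * (A * D * ((1 - \<epsilon>) powr (- ?b) * real n powr (- ?b)))"
        using p1 A D0 kap by (intro mult_left_mono) auto
      also have "\<dots> = ((1 - \<kappa>) * (1 - \<epsilon>) powr (- ?b)) * (A * D * real n powr (- ?b))" by (simp only: mult_ac)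
      finally have t1: "(1 - \<kappa>) * integral\<^sup>L unit_borel F \<le> (1 - \<kappa> / 2) * (A * D * real n powr (- ?b))"
        unfolding epsq .
      have "\<kappa> * A * tail_const * real k powr (- ?b) \<le> \<kappa> * A * tail_const * ((\<epsilon> / 2) powr (- ?b) * real n powr (- ?b))"
        using p2 A tc kap by (intro mult_left_mono) auto
      also have "\<dots> = (\<kappa> / 2 * A * real n powr (- ?b)) * (2 * tail_const * (\<epsilon> / 2) powr (- ?b))"
        by (simp add: mult_ac)
      also have "\<dots> \<le> (\<kappa> / 2 * A * real n powr (- ?b)) * D"
        using D2 A kap by (intro mult_left_mono) auto
      finally have t2: "\<kappa> * A * tail_const * real k powr (- ?b) \<le> \<kappa> / 2 * (A * D * real n powr (- ?b))"
        by (simp add: mult_ac)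
      have "integral\<^sup>L unit_borel F' \<le> (1 - \<kappa> / 2) * (A * D * real n powr (- ?b)) + \<kappa> / 2 * (A * D * real n powr (- ?b))"
        using FG'(4) t1 t2 by linarith
      also have "\<dots> = A * D * real n powr (- ?b)" by (simp add: algebra_simps)
      finally show ?thesis using FG'(1-3) e by blast
    qed
  qed
  thus ?thesis using D0 by blast
qed

lemma memory_loss:
  "\<exists>D>0. \<forall>a A f g n. admissible a \<longrightarrow> decr_cone A f \<longrightarrow> decr_cone A g \<longrightarrow>
     integral\<^sup>L unit_borel f = integral\<^sup>L unit_borel g \<longrightarrow> 1 \<le> n \<longrightarrow>
     (\<integral>x. \<bar>transfers a n f x - transfers a n g x\<bar> \<partial>unit_borel) \<le> A * D * real n powr (- decay_exp)"
proof -
  obtain D where D: "0 < D" "\<And>a A f g n. admissible a \<Longrightarrow> decr_cone A f \<Longrightarrow> decr_cone A g \<Longrightarrow>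
     integral\<^sup>L unit_borel f = integral\<^sup>L unit_borel g \<Longrightarrow> 1 \<le> n \<Longrightarrow>
     (\<exists>F G. decr_cone A F \<and> decr_cone A G \<and> integral\<^sup>L unit_borel F = integral\<^sup>L unit_borel G \<and>
       integral\<^sup>L unit_borel F \<le> A * D * real n powr (- decay_exp) \<and>
       (\<lambda>x. transfers a n f x - transfers a n g x) = (\<lambda>x. F x - G x))"
    using coupling by blast
  have "(\<integral>x. \<bar>transfers a n f x - transfers a n g x\<bar> \<partial>unit_borel) \<le> A * (2 * D) * real n powr (- decay_exp)"
    if H: "admissible a" "decr_cone A f" "decr_cone A g"
     "integral\<^sup>L unit_borel f = integral\<^sup>L unit_borel g" "1 \<le> n" for a A f g n
  proof -
    obtain F G where FG: "decr_cone A F" "decr_cone A G" "integral\<^sup>L unit_borel F = integral\<^sup>L unit_borel G"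
       "integral\<^sup>L unit_borel F \<le> A * D * real n powr (- decay_exp)"
       "(\<lambda>x. transfers a n f x - transfers a n g x) = (\<lambda>x. F x - G x)"
      using D(2)[OF H] by blast
    note iF = cone_integrable[OF FG(1)] and iG = cone_integrable[OF FG(2)]
    have "(\<integral>x. \<bar>transfers a n f x - transfers a n g x\<bar> \<partial>unit_borel) = (\<integral>x. \<bar>F x - G x\<bar> \<partial>unit_borel)"
      using FG(5) by (simp add: fun_eq_iff)
    also have "\<dots> \<le> (\<integral>x. F x + G x \<partial>unit_borel)"
    proof (rule integral_mono_unit_borel)
      fix x :: real assume x: "x \<in> {0<..1}"
      show "\<bar>F x - G x\<bar> \<le> F x + G x" using cone_nonneg[OF FG(1) x] cone_nonneg[OF FG(2) x] by linarith
    qed (use iF iG in auto)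
    also have "\<dots> = integral\<^sup>L unit_borel F + integral\<^sup>L unit_borel G" using iF iG by simp
    finally show ?thesis using FG(3,4) by simp
  qed
  thus ?thesis using D(1) by (intro exI[of _ "2 * D"]) auto
qed

end

section \<open>Moments of weakly dependent sums\<close>

text \<open>The odd extension of the power function: p times \<open>signed_powr (p - 1)\<close> is
  the derivative of the p-th absolute power for p > 1.\<close>

definition signed_powr :: "real \<Rightarrow> real \<Rightarrow> real" where
  "signed_powr q x = max 0 x powr q - max 0 (- x) powr q"

lemma signed_powr_nonneg: "0 \<le> x \<Longrightarrow> signed_powr q x = x powr q"
  by (simp add: signed_powr_def)

lemma signed_powr_minus: "signed_powr q (- x) = - signed_powr q x"
  by (simp add: signed_powr_def)

lemma signed_powr_0 [simp]: "signed_powr q 0 = 0"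
  by (simp add: signed_powr_def)

lemma abs_signed_powr: "\<bar>signed_powr q x\<bar> = \<bar>x\<bar> powr q"
  by (cases "0 \<le> x") (auto simp: signed_powr_def max_def)

lemma continuous_signed_powr: "0 < q \<Longrightarrow> continuous_on UNIV (signed_powr q)"
  unfolding signed_powr_def[abs_def] by (intro continuous_intros continuous_on_powr') auto

lemma signed_powr_mult_self: "signed_powr q x * x = \<bar>x\<bar> powr (q + 1)"
  by (cases "0 \<le> x") (auto simp: signed_powr_def powr_add max_def)

text \<open>Convexity of the p-th absolute power, obtained from Young's inequality with the
  exponents p and p / (p - 1). The case p = 1 stands apart because the conjugate exponent
  degenerates.\<close>

lemma powr_abs_tangent:
  fixes a b :: real
  assumes "1 \<le> p"
  shows "\<bar>b\<bar> powr p + p * signed_powr (p - 1) b * (a - b) \<le> \<bar>a\<bar> powr p"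
proof (cases "p = 1")
  case True
  thus ?thesis by (cases "0 < b"; cases "b = 0") (auto simp: signed_powr_def max_def)
next
  case False
  with assms have p: "1 < p" by simp
  have "\<bar>a\<bar> * \<bar>b\<bar> powr (p - 1) \<le> \<bar>a\<bar> powr p / p + (\<bar>b\<bar> powr (p - 1)) powr (p / (p - 1)) / (p / (p - 1))"
    using p by (intro Youngs_inequality) (auto simp: field_simps)
  also have "(\<bar>b\<bar> powr (p - 1)) powr (p / (p - 1)) = \<bar>b\<bar> powr p"
    using p by (simp add: powr_powr)
  finally have "p * (\<bar>a\<bar> * \<bar>b\<bar> powr (p - 1)) \<le> \<bar>a\<bar> powr p + (p - 1) * \<bar>b\<bar> powr p"
    using p by (simp add: field_simps)
  moreover have "p * (signed_powr (p - 1) b * a) \<le> p * (\<bar>a\<bar> * \<bar>b\<bar> powr (p - 1))"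
  proof (rule mult_left_mono)
    have "signed_powr (p - 1) b * a \<le> \<bar>signed_powr (p - 1) b * a\<bar>" by simp
    thus "signed_powr (p - 1) b * a \<le> \<bar>a\<bar> * \<bar>b\<bar> powr (p - 1)"
      by (simp add: abs_mult abs_signed_powr mult.commute)
  qed (use p in simp)
  moreover have "p * signed_powr (p - 1) b * (a - b) = p * (signed_powr (p - 1) b * a) - p * \<bar>b\<bar> powr p"
    using signed_powr_mult_self[of "p - 1" b] by (simp add: right_diff_distrib mult.assoc)
  moreover have "(p - 1) * \<bar>b\<bar> powr p = p * \<bar>b\<bar> powr p - \<bar>b\<bar> powr p" by (simp add: left_diff_distrib)
  ultimately show ?thesis by linarith
qed

text \<open>For equal signs, use the tangent at the point of larger absolute value. For opposite
  signs, pass through 0 and add the two estimates.\<close>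

lemma signed_powr_Lipschitz:
  fixes a b :: real
  assumes q: "1 \<le> q" and M: "\<bar>a\<bar> \<le> M" "\<bar>b\<bar> \<le> M"
  shows "\<bar>signed_powr q a - signed_powr q b\<bar> \<le> q * M powr (q - 1) * \<bar>a - b\<bar>"
proof -
  have same: "x powr q - y powr q \<le> q * M powr (q - 1) * (x - y)" if "0 \<le> y" "y \<le> x" "x \<le> M" for x y
  proof -
    have "x powr q - y powr q \<le> q * x powr (q - 1) * (x - y)"
      using powr_abs_tangent[OF q, of x y] that by (simp add: signed_powr_nonneg algebra_simps)
    also have "\<dots> \<le> q * M powr (q - 1) * (x - y)"
      using that q by (intro mult_right_mono mult_left_mono powr_mono2) auto
    finally show ?thesis .
  qed
  have opp: "x powr q + y powr q \<le> q * M powr (q - 1) * (x + y)" if "0 \<le> y" "0 \<le> x" "x \<le> M" "y \<le> M" for x y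
    using same[of 0 x] same[of 0 y] that by (simp add: distrib_left)
  consider "0 \<le> b" "b \<le> a" | "0 \<le> a" "a \<le> b" | "a \<le> 0" "b \<le> a" | "b \<le> 0" "a \<le> b"
    | "a \<le> 0" "0 \<le> b" | "b \<le> 0" "0 \<le> a" by linarith
  thus ?thesis
  proof cases
    case 1
    thus ?thesis using same[of b a] powr_mono2[of q b a] q M by (simp add: signed_powr_nonneg)
  next
    case 2
    thus ?thesis using same[of a b] powr_mono2[of q a b] q M by (simp add: signed_powr_nonneg)
  next
    case 3
    thus ?thesis using same[of "-a" "-b"] powr_mono2[of q "-a" "-b"] q M
      signed_powr_minus[of q "-a"] signed_powr_minus[of q "-b"] by (simp add: signed_powr_nonneg)
  next
    case 4
    thus ?thesis using same[of "-b" "-a"] powr_mono2[of q "-b" "-a"] q M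
      signed_powr_minus[of q "-a"] signed_powr_minus[of q "-b"] by (simp add: signed_powr_nonneg)
  next
    case 5
    hence "signed_powr q a - signed_powr q b = - (b powr q + (- a) powr q)"
      using signed_powr_minus[of q "-a"] by (simp add: signed_powr_nonneg)
    hence "\<bar>signed_powr q a - signed_powr q b\<bar> = b powr q + (- a) powr q"
      by (simp only: abs_minus_cancel abs_of_nonneg add_nonneg_nonneg powr_ge_zero)
    thus ?thesis using 5 opp[of "-a" b] q M by simp
  next
    case 6
    hence "signed_powr q a - signed_powr q b = a powr q + (- b) powr q"
      using signed_powr_minus[of q "-b"] by (simp add: signed_powr_nonneg)
    thus ?thesis using 6 opp[of "-b" a] q M by simp
  qed
qed

lemma signed_powr_increment:
  fixes x y :: real
  assumes "2 \<le> p" "\<bar>y\<bar> \<le> K"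
  shows "\<bar>signed_powr (p - 1) (x + y) - signed_powr (p - 1) x\<bar> \<le> (p - 1) * K * (\<bar>x\<bar> + K) powr (p - 2)"
proof -
  have "\<bar>signed_powr (p - 1) (x + y) - signed_powr (p - 1) x\<bar> \<le> (p - 1) * (\<bar>x\<bar> + K) powr (p - 1 - 1) * \<bar>x + y - x\<bar>"
    using assms by (intro signed_powr_Lipschitz) auto
  also have "\<dots> \<le> (p - 1) * (\<bar>x\<bar> + K) powr (p - 1 - 1) * K"
    using assms by (intro mult_left_mono) auto
  finally show ?thesis by (simp add: mult_ac)
qed

text \<open>The tangent at x + y, evaluated at x, already gives a first-order bound, but with the
  slope taken at x + y. Moving the slope back to x costs \<open>signed_powr_increment\<close> times
  the increment y, which is the quadratic remainder.\<close>

lemma powr_abs_expansion: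
  fixes x y :: real
  assumes p: "2 \<le> p" and y: "\<bar>y\<bar> \<le> K"
  shows "\<bar>x + y\<bar> powr p \<le> \<bar>x\<bar> powr p + p * (signed_powr (p - 1) x * y) + p * (p - 1) * K^2 * (\<bar>x\<bar> + K) powr (p - 2)"
proof -
  define d where "d = signed_powr (p - 1) (x + y) - signed_powr (p - 1) x"
  have "\<bar>x + y\<bar> powr p + p * signed_powr (p - 1) (x + y) * (x - (x + y)) \<le> \<bar>x\<bar> powr p"
    using p by (intro powr_abs_tangent) auto
  hence "\<bar>x + y\<bar> powr p \<le> \<bar>x\<bar> powr p + p * (signed_powr (p - 1) x * y) + p * (d * y)"
    by (simp add: d_def algebra_simps)
  also have "d * y \<le> \<bar>d\<bar> * \<bar>y\<bar>" by (metis abs_ge_self abs_mult)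
  also have "\<bar>d\<bar> * \<bar>y\<bar> \<le> ((p - 1) * K * (\<bar>x\<bar> + K) powr (p - 2)) * K"
    using signed_powr_increment[OF p y, of x] p y unfolding d_def
    by (intro mult_mono) auto
  finally show ?thesis using p by (simp add: power2_eq_square mult_ac)
qed

text \<open>Split according to whether v exceeds \<theta> * u^2. The free \<theta> lets the high
  power of u carry a coefficient of order 1/n, and the price \<open>\<theta> powr (1 - q)\<close> is
  then of order n^(q - 1).\<close>

lemma young_powr:
  fixes u v \<theta> :: real
  assumes "0 < u" "0 \<le> v" "0 < \<theta>" "1 \<le> q"
  shows "u powr (2 * q - 2) * v \<le> \<theta> * u powr (2 * q) + \<theta> powr (1 - q) * v powr q"
proof (cases "v \<le> \<theta> * u\<^sup>2")
  case True
  have "u powr (2 * q - 2) * v \<le> u powr (2 * q - 2) * (\<theta> * u\<^sup>2)" using True by (intro mult_left_mono) auto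
  also have "\<dots> = \<theta> * u powr (2 * q)" using assms by (simp add: powr_diff)
  also have "\<dots> \<le> \<theta> * u powr (2 * q) + \<theta> powr (1 - q) * v powr q" by simp
  finally show ?thesis .
next
  case False
  have v: "0 < v" using False assms by (smt (verit) mult_nonneg_nonneg zero_le_power2)
  have "u powr (2 * q - 2) = (u\<^sup>2) powr (q - 1)" using assms powr_powr[of u 2 "q - 1"]
    by (simp add: algebra_simps)
  also have "\<dots> \<le> (v / \<theta>) powr (q - 1)" using False assms by (intro powr_mono2) (auto simp: field_simps)
  also have "\<dots> = \<theta> powr (1 - q) * v powr (q - 1)"
    using assms powr_minus_divide[of \<theta> "q - 1"] by (simp add: powr_divide)
  finally have "u powr (2 * q - 2) * v \<le> \<theta> powr (1 - q) * v powr (q - 1) * v"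
    using v by (intro mult_right_mono) auto
  also have "v powr (q - 1) * v = v powr q" using v by (simp add: powr_diff)
  hence "\<theta> powr (1 - q) * v powr (q - 1) * v = \<theta> powr (1 - q) * v powr q" by simp
  also have "\<dots> \<le> \<theta> * u powr (2 * q) + \<theta> powr (1 - q) * v powr q" using assms by simp
  finally show ?thesis .
qed

lemma powr_add_le:
  fixes x y p :: real
  assumes "0 \<le> x" "0 \<le> y" "0 \<le> p"
  shows "(x + y) powr p \<le> 2 powr p * (x powr p + y powr p)"
proof -
  have "(x + y) powr p \<le> (2 * max x y) powr p" using assms by (intro powr_mono2) auto
  also have "\<dots> = 2 powr p * max x y powr p" by (rule powr_mult)
  also have "\<dots> \<le> 2 powr p * (x powr p + y powr p)"
    by (intro mult_left_mono) (auto simp: max_def)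
  finally show ?thesis .
qed

text \<open>The value that \<open>moment_bound\<close> produces: the summand 1 covers the term
  without n, and the rest is 2 c n \<theta>^(1 - q) 2^q with the \<theta> chosen there, after
  division by n^q.\<close>

definition moment_const :: "real \<Rightarrow> real" where
  "moment_const q = (let c = 2 * q * (2 * q - 1) in
     1 + 2 * c * (2 * 2 powr (2 * q) * c) powr (q - 1) * 2 powr q)"

lemma moment_const_pos: "1 \<le> q \<Longrightarrow> 0 < moment_const q"
  by (auto simp: moment_const_def Let_def intro!: add_pos_nonneg mult_nonneg_nonneg)

text \<open>Jensen's inequality with free weights: the tangent inequality is applied to each
  \<open>a i / w i\<close> at their weighted mean, and the linear terms then add up to 0. In
  \<open>cond_moment\<close> the weights are inverse time distances.\<close>

lemma powr_sum_le:
  fixes a w :: "'i \<Rightarrow> real"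
  assumes q: "1 \<le> q" and w: "\<And>i. i \<in> I \<Longrightarrow> 0 < w i" and a: "\<And>i. i \<in> I \<Longrightarrow> 0 \<le> a i"
  shows "(\<Sum>i\<in>I. a i) powr q \<le> (\<Sum>i\<in>I. w i) powr (q - 1) * (\<Sum>i\<in>I. w i powr (1 - q) * a i powr q)"
proof (cases "finite I \<and> I \<noteq> {}")
  case True
  define s where "s = (\<Sum>i\<in>I. w i)"
  define m where "m = (\<Sum>i\<in>I. a i) / s"
  have s: "0 < s" unfolding s_def using True w by (intro sum_pos) auto
  have m: "0 \<le> m" unfolding m_def using a s by (intro divide_nonneg_pos sum_nonneg)
  have sm: "s * m = (\<Sum>i\<in>I. a i)" using s by (simp add: m_def)
  have "s * m powr q = (\<Sum>i\<in>I. w i * (m powr q) + q * signed_powr (q - 1) m * (a i - w i * m))"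
    using sm by (simp add: sum.distrib sum_subtractf flip: sum_distrib_right sum_distrib_left s_def)
  also have "\<dots> \<le> (\<Sum>i\<in>I. w i powr (1 - q) * a i powr q)"
  proof (rule sum_mono)
    fix i assume i: "i \<in> I"
    have "w i * (m powr q + q * signed_powr (q - 1) m * (a i / w i - m)) \<le> w i * (a i / w i) powr q"
      using powr_abs_tangent[OF q, of m "a i / w i"] m w[OF i] a[OF i] by (intro mult_left_mono) auto
    also have "\<dots> = w i powr (1 - q) * a i powr q"
      using w[OF i] a[OF i] by (simp add: powr_divide powr_diff)
    finally show "w i * (m powr q) + q * signed_powr (q - 1) m * (a i - w i * m) \<le> w i powr (1 - q) * a i powr q"
      using w[OF i] by (simp add: algebra_simps)
  qed
  finally have "s powr (q - 1) * (s * m powr q) \<le> s powr (q - 1) * (\<Sum>i\<in>I. w i powr (1 - q) * a i powr q)"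
    by (rule mult_left_mono) simp
  moreover have "s powr (q - 1) * (s * m powr q) = (s * m) powr q"
    using s by (simp add: powr_mult powr_diff)
  ultimately have "(s * m) powr q \<le> s powr (q - 1) * (\<Sum>i\<in>I. w i powr (1 - q) * a i powr q)"
    by simp
  thus ?thesis unfolding sm unfolding s_def .
qed auto

text \<open>
  The variable \<open>Z i l\<close> plays the role of the conditional expectation of \<open>Y i\<close> given
  \<open>Y 0, \<dots>, Y l\<close>; only its pairing with functions of two partial sums is needed.
\<close>

locale weakly_dependent = finite_measure M for M :: "'a measure" +
  fixes Y :: "nat \<Rightarrow> 'a \<Rightarrow> real" and Z :: "nat \<Rightarrow> nat \<Rightarrow> 'a \<Rightarrow> real" and n :: nat and K B q L :: real
  assumes q: "1 \<le> q" and K: "0 < K"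
    and Y_measurable: "\<And>i. i < n \<Longrightarrow> Y i \<in> borel_measurable M"
    and Y_bound: "\<And>i x. i < n \<Longrightarrow> x \<in> space M \<Longrightarrow> \<bar>Y i x\<bar> \<le> K"
    and Z_measurable: "\<And>i l. l < i \<Longrightarrow> i < n \<Longrightarrow> Z i l \<in> borel_measurable M"
    and Z_bound: "\<And>i l x. l < i \<Longrightarrow> i < n \<Longrightarrow> x \<in> space M \<Longrightarrow> \<bar>Z i l x\<bar> \<le> B"
    and Z_cond: "\<And>i l k G. l < i \<Longrightarrow> i < n \<Longrightarrow> k \<in> {l, Suc l} \<Longrightarrow> continuous_on UNIV G \<Longrightarrow>
        (\<integral>x. G (\<Sum>j<k. Y j x) * Y i x \<partial>M) = (\<integral>x. G (\<Sum>j<k. Y j x) * Z i l x \<partial>M)"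
    and Z_moment: "\<And>l. l < n \<Longrightarrow> (\<integral>x. (\<Sum>i\<in>{l<..<n}. \<bar>Z i l x\<bar>) powr q \<partial>M) \<le> L"
begin

definition W :: "nat \<Rightarrow> 'a \<Rightarrow> real" where "W l x = (\<Sum>j<l. Y j x)"
definition V :: "nat \<Rightarrow> 'a \<Rightarrow> real" where "V l x = (\<Sum>i\<in>{l<..<n}. \<bar>Z i l x\<bar>)"

lemma integrable_bounded:
  fixes f :: "'a \<Rightarrow> real"
  shows "f \<in> borel_measurable M \<Longrightarrow> (\<And>x. x \<in> space M \<Longrightarrow> \<bar>f x\<bar> \<le> c) \<Longrightarrow> integrable M f"
  by (rule integrable_const_bound[where B=c]) auto

lemma W_measurable [measurable]: "l \<le> n \<Longrightarrow> W l \<in> borel_measurable M"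
  unfolding W_def[abs_def] by (intro borel_measurable_sum Y_measurable) auto

lemma W_bound: "l \<le> n \<Longrightarrow> x \<in> space M \<Longrightarrow> \<bar>W l x\<bar> \<le> real l * K"
  unfolding W_def using sum_norm_bound[of "{..<l}" "\<lambda>j. Y j x" K] Y_bound by auto

lemma W_Suc: "W (Suc l) x = W l x + Y l x"
  by (simp add: W_def)

lemma V_measurable [measurable]: "V l \<in> borel_measurable M"
  unfolding V_def[abs_def] by (intro borel_measurable_sum borel_measurable_abs Z_measurable) auto

lemma V_bound: "x \<in> space M \<Longrightarrow> \<bar>V l x\<bar> \<le> real n * \<bar>B\<bar>"
proof -
  assume x: "x \<in> space M"
  have "\<bar>V l x\<bar> \<le> real (card {l<..<n}) * \<bar>B\<bar>"
    unfolding V_def using sum_norm_bound[of "{l<..<n}" "\<lambda>i. \<bar>Z i l x\<bar>" "\<bar>B\<bar>"] Z_bound[OF _ _ x]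
    by (force simp: sum_nonneg)
  also have "\<dots> \<le> real n * \<bar>B\<bar>" by (intro mult_right_mono) auto
  finally show ?thesis .
qed

lemma V_nonneg: "0 \<le> V l x"
  by (simp add: V_def sum_nonneg)

lemma integrable_main_term:
  assumes "l \<le> n"
  shows "integrable M (\<lambda>x. (\<bar>W l x\<bar> + K) powr (2 * q - 2) * (K\<^sup>2 + K * V l x))"
proof (rule integrable_bounded)
  fix x assume x: "x \<in> space M"
  have "(\<bar>W l x\<bar> + K) powr (2 * q - 2) \<le> (real l * K + K) powr (2 * q - 2)"
    using W_bound[OF assms x] K q by (intro powr_mono2) auto
  moreover have "K\<^sup>2 + K * V l x \<le> K\<^sup>2 + K * (real n * \<bar>B\<bar>)"
    using V_bound[OF x, of l] K by (intro add_left_mono mult_left_mono) auto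
  moreover have "0 \<le> K\<^sup>2 + K * V l x" using K V_nonneg[of l x] by simp
  ultimately show "\<bar>(\<bar>W l x\<bar> + K) powr (2 * q - 2) * (K\<^sup>2 + K * V l x)\<bar>
     \<le> (real l * K + K) powr (2 * q - 2) * (K\<^sup>2 + K * (real n * \<bar>B\<bar>))"
    by (simp add: abs_mult mult_mono)
qed (use assms in measurable)

lemma integrable_W_powr: "l \<le> n \<Longrightarrow> integrable M (\<lambda>x. \<bar>W l x\<bar> powr (2 * q))"
  using W_bound q by (intro integrable_bounded[where c="(real l * K) powr (2 * q)"])
    (auto intro!: powr_mono2)

lemma integrable_signed_powr_W: 
  assumes "l \<le> n" "f \<in> borel_measurable M" "\<And>x. x \<in> space M \<Longrightarrow> \<bar>f x\<bar> \<le> c"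
  shows "integrable M (\<lambda>x. signed_powr (2 * q - 1) (W l x) * f x)"
proof (rule integrable_bounded)
  have "signed_powr (2 * q - 1) \<in> borel_measurable borel"
    using q by (intro borel_measurable_continuous_onI continuous_signed_powr) auto
  thus "(\<lambda>x. signed_powr (2 * q - 1) (W l x) * f x) \<in> borel_measurable M"
    using assms by measurable
  fix x assume x: "x \<in> space M"
  have "\<bar>W l x\<bar> powr (2 * q - 1) \<le> (real l * K) powr (2 * q - 1)"
    using W_bound[OF assms(1) x] q by (intro powr_mono2) auto
  thus "\<bar>signed_powr (2 * q - 1) (W l x) * f x\<bar> \<le> (real l * K) powr (2 * q - 1) * c"
    using assms(3)[OF x] by (auto simp: abs_mult abs_signed_powr intro!: mult_mono)
qed

text \<open>In the expansion of each new increment, the linear term pairs a power of the partial sum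
  \<open>W i\<close> with \<open>Y i\<close>. Telescoping that power over l < i and replacing
  \<open>Y i\<close> by \<open>Z i l\<close> in each difference makes it quadratic: one factor is an
  increment of the power, the other is a conditional expectation. Exchanging the sums then collects
  all terms with the same l in \<open>V l\<close>.\<close>

lemma moment_step:
  assumes "m \<le> n"
  shows "(\<integral>x. \<bar>W m x\<bar> powr (2 * q) \<partial>M)
     \<le> 2 * q * (2 * q - 1) * (\<Sum>l<m. \<integral>x. (\<bar>W l x\<bar> + K) powr (2 * q - 2) * (K\<^sup>2 + K * V l x) \<partial>M)"
proof -
  let ?p = "2 * q"
  let ?s = "signed_powr (?p - 1)"
  let ?u = "\<lambda>l x. (\<bar>W l x\<bar> + K) powr (?p - 2)"
  have p: "2 \<le> ?p" using q by simp
  have u_int: "integrable M (?u l)" if "l \<le> n" for l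
  proof (rule integrable_bounded)
    fix x assume x: "x \<in> space M"
    show "\<bar>?u l x\<bar> \<le> (real l * K + K) powr (?p - 2)"
      using W_bound[OF that x] K q by (auto intro!: powr_mono2)
  qed (use that in measurable)
  have uZ_int: "integrable M (\<lambda>x. ?u l x * \<bar>Z i l x\<bar>)" if "l < i" "i < n" for i l
  proof (rule integrable_bounded)
    have [measurable]: "W l \<in> borel_measurable M" "Z i l \<in> borel_measurable M"
      using that by (auto intro: W_measurable Z_measurable)
    show "(\<lambda>x. ?u l x * \<bar>Z i l x\<bar>) \<in> borel_measurable M" by measurable
    fix x assume x: "x \<in> space M"
    have "?u l x \<le> (real l * K + K) powr (?p - 2)"
      using W_bound[OF _ x, of l] that K q by (auto intro!: powr_mono2)
    thus "\<bar>?u l x * \<bar>Z i l x\<bar>\<bar> \<le> (real l * K + K) powr (?p - 2) * B"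
      using Z_bound[OF that x] by (auto simp: abs_mult intro!: mult_mono)
  qed
  have sY_int: "integrable M (\<lambda>x. ?s (W l x) * Y i x)" if "l \<le> n" "i < n" for l i
    using integrable_signed_powr_W[OF that(1) Y_measurable[OF that(2)] Y_bound[OF that(2)]] .
  have sZ_int: "integrable M (\<lambda>x. ?s (W k x) * Z i l x)" if "k \<le> n" "l < i" "i < n" for k l i
    using integrable_signed_powr_W[OF that(1) Z_measurable[OF that(2,3)] Z_bound[OF that(2,3)]] .
  have step: "(\<integral>x. \<bar>W (Suc i) x\<bar> powr ?p \<partial>M) \<le> (\<integral>x. \<bar>W i x\<bar> powr ?p \<partial>M) + ?p * (\<integral>x. ?s (W i x) * Y i x \<partial>M)
      + ?p * (?p - 1) * K\<^sup>2 * (\<integral>x. ?u i x \<partial>M)" if i: "i < n" for i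
  proof -
    have "(\<integral>x. \<bar>W (Suc i) x\<bar> powr ?p \<partial>M)
        \<le> (\<integral>x. (\<bar>W i x\<bar> powr ?p + ?p * (?s (W i x) * Y i x)) + ?p * (?p - 1) * K\<^sup>2 * ?u i x \<partial>M)"
    proof (rule integral_mono)
      show "integrable M (\<lambda>x. \<bar>W (Suc i) x\<bar> powr ?p)" using i by (intro integrable_W_powr) auto
      show "integrable M (\<lambda>x. (\<bar>W i x\<bar> powr ?p + ?p * (?s (W i x) * Y i x)) + ?p * (?p - 1) * K\<^sup>2 * ?u i x)"
        using i by (intro Bochner_Integration.integrable_add integrable_mult_right sY_int u_int integrable_W_powr) auto
      fix x assume x: "x \<in> space M"
      show "\<bar>W (Suc i) x\<bar> powr ?p \<le> (\<bar>W i x\<bar> powr ?p + ?p * (?s (W i x) * Y i x)) + ?p * (?p - 1) * K\<^sup>2 * ?u i x"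
        unfolding W_Suc by (rule powr_abs_expansion[OF p Y_bound[OF i x]])
    qed
    also have "\<dots> = (\<integral>x. \<bar>W i x\<bar> powr ?p + ?p * (?s (W i x) * Y i x) \<partial>M) + (\<integral>x. ?p * (?p - 1) * K\<^sup>2 * ?u i x \<partial>M)"
      using i by (intro Bochner_Integration.integral_add Bochner_Integration.integrable_add
          integrable_mult_right sY_int u_int integrable_W_powr) auto
    also have "(\<integral>x. \<bar>W i x\<bar> powr ?p + ?p * (?s (W i x) * Y i x) \<partial>M) = (\<integral>x. \<bar>W i x\<bar> powr ?p \<partial>M) + (\<integral>x. ?p * (?s (W i x) * Y i x) \<partial>M)"
      using i by (intro Bochner_Integration.integral_add integrable_mult_right sY_int integrable_W_powr) auto
    finally show ?thesis by (simp only: integral_mult_right_zero)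
  qed
  have corr: "(\<integral>x. ?s (W i x) * Y i x \<partial>M) \<le> (\<Sum>l<i. (?p - 1) * K * (\<integral>x. ?u l x * \<bar>Z i l x\<bar> \<partial>M))" if i: "i < n" for i
  proof -
    \<comment> \<open>Both sums in the l-th difference involve at most Y 0, ..., Y l, so both may be
      paired with \<open>Z i l\<close>. This is why the pairing hypothesis admits the two indices l
      and Suc l.\<close>
    have tele: "?s (W i x) = (\<Sum>l<i. ?s (W (Suc l) x) - ?s (W l x))" for x
      by (subst sum_lessThan_telescope) (simp add: W_def)
    have "(\<integral>x. ?s (W i x) * Y i x \<partial>M) = (\<integral>x. (\<Sum>l<i. ?s (W (Suc l) x) * Y i x - ?s (W l x) * Y i x) \<partial>M)"
      by (subst tele) (simp add: sum_distrib_right left_diff_distrib)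
    also have "\<dots> = (\<Sum>l<i. (\<integral>x. ?s (W (Suc l) x) * Y i x - ?s (W l x) * Y i x \<partial>M))"
      using i by (intro Bochner_Integration.integral_sum Bochner_Integration.integrable_diff sY_int) auto
    also have "\<dots> \<le> (\<Sum>l<i. (?p - 1) * K * (\<integral>x. ?u l x * \<bar>Z i l x\<bar> \<partial>M))"
    proof (rule sum_mono)
      fix l assume "l \<in> {..<i}"
      hence l: "l < i" by simp
      have c: "continuous_on UNIV ?s" using q by (intro continuous_signed_powr) auto
      have "(\<integral>x. ?s (W (Suc l) x) * Y i x - ?s (W l x) * Y i x \<partial>M)
          = (\<integral>x. ?s (W (Suc l) x) * Y i x \<partial>M) - (\<integral>x. ?s (W l x) * Y i x \<partial>M)"
        using i l by (intro Bochner_Integration.integral_diff sY_int) auto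
      also have "\<dots> = (\<integral>x. ?s (W (Suc l) x) * Z i l x \<partial>M) - (\<integral>x. ?s (W l x) * Z i l x \<partial>M)"
        unfolding W_def using Z_cond[OF l i _ c, of "Suc l"] Z_cond[OF l i _ c, of l] by simp
      also have "\<dots> = (\<integral>x. ?s (W (Suc l) x) * Z i l x - ?s (W l x) * Z i l x \<partial>M)"
        using i l by (intro Bochner_Integration.integral_diff[symmetric] sZ_int) auto
      also have "\<dots> \<le> (\<integral>x. (?p - 1) * K * (?u l x * \<bar>Z i l x\<bar>) \<partial>M)"
      proof (rule integral_mono)
        show "integrable M (\<lambda>x. ?s (W (Suc l) x) * Z i l x - ?s (W l x) * Z i l x)"
          using i l by (intro Bochner_Integration.integrable_diff sZ_int) auto
        show "integrable M (\<lambda>x. (?p - 1) * K * (?u l x * \<bar>Z i l x\<bar>))"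
          using i l by (intro integrable_mult_right uZ_int)
        fix x assume x: "x \<in> space M"
        have "?s (W (Suc l) x) * Z i l x - ?s (W l x) * Z i l x \<le> \<bar>?s (W (Suc l) x) - ?s (W l x)\<bar> * \<bar>Z i l x\<bar>"
          by (metis abs_ge_self abs_mult left_diff_distrib)
        also have "\<dots> \<le> ((?p - 1) * K * ?u l x) * \<bar>Z i l x\<bar>"
          unfolding W_Suc using i l x
          by (intro mult_right_mono signed_powr_increment[OF p Y_bound]) auto
        finally show "?s (W (Suc l) x) * Z i l x - ?s (W l x) * Z i l x \<le> (?p - 1) * K * (?u l x * \<bar>Z i l x\<bar>)"
          by (simp add: mult_ac)
      qed
      also have "\<dots> = (?p - 1) * K * (\<integral>x. ?u l x * \<bar>Z i l x\<bar> \<partial>M)" by (simp only: integral_mult_right_zero)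
      finally show "(\<integral>x. ?s (W (Suc l) x) * Y i x - ?s (W l x) * Y i x \<partial>M)
          \<le> (?p - 1) * K * (\<integral>x. ?u l x * \<bar>Z i l x\<bar> \<partial>M)" .
    qed
    finally show ?thesis .
  qed
  let ?c = "?p * (?p - 1)"
  have "(\<integral>x. \<bar>W m x\<bar> powr ?p \<partial>M) \<le> (\<Sum>i<m. ?c * K\<^sup>2 * (\<integral>x. ?u i x \<partial>M)) + (\<Sum>i<m. \<Sum>l<i. ?c * K * (\<integral>x. ?u l x * \<bar>Z i l x\<bar> \<partial>M))"
    using assms
  proof (induction m)
    case 0
    thus ?case by (simp add: W_def)
  next
    case (Suc m)
    have "?p * (\<integral>x. ?s (W m x) * Y m x \<partial>M) \<le> ?p * (\<Sum>l<m. (?p - 1) * K * (\<integral>x. ?u l x * \<bar>Z m l x\<bar> \<partial>M))"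
      using corr[of m] Suc.prems q by (intro mult_left_mono) auto
    also have "\<dots> = (\<Sum>l<m. ?c * K * (\<integral>x. ?u l x * \<bar>Z m l x\<bar> \<partial>M))"
      by (simp add: sum_distrib_left mult.assoc)
    finally show ?case using step[of m] Suc by (simp add: algebra_simps)
  qed
  also have "(\<Sum>i<m. \<Sum>l<i. ?c * K * (\<integral>x. ?u l x * \<bar>Z i l x\<bar> \<partial>M)) = (\<Sum>l<m. \<Sum>i\<in>{l<..<m}. ?c * K * (\<integral>x. ?u l x * \<bar>Z i l x\<bar> \<partial>M))"
    by (subst sum.Sigma, simp, simp, subst sum.Sigma, simp, simp)
       (rule sum.reindex_bij_witness[of _ prod.swap prod.swap], auto)
  also have "(\<Sum>i<m. ?c * K\<^sup>2 * (\<integral>x. ?u i x \<partial>M)) + (\<Sum>l<m. \<Sum>i\<in>{l<..<m}. ?c * K * (\<integral>x. ?u l x * \<bar>Z i l x\<bar> \<partial>M))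
     = (\<Sum>l<m. ?c * (K\<^sup>2 * (\<integral>x. ?u l x \<partial>M) + K * (\<Sum>i\<in>{l<..<m}. \<integral>x. ?u l x * \<bar>Z i l x\<bar> \<partial>M)))"
    by (simp add: sum.distrib sum_distrib_left distrib_left mult.assoc)
  also have "\<dots> \<le> (\<Sum>l<m. ?c * (\<integral>x. ?u l x * (K\<^sup>2 + K * V l x) \<partial>M))"
  proof (intro sum_mono mult_left_mono)
    fix l assume "l \<in> {..<m}"
    hence l: "l < m" by simp
    have "K\<^sup>2 * (\<integral>x. ?u l x \<partial>M) + K * (\<Sum>i\<in>{l<..<m}. \<integral>x. ?u l x * \<bar>Z i l x\<bar> \<partial>M)
        \<le> K\<^sup>2 * (\<integral>x. ?u l x \<partial>M) + K * (\<Sum>i\<in>{l<..<n}. \<integral>x. ?u l x * \<bar>Z i l x\<bar> \<partial>M)"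
      using assms K by (intro add_left_mono mult_left_mono sum_mono2) auto
    also have "(\<Sum>i\<in>{l<..<n}. \<integral>x. ?u l x * \<bar>Z i l x\<bar> \<partial>M) = (\<integral>x. (\<Sum>i\<in>{l<..<n}. ?u l x * \<bar>Z i l x\<bar>) \<partial>M)"
      using uZ_int by (intro Bochner_Integration.integral_sum[symmetric]) auto
    also have "K\<^sup>2 * (\<integral>x. ?u l x \<partial>M) + K * (\<integral>x. (\<Sum>i\<in>{l<..<n}. ?u l x * \<bar>Z i l x\<bar>) \<partial>M)
        = (\<integral>x. K\<^sup>2 * ?u l x + K * (\<Sum>i\<in>{l<..<n}. ?u l x * \<bar>Z i l x\<bar>) \<partial>M)"
      using u_int[of l] uZ_int l assms by (subst Bochner_Integration.integral_add) auto
    also have "\<dots> = (\<integral>x. ?u l x * (K\<^sup>2 + K * V l x) \<partial>M)"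
      unfolding V_def sum_distrib_left[symmetric] by (simp add: algebra_simps)
    finally show "K\<^sup>2 * (\<integral>x. ?u l x \<partial>M) + K * (\<Sum>i\<in>{l<..<m}. \<integral>x. ?u l x * \<bar>Z i l x\<bar> \<partial>M)
       \<le> (\<integral>x. ?u l x * (K\<^sup>2 + K * V l x) \<partial>M)" .
  qed (use q in auto)
  finally show ?thesis by (simp add: sum_distrib_left)
qed

text \<open>\<open>young_powr\<close> bounds each integral of \<open>moment_step\<close> by a small
  multiple of an earlier moment plus a term free of moments. There are at most n of them, so with
  \<theta> of order 1/n the earlier moments make up only half of the bound being proved by
  induction.\<close>

theorem moment_bound:
  assumes n: "1 \<le> n"
  shows "(\<integral>x. \<bar>W n x\<bar> powr (2 * q) \<partial>M)
     \<le> moment_const q * real n powr q * (K powr (2 * q) * measure M (space M) + K powr q * L)"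
proof -
  let ?p = "2 * q"
  define \<mu> where "\<mu> = measure M (space M)"
  define c where "c = ?p * (?p - 1)"
  define E where "E = K powr ?p * \<mu> + K powr q * L"
  \<comment> \<open>Chosen so that \<open>c * real n * \<theta> * 2 powr ?p\<close> is 1/2.\<close>
  define \<theta> where "\<theta> = 1 / (2 * 2 powr ?p * c * real n)"
  \<comment> \<open>The fixed point of the affine recursion that results: R is half of
    \<open>R + K powr ?p * \<mu>\<close> plus n times the moment-free term with its factor
    c.\<close>
  define R where "R = K powr ?p * \<mu> + 2 * c * real n * (\<theta> powr (1 - q) * (2 powr q * E))"
  have c: "0 < c" using q by (simp add: c_def)
  have lam: "0 < \<theta>" using c n by (simp add: \<theta>_def)
  have mu: "0 \<le> \<mu>" by (simp add: \<mu>_def)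
  have "0 \<le> (\<integral>x. (\<Sum>i\<in>{0<..<n}. \<bar>Z i 0 x\<bar>) powr q \<partial>M)" by simp
  also have "\<dots> \<le> L" using n by (intro Z_moment) auto
  finally have L: "0 \<le> L" .
  have E: "0 \<le> E" "K powr ?p * \<mu> \<le> E" using mu L by (auto simp: E_def)
  have v: "(\<integral>x. (\<bar>W l x\<bar> + K) powr (?p - 2) * (K\<^sup>2 + K * V l x) \<partial>M)
     \<le> \<theta> * (2 powr ?p * ((\<integral>x. \<bar>W l x\<bar> powr ?p \<partial>M) + K powr ?p * \<mu>)) + \<theta> powr (1 - q) * (2 powr q * E)"
    if l: "l < n" for l
  proof -
    have Vq_int: "integrable M (\<lambda>x. V l x powr q)"
      using abs_le_D1[OF V_bound] V_nonneg[of l] q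
      by (intro integrable_bounded[where c="(real n * \<bar>B\<bar>) powr q"]) (auto intro!: powr_mono2)
    have Wq_int: "integrable M (\<lambda>x. \<bar>W l x\<bar> powr ?p)" using l by (intro integrable_W_powr) auto
    have "(\<integral>x. (\<bar>W l x\<bar> + K) powr (?p - 2) * (K\<^sup>2 + K * V l x) \<partial>M)
       \<le> (\<integral>x. \<theta> * (2 powr ?p * (\<bar>W l x\<bar> powr ?p + K powr ?p)) + \<theta> powr (1 - q) * (2 powr q * (K powr ?p + K powr q * V l x powr q)) \<partial>M)"
    proof (rule integral_mono)
      show "integrable M (\<lambda>x. (\<bar>W l x\<bar> + K) powr (?p - 2) * (K\<^sup>2 + K * V l x))"
        using l by (intro integrable_main_term) auto
      show "integrable M (\<lambda>x. \<theta> * (2 powr ?p * (\<bar>W l x\<bar> powr ?p + K powr ?p)) + \<theta> powr (1 - q) * (2 powr q * (K powr ?p + K powr q * V l x powr q)))"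
        using Vq_int Wq_int by auto
      fix x assume x: "x \<in> space M"
      have "(\<bar>W l x\<bar> + K) powr (?p - 2) * (K\<^sup>2 + K * V l x)
          \<le> \<theta> * (\<bar>W l x\<bar> + K) powr ?p + \<theta> powr (1 - q) * (K\<^sup>2 + K * V l x) powr q"
        using K lam q V_nonneg[of l x] by (intro young_powr) auto
      also have "(\<bar>W l x\<bar> + K) powr ?p \<le> 2 powr ?p * (\<bar>W l x\<bar> powr ?p + K powr ?p)"
        using K q by (intro powr_add_le) auto
      also have "(K\<^sup>2 + K * V l x) powr q \<le> 2 powr q * (K\<^sup>2 powr q + (K * V l x) powr q)"
        using K q V_nonneg[of l x] by (intro powr_add_le) auto
      also have "K\<^sup>2 powr q = K powr ?p" using K powr_powr[of K 2 q] by simp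
      also have "(K * V l x) powr q = K powr q * V l x powr q" by (rule powr_mult)
      finally show "(\<bar>W l x\<bar> + K) powr (?p - 2) * (K\<^sup>2 + K * V l x)
         \<le> \<theta> * (2 powr ?p * (\<bar>W l x\<bar> powr ?p + K powr ?p)) + \<theta> powr (1 - q) * (2 powr q * (K powr ?p + K powr q * V l x powr q))"
        using lam by simp
    qed
    also have "\<dots> = \<theta> * (2 powr ?p * ((\<integral>x. \<bar>W l x\<bar> powr ?p \<partial>M) + K powr ?p * \<mu>))
       + \<theta> powr (1 - q) * (2 powr q * (K powr ?p * \<mu> + K powr q * (\<integral>x. V l x powr q \<partial>M)))"
      using Vq_int Wq_int by (simp add: \<mu>_def mult_ac)
    also have "\<dots> \<le> \<theta> * (2 powr ?p * ((\<integral>x. \<bar>W l x\<bar> powr ?p \<partial>M) + K powr ?p * \<mu>)) + \<theta> powr (1 - q) * (2 powr q * E)"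
      unfolding E_def using Z_moment[OF l] by (intro add_left_mono mult_left_mono) (auto simp: V_def)
    finally show ?thesis .
  qed
  have R: "(\<integral>x. \<bar>W m x\<bar> powr ?p \<partial>M) \<le> R" if "m \<le> n" for m
    using that
  proof (induction m rule: less_induct)
    case (less m)
    have R0: "0 \<le> R" using mu c E by (simp add: R_def)
    have "(\<integral>x. \<bar>W m x\<bar> powr ?p \<partial>M)
      \<le> c * (\<Sum>l<m. \<integral>x. (\<bar>W l x\<bar> + K) powr (?p - 2) * (K\<^sup>2 + K * V l x) \<partial>M)"
      unfolding c_def by (rule moment_step[OF less.prems])
    also have "\<dots> \<le> c * (\<Sum>l<m. \<theta> * (2 powr ?p * (R + K powr ?p * \<mu>)) + \<theta> powr (1 - q) * (2 powr q * E))"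
    proof (intro mult_left_mono sum_mono)
      fix l assume "l \<in> {..<m}"
      hence l: "l < m" "l < n" using less.prems by auto
      note v[OF l(2)]
      also have "(\<integral>x. \<bar>W l x\<bar> powr ?p \<partial>M) \<le> R" using less.IH[OF l(1)] l(2) by simp
      finally show "(\<integral>x. (\<bar>W l x\<bar> + K) powr (?p - 2) * (K\<^sup>2 + K * V l x) \<partial>M)
        \<le> \<theta> * (2 powr ?p * (R + K powr ?p * \<mu>)) + \<theta> powr (1 - q) * (2 powr q * E)" using lam by simp
    qed (use c in simp)
    also have "\<dots> = c * (real m * (\<theta> * (2 powr ?p * (R + K powr ?p * \<mu>)) + \<theta> powr (1 - q) * (2 powr q * E)))"
      by simp
    also have "\<dots> \<le> c * (real n * (\<theta> * (2 powr ?p * (R + K powr ?p * \<mu>)) + \<theta> powr (1 - q) * (2 powr q * E)))"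
      using less.prems c lam R0 E mu by (intro mult_left_mono mult_right_mono add_nonneg_nonneg mult_nonneg_nonneg) auto
    also have "\<dots> = (R + K powr ?p * \<mu>) * (c * real n * \<theta> * 2 powr ?p) + c * real n * (\<theta> powr (1 - q) * (2 powr q * E))"
      by (simp add: algebra_simps)
    also have "c * real n * \<theta> * 2 powr ?p = 1 / 2" using c n by (simp add: \<theta>_def)
    also have "(R + K powr ?p * \<mu>) * (1 / 2) + c * real n * (\<theta> powr (1 - q) * (2 powr q * E)) = R"
      by (simp add: R_def)
    finally show ?case .
  qed
  have "\<theta> powr (1 - q) = (2 * 2 powr ?p * c * real n) powr (q - 1)"
    using c n powr_minus_divide[of "2 * 2 powr ?p * c * real n" "1 - q"] by (simp add: \<theta>_def powr_divide)
  also have "\<dots> = (2 * 2 powr ?p * c) powr (q - 1) * real n powr (q - 1)" by (rule powr_mult)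
  finally have "real n * \<theta> powr (1 - q) = (2 * 2 powr ?p * c) powr (q - 1) * real n powr q"
    using n by (simp add: powr_diff)
  hence "R = K powr ?p * \<mu> + 2 * c * ((2 * 2 powr ?p * c) powr (q - 1) * real n powr q) * (2 powr q * E)"
    by (simp add: R_def mult_ac)
  also have "K powr ?p * \<mu> \<le> real n powr q * E"
    using E n mult_mono[of 1 "real n powr q" "K powr ?p * \<mu>" E] mu q ge_one_powr_ge_zero[of "real n" q] by simp
  finally have "R \<le> moment_const q * real n powr q * E"
    by (simp add: moment_const_def Let_def c_def algebra_simps)
  thus ?thesis using R[of n] by (simp add: E_def \<mu>_def)
qed

end

section \<open>Deviations of Birkhoff sums\<close>

definition (in intermittent_family) start_const :: real where
  "start_const = cone_const / (1 - \<alpha>)"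

locale observable = intermittent_family +
  fixes h \<phi> :: "real \<Rightarrow> real" and K :: real and a :: "nat \<Rightarrow> real"
  assumes h_antimono: "\<And>x y. 0 < x \<Longrightarrow> x \<le> y \<Longrightarrow> y \<le> 1 \<Longrightarrow> h y \<le> h x"
    and h_ge_1: "\<And>x. x \<in> {0<..1} \<Longrightarrow> 1 \<le> h x"
    and h_le: "\<And>x. x \<in> {0<..1} \<Longrightarrow> h x \<le> x powr (- \<alpha>)"
    and phi_measurable [measurable]: "\<phi> \<in> borel_measurable borel"
    and K_pos: "0 < K"
    and phi_bound: "\<And>x. x \<in> {0<..1} \<Longrightarrow> \<bar>\<phi> x\<bar> \<le> K"
    and phi_Lipschitz: "\<And>x y. 0 < x \<Longrightarrow> x \<le> y \<Longrightarrow> y \<le> 1 \<Longrightarrow> \<bar>\<phi> y - \<phi> x\<bar> \<le> K * (y - x)"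
    and admissible: "admissible a"
begin

lemma h_cone: "decr_cone start_const h"
proof (rule coneI)
  have A: "1 \<le> start_const"
    using cone_const_ge_1 alpha_pos alpha_less_1 by (simp add: start_const_def field_simps)
  fix x :: real assume x: "x \<in> {0<..1}"
  show "0 \<le> h x" using h_ge_1[OF x] by simp
  have "h x \<le> 1 * x powr (- \<alpha>)" using h_le[OF x] by simp
  also have "\<dots> \<le> start_const * x powr (- \<alpha>)" using A by (intro mult_right_mono) auto
  finally show "h x \<le> start_const * x powr (- \<alpha>)" .
next
  have hm: "h \<in> borel_measurable unit_borel"
    using h_antimono by (intro antimono_measurable_unit_borel) (auto simp: monotone_on_def)
  have i: "integrable unit_borel h"
  proof (rule Bochner_Integration.integrable_bound[OF integrable_powr_unit_borel[OF alpha_less_1] hm])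
    show "AE x in unit_borel. norm (h x) \<le> norm (x powr (- \<alpha>))"
      using h_ge_1 h_le by (intro AE_I2) (force dest: order_trans[OF zero_le_one])
  qed
  have "integral\<^sup>L unit_borel h \<le> (\<integral>x. x powr (- \<alpha>) \<partial>unit_borel)"
    using h_le by (intro integral_mono_unit_borel i integrable_powr_unit_borel alpha_less_1) auto
  also have "\<dots> = (\<integral>x. x powr (- \<alpha>) * indicator {0<..1} x \<partial>unit_borel)"
    by (rule Bochner_Integration.integral_cong) auto
  also have "\<dots> = 1 / (1 - \<alpha>)"
    using integral_powr_unit_borel[OF alpha_less_1, of 1] by simp
  finally show "cone_const * integral\<^sup>L unit_borel h \<le> start_const"
    using mult_left_mono[of "integral\<^sup>L unit_borel h" "1 / (1 - \<alpha>)" cone_const] cone_const_ge_1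
    by (simp add: start_const_def)
qed (rule h_antimono)

lemmas h_measurable [measurable] = cone_measurable[OF h_cone]
lemmas h_integrable = cone_integrable[OF h_cone]

definition mass :: real where "mass = integral\<^sup>L unit_borel h"

lemma mass_ge_1: "1 \<le> mass"
proof -
  have "(\<integral>x. 1 \<partial>unit_borel) \<le> mass"
    unfolding mass_def using h_ge_1 h_integrable by (intro integral_mono_unit_borel) auto
  thus ?thesis by simp
qed

lemma mass_le: "mass \<le> 1 / (1 - \<alpha>)"
proof -
  have "cone_const * mass \<le> cone_const * (1 / (1 - \<alpha>))"
    using cone_mass[OF h_cone] by (simp add: start_const_def mass_def)
  thus ?thesis by (rule mult_left_le_imp_le) (use cone_const_ge_1 in simp)
qed

lemma a_pos: "1 \<le> j \<Longrightarrow> 0 < a j"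
  using admissible by (simp add: admissible_def)

lemma seq_map_in: "x \<in> {0<..1} \<Longrightarrow> seq_map a k x \<in> {0<..1}"
  by (rule seq_map_unit) (auto intro: a_pos)

definition mean :: "nat \<Rightarrow> real" where
  "mean k = (\<integral>x. h x * \<phi> (seq_map a k x) \<partial>unit_borel) / mass"

definition psi :: "nat \<Rightarrow> real \<Rightarrow> real" where "psi k y = \<phi> y - mean k"

definition X :: "nat \<Rightarrow> real \<Rightarrow> real" where "X k x = psi k (seq_map a k x)"

definition dens :: "nat \<Rightarrow> real \<Rightarrow> real" where "dens k = transfers a k h"

text \<open>For k \<le> i, the density of the image under the i-th iterate of the signed measure
  with density \<open>X k\<close> times h.\<close>

definition corr :: "nat \<Rightarrow> nat \<Rightarrow> real \<Rightarrow> real" where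
  "corr k i = transfers (\<lambda>j. a (j + k)) (i - k) (\<lambda>y. psi k y * dens k y)"

lemma mean_bound: "\<bar>mean k\<bar> \<le> K"
proof -
  have "\<bar>\<integral>x. h x * \<phi> (seq_map a k x) \<partial>unit_borel\<bar> \<le> (\<integral>x. \<bar>h x * \<phi> (seq_map a k x)\<bar> \<partial>unit_borel)"
    by (rule integral_abs_bound)
  also have i: "integrable unit_borel (\<lambda>x. h x * \<phi> (seq_map a k x))"
    using phi_bound[OF seq_map_in]
    by (intro integrable_bounded_mult_unit_borel[OF h_integrable] borel_measurable_unit_borel) auto
  have "(\<integral>x. \<bar>h x * \<phi> (seq_map a k x)\<bar> \<partial>unit_borel) \<le> (\<integral>x. h x * K \<partial>unit_borel)"
  proof (rule integral_mono_unit_borel)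
    fix x :: real assume x: "x \<in> {0<..1}"
    show "\<bar>h x * \<phi> (seq_map a k x)\<bar> \<le> h x * K"
      using phi_bound[OF seq_map_in[OF x]] h_ge_1[OF x] by (simp add: abs_mult mult_left_mono)
  qed (use i h_integrable in auto)
  also have "\<dots> = mass * K" by (simp add: mass_def)
  finally show ?thesis using mass_ge_1 by (simp add: mean_def divide_simps mult.commute)
qed

lemma psi_bound: "y \<in> {0<..1} \<Longrightarrow> \<bar>psi k y\<bar> \<le> 2 * K"
  using phi_bound[of y] mean_bound[of k] by (simp add: psi_def)

lemma psi_measurable [measurable]: "psi k \<in> borel_measurable borel"
  unfolding psi_def[abs_def] by measurable

lemma X_measurable [measurable]: "X k \<in> borel_measurable borel"
  unfolding X_def[abs_def] by measurable

lemma X_bound: "x \<in> {0<..1} \<Longrightarrow> \<bar>X k x\<bar> \<le> 2 * K"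
  unfolding X_def by (intro psi_bound seq_map_in)

lemma dens_cone: "decr_cone start_const (dens k)"
  unfolding dens_def by (rule transfers_cone[OF admissible h_cone])

text \<open>The bound h \<ge> 1 carries the floor of the constant density over to h. Positivity is
  what makes the quotient in \<open>cond\<close> meaningful.\<close>

lemma dens_ge: "y \<in> {0<..1} \<Longrightarrow> floor_const \<le> dens k y"
proof -
  assume y: "y \<in> {0<..1}"
  have "floor_const \<le> transfers a k (\<lambda>_. 1) y" by (rule floor_const_le[OF admissible y])
  also have "\<dots> \<le> dens k y" unfolding dens_def using h_ge_1 y by (intro transfers_mono a_pos) auto
  finally show ?thesis .
qed

lemma dens_pos: "y \<in> {0<..1} \<Longrightarrow> 0 < dens k y"
  using dens_ge[of y k] floor_const_pos by simp

lemma dens_shift: "k \<le> i \<Longrightarrow> transfers (\<lambda>j. a (j + k)) (i - k) (dens k) = dens i"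
  using transfers_add[of a k "i - k" h] by (simp add: dens_def)

lemma dens_duality:
  assumes "g \<in> borel_measurable unit_borel" "\<And>y. y \<in> {0<..1} \<Longrightarrow> \<bar>g y\<bar> \<le> B"
  shows "(\<integral>x. h x * g (seq_map a k x) \<partial>unit_borel) = (\<integral>y. dens k y * g y \<partial>unit_borel)"
  unfolding dens_def
proof (rule transfers_duality(2)[symmetric, OF a_pos h_measurable assms(1)])
  have "(\<lambda>y. g (seq_map a k y)) \<in> borel_measurable unit_borel"
    using assms(1) seq_map_unit_measurable[of a k] a_pos by measurable
  thus "integrable unit_borel (\<lambda>y. h y * g (seq_map a k y))"
    using assms(2)[OF seq_map_in] by (intro integrable_bounded_mult_unit_borel[OF h_integrable])
qed

lemma psi_dens_integrable: "integrable unit_borel (\<lambda>y. psi k y * dens k y)"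
proof -
  have "integrable unit_borel (\<lambda>y. dens k y * psi k y)"
    using psi_bound by (intro integrable_bounded_mult_unit_borel[OF cone_integrable[OF dens_cone]]
        borel_measurable_unit_borel psi_measurable)
  thus ?thesis by (simp add: mult.commute)
qed

lemma corr_measurable [measurable]: "corr k i \<in> borel_measurable unit_borel"
  unfolding corr_def by (intro transfers_measurable borel_measurable_integrable psi_dens_integrable) (simp add: a_pos)

lemma dens_measurable [measurable]: "dens k \<in> borel_measurable unit_borel"
  by (rule cone_measurable[OF dens_cone])

lemma psi_mean_zero: "(\<integral>y. psi k y * dens k y \<partial>unit_borel) = 0"
proof -
  have i: "integrable unit_borel (\<lambda>x. h x * \<phi> (seq_map a k x))"
    using phi_bound[OF seq_map_in]
    by (intro integrable_bounded_mult_unit_borel[OF h_integrable] borel_measurable_unit_borel) auto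
  have "(\<integral>y. psi k y * dens k y \<partial>unit_borel) = (\<integral>y. dens k y * psi k y \<partial>unit_borel)" by (simp add: mult.commute)
  also have "\<dots> = (\<integral>x. h x * psi k (seq_map a k x) \<partial>unit_borel)"
    by (rule dens_duality[symmetric, of _ "2 * K"]) (auto intro: borel_measurable_unit_borel psi_bound)
  also have "\<dots> = (\<integral>x. h x * \<phi> (seq_map a k x) - h x * mean k \<partial>unit_borel)"
    by (simp add: psi_def right_diff_distrib)
  also have "\<dots> = (\<integral>x. h x * \<phi> (seq_map a k x) \<partial>unit_borel) - mass * mean k"
    using i h_integrable by (simp add: mass_def)
  also have "\<dots> = 0" using mass_ge_1 by (simp add: mean_def)
  finally show ?thesis .
qed

text \<open>Transfer operators preserve inequalities, so the pointwise bound 2 K on the centered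
  observable at time k becomes a bound on the ratio of the two densities at time i.\<close>

lemma corr_bound:
  assumes ki: "k \<le> i" and y: "y \<in> {0<..1}"
  shows "\<bar>corr k i y\<bar> \<le> 2 * K * dens i y"
proof -
  let ?a = "\<lambda>j. a (j + k)"
  have ap: "1 \<le> j \<Longrightarrow> 0 < ?a j" for j by (simp add: a_pos)
  have scale: "transfers ?a (i - k) (\<lambda>y. c * dens k y) y = c * dens i y" for c
    using transfers_lincomb[of ?a "i - k" c "dens k" 0 "dens k"] dens_shift[OF ki] by (simp add: fun_eq_iff)
  have b: "\<bar>psi k y * dens k y\<bar> \<le> 2 * K * dens k y" if "y \<in> {0<..1}" for y
    using psi_bound[OF that, of k] dens_pos[OF that, of k] by (simp add: abs_mult mult_right_mono)
  have "corr k i y \<le> transfers ?a (i - k) (\<lambda>y. 2 * K * dens k y) y"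
    unfolding corr_def using b by (intro transfers_mono ap y) (auto simp: abs_le_iff)
  moreover have "transfers ?a (i - k) (\<lambda>y. (- 2 * K) * dens k y) y \<le> corr k i y"
    unfolding corr_def by (intro transfers_mono ap y, simp, drule b) (simp add: abs_le_iff)
  ultimately show ?thesis unfolding scale by (simp add: abs_le_iff)
qed

text \<open>
  A Lipschitz function is a difference of decreasing ones: \<open>\<psi> = (\<psi> + 3 K - K y) - (3 K - K y)\<close>,
  both terms being nonnegative on the unit interval because \<open>\<bar>\<psi>\<bar> \<le> 2 K\<close>.
\<close>

lemma corr_integral_le:
  assumes D: "\<And>a A f g n. admissible a \<Longrightarrow> decr_cone A f \<Longrightarrow> decr_cone A g \<Longrightarrow>
     integral\<^sup>L unit_borel f = integral\<^sup>L unit_borel g \<Longrightarrow> 1 \<le> n \<Longrightarrow>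
     (\<integral>x. \<bar>transfers a n f x - transfers a n g x\<bar> \<partial>unit_borel) \<le> A * D * real n powr (- decay_exp)"
    and ki: "k < i"
  shows "(\<integral>y. \<bar>corr k i y\<bar> \<partial>unit_borel) \<le> 5 * K * start_const * D * real (i - k) powr (- decay_exp)"
proof -
  define u where "u y = psi k y + (3 * K - K * y)" for y
  define v where "v y = 3 * K - K * y" for y
  have Ky: "0 \<le> K * y" "K * y \<le> K" if "y \<in> {0<..1}" for y
    using K_pos that by (auto simp: mult_left_le)
  have cu: "decr_cone (5 * K * start_const) (\<lambda>y. u y * dens k y)"
  proof (rule cone_mult[OF dens_cone])
    show "u y \<le> u x" if "0 < x" "x \<le> y" "y \<le> 1" for x y
      using phi_Lipschitz[OF that] by (simp add: u_def psi_def algebra_simps)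
    show "0 \<le> u y" "u y \<le> 5 * K" if "y \<in> {0<..1}" for y
      using psi_bound[OF that, of k] Ky[OF that] by (auto simp: u_def)
  qed
  have cv: "decr_cone (5 * K * start_const) (\<lambda>y. v y * dens k y)"
  proof (rule cone_mult[OF dens_cone])
    show "v y \<le> v x" if "0 < x" "x \<le> y" "y \<le> 1" for x y
      using that K_pos by (simp add: v_def)
    show "0 \<le> v y" "v y \<le> 5 * K" if "y \<in> {0<..1}" for y
      using Ky[OF that] K_pos by (auto simp: v_def)
  qed
  have e: "psi k y * dens k y = u y * dens k y - v y * dens k y" for y
    by (simp add: u_def v_def algebra_simps)
  have "integral\<^sup>L unit_borel (\<lambda>y. u y * dens k y) - integral\<^sup>L unit_borel (\<lambda>y. v y * dens k y)
      = (\<integral>y. psi k y * dens k y \<partial>unit_borel)"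
    unfolding e using cone_integrable[OF cu] cone_integrable[OF cv] by simp
  hence eq: "integral\<^sup>L unit_borel (\<lambda>y. u y * dens k y) = integral\<^sup>L unit_borel (\<lambda>y. v y * dens k y)"
    using psi_mean_zero[of k] by simp
  have "1 \<le> i - k" using ki by simp
  from D[OF admissible_shift[OF admissible, of k] cu cv eq this] show ?thesis
    unfolding corr_def e transfers_diff .
qed

section \<open>Conditional expectations given an iterate\<close>

definition weighted :: "real measure" where
  "weighted = density unit_borel (\<lambda>x. ennreal (h x))"

lemma space_weighted [simp]: "space weighted = {0<..1}"
  by (simp add: weighted_def)

lemma measurable_weighted: "f \<in> borel_measurable unit_borel \<Longrightarrow> f \<in> borel_measurable weighted"
  by (simp add: weighted_def)

lemma integral_weighted:
  fixes f :: "real \<Rightarrow> real"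
  assumes "f \<in> borel_measurable unit_borel"
  shows "integral\<^sup>L weighted f = (\<integral>x. h x * f x \<partial>unit_borel)"
proof -
  have "AE x in unit_borel. 0 \<le> h x" using h_ge_1 by (intro AE_I2) (auto dest: order_trans[OF zero_le_one])
  thus ?thesis unfolding weighted_def by (subst integral_density) (use assms in auto)
qed

lemma finite_measure_weighted: "finite_measure weighted"
proof (rule finite_measureI)
  have "emeasure weighted (space weighted) = (\<integral>\<^sup>+ x. ennreal (h x) * indicator {0<..1} x \<partial>unit_borel)"
    unfolding weighted_def by (subst emeasure_density) (auto simp: sets_unit_borel)
  also have "\<dots> = (\<integral>\<^sup>+ x. ennreal (h x) \<partial>unit_borel)" by (rule nn_integral_cong) auto
  also have "\<dots> = ennreal mass"
    unfolding mass_def using h_integrable h_ge_1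
    by (intro nn_integral_eq_integral AE_I2) (auto dest: order_trans[OF zero_le_one])
  finally show "emeasure weighted (space weighted) \<noteq> \<infinity>" by simp
qed

lemma measure_weighted: "measure weighted {0<..1} = mass"
proof -
  interpret finite_measure weighted by (rule finite_measure_weighted)
  have "measure weighted {0<..1} = (\<integral>x. 1 \<partial>weighted)" by simp
  also have "\<dots> = mass" by (subst integral_weighted) (auto simp: mass_def)
  finally show ?thesis .
qed

text \<open>As a ratio of two image densities, the conditional expectation of \<open>X k\<close>
  given the i-th iterate is an explicit function of that iterate, with no choice of version.\<close>

definition cond :: "nat \<Rightarrow> nat \<Rightarrow> real \<Rightarrow> real" where
  "cond k i x = corr k i (seq_map a i x) / dens i (seq_map a i x)"

lemma seq_map_measurable_unit [measurable]: "seq_map a k \<in> measurable unit_borel unit_borel"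
  by (rule seq_map_unit_measurable) (rule a_pos)

lemma cond_measurable [measurable]: "cond k i \<in> borel_measurable unit_borel"
  unfolding cond_def[abs_def] by measurable

lemma cond_bound: 
  assumes "k \<le> i" "x \<in> {0<..1}" shows "\<bar>cond k i x\<bar> \<le> 2 * K"
  using corr_bound[OF assms(1) seq_map_in[OF assms(2)]] dens_pos[OF seq_map_in[OF assms(2)], of i i]
  by (simp add: cond_def abs_divide divide_le_eq)

text \<open>Duality moves each integral to time i. The first two results agree, so
  \<open>cond k i\<close> may replace \<open>X k\<close> against bounded functions of the i-th
  iterate. The third turns an L1 norm into the quantity that loss of memory controls.\<close>

lemma cond_integral:
  assumes ki: "k \<le> i" and g[measurable]: "g \<in> borel_measurable unit_borel"
    and gB: "\<And>y. y \<in> {0<..1} \<Longrightarrow> \<bar>g y\<bar> \<le> B"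
  shows "(\<integral>x. h x * (g (seq_map a i x) * X k x) \<partial>unit_borel) = (\<integral>y. corr k i y * g y \<partial>unit_borel)"
    and "(\<integral>x. h x * (g (seq_map a i x) * cond k i x) \<partial>unit_borel) = (\<integral>y. corr k i y * g y \<partial>unit_borel)"
    and "(\<integral>x. h x * \<bar>cond k i x\<bar> \<partial>unit_borel) = (\<integral>y. \<bar>corr k i y\<bar> \<partial>unit_borel)"
proof -
  let ?a = "\<lambda>j. a (j + k)"
  have ap: "1 \<le> j \<Longrightarrow> 0 < ?a j" for j by (simp add: a_pos)
  have sm: "seq_map a i x = seq_map ?a (i - k) (seq_map a k x)" for x
    using seq_map_add[of a k "i - k" x] ki by simp
  have [measurable]: "seq_map ?a (i - k) \<in> measurable unit_borel unit_borel"
    by (rule seq_map_unit_measurable) (rule ap)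
  have [measurable]: "psi k \<in> borel_measurable unit_borel" by (rule borel_measurable_unit_borel[OF psi_measurable])
  have inr: "seq_map ?a (i - k) y \<in> {0<..1}" if "y \<in> {0<..1}" for y
    using that by (intro seq_map_unit ap)
  have "(\<integral>x. h x * (g (seq_map a i x) * X k x) \<partial>unit_borel)
      = (\<integral>y. dens k y * (g (seq_map ?a (i - k) y) * psi k y) \<partial>unit_borel)"
    unfolding X_def sm
  proof (rule dens_duality)
    show "\<bar>g (seq_map ?a (i - k) y) * psi k y\<bar> \<le> B * (2 * K)" if y: "y \<in> {0<..1}" for y
      using gB[OF inr[OF y]] psi_bound[OF y, of k] by (auto simp: abs_mult intro!: mult_mono)
  qed measurable
  also have "\<dots> = (\<integral>y. psi k y * dens k y * g (seq_map ?a (i - k) y) \<partial>unit_borel)"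
    by (simp add: mult_ac)
  also have "\<dots> = (\<integral>y. corr k i y * g y \<partial>unit_borel)"
    unfolding corr_def
  proof (rule transfers_duality(2)[symmetric, OF ap])
    show "integrable unit_borel (\<lambda>y. psi k y * dens k y * g (seq_map ?a (i - k) y))"
      using gB[OF inr] by (intro integrable_bounded_mult_unit_borel[OF psi_dens_integrable]) auto
  qed measurable
  finally show "(\<integral>x. h x * (g (seq_map a i x) * X k x) \<partial>unit_borel) = (\<integral>y. corr k i y * g y \<partial>unit_borel)" .
  have b: "\<bar>corr k i y / dens i y\<bar> \<le> 2 * K" if y: "y \<in> {0<..1}" for y
    using corr_bound[OF ki y] dens_pos[OF y, of i] by (simp add: abs_divide divide_le_eq)
  have "(\<integral>x. h x * (g (seq_map a i x) * cond k i x) \<partial>unit_borel)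
      = (\<integral>y. dens i y * (g y * (corr k i y / dens i y)) \<partial>unit_borel)"
    unfolding cond_def
  proof (rule dens_duality)
    show "\<bar>g y * (corr k i y / dens i y)\<bar> \<le> B * (2 * K)" if y: "y \<in> {0<..1}" for y
      using gB[OF y] b[OF y] by (auto simp only: abs_mult intro!: mult_mono)
  qed measurable
  also have "\<dots> = (\<integral>y. corr k i y * g y \<partial>unit_borel)"
    using dens_pos[of _ i] by (intro Bochner_Integration.integral_cong) force+
  finally show "(\<integral>x. h x * (g (seq_map a i x) * cond k i x) \<partial>unit_borel) = (\<integral>y. corr k i y * g y \<partial>unit_borel)" .
  have "(\<integral>x. h x * \<bar>cond k i x\<bar> \<partial>unit_borel) = (\<integral>y. dens i y * \<bar>corr k i y / dens i y\<bar> \<partial>unit_borel)"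
    unfolding cond_def
  proof (rule dens_duality)
    show "\<bar>\<bar>corr k i y / dens i y\<bar>\<bar> \<le> 2 * K" if y: "y \<in> {0<..1}" for y
      using b[OF y] by simp
  qed measurable
  also have "\<dots> = (\<integral>y. \<bar>corr k i y\<bar> \<partial>unit_borel)"
    using dens_pos[of _ i] by (intro Bochner_Integration.integral_cong) (force simp: abs_divide)+
  finally show "(\<integral>x. h x * \<bar>cond k i x\<bar> \<partial>unit_borel) = (\<integral>y. \<bar>corr k i y\<bar> \<partial>unit_borel)" .
qed

end

section \<open>Moments of Birkhoff sums\<close>

lemma sum_shift_le:
  fixes g :: "nat \<Rightarrow> real"
  assumes "\<And>d. 0 \<le> g d"
  shows "(\<Sum>i\<in>{l<..<n}. g (i - l)) \<le> (\<Sum>d=1..n. g d)"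
proof -
  have "(\<Sum>i\<in>{l<..<n}. g (i - l)) = (\<Sum>d\<in>{1..<n - l}. g d)"
    by (rule sum.reindex_bij_witness[of _ "\<lambda>d. d + l" "\<lambda>i. i - l"]) auto
  also have "\<dots> \<le> (\<Sum>d=1..n. g d)" using assms by (intro sum_mono2) auto
  finally show ?thesis .
qed

context observable begin

text \<open>\<open>powr_sum_le\<close> with weights 1/d brings in the harmonic sum and the factor
  d^(q - 1). The uniform bound 2 K reduces the q-th power of each term to the first power, whose
  integral is of order d^-\<beta>.\<close>

lemma cond_moment:
  assumes D: "\<And>a A f g n. admissible a \<Longrightarrow> decr_cone A f \<Longrightarrow> decr_cone A g \<Longrightarrow>
     integral\<^sup>L unit_borel f = integral\<^sup>L unit_borel g \<Longrightarrow> 1 \<le> n \<Longrightarrow>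
     (\<integral>x. \<bar>transfers a n f x - transfers a n g x\<bar> \<partial>unit_borel) \<le> A * D * real n powr (- decay_exp)"
    and D0: "0 < D" and q: "1 \<le> q" and l: "l < n"
  shows "(\<integral>x. (\<Sum>i\<in>{l<..<n}. \<bar>cond (n - i) (n - l) x\<bar>) powr q \<partial>weighted)
     \<le> (\<Sum>d=1..n. 1 / real d) powr (q - 1) * ((2 * K) powr (q - 1) *
         (5 * K * start_const * D * (\<Sum>d=1..n. real d powr (q - 1 - decay_exp))))"
proof -
  interpret W: finite_measure weighted by (rule finite_measure_weighted)
  define H where "H = (\<Sum>d=1..n. 1 / real d)"
  define C where "C = 5 * K * start_const * D"
  have sc: "0 \<le> start_const" by (rule cone_A_nonneg[OF h_cone])
  have C: "0 \<le> C" using K_pos sc D0 by (simp add: C_def)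
  let ?z = "\<lambda>i x. \<bar>cond (n - i) (n - l) x\<bar>"
  have z_meas: "?z i \<in> borel_measurable weighted" for i
    by (intro measurable_weighted) measurable
  have z_int: "integrable weighted (?z i)" if "l < i" for i
    using that cond_bound[of "n - i" "n - l"] by (intro W.integrable_const_bound[where B="2 * K"] z_meas AE_I2) auto
  have pw: "(\<Sum>i\<in>{l<..<n}. ?z i x) powr q
      \<le> H powr (q - 1) * ((2 * K) powr (q - 1) * (\<Sum>i\<in>{l<..<n}. real (i - l) powr (q - 1) * ?z i x))"
    if x: "x \<in> {0<..1}" for x
  proof -
    have "(\<Sum>i\<in>{l<..<n}. ?z i x) powr q \<le> (\<Sum>i\<in>{l<..<n}. 1 / real (i - l)) powr (q - 1) *
        (\<Sum>i\<in>{l<..<n}. (1 / real (i - l)) powr (1 - q) * ?z i x powr q)"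
      by (rule powr_sum_le[OF q]) auto
    also have "\<dots> \<le> H powr (q - 1) * (\<Sum>i\<in>{l<..<n}. real (i - l) powr (q - 1) * ((2 * K) powr (q - 1) * ?z i x))"
    proof (intro mult_mono sum_mono powr_mono2)
      show "(\<Sum>i\<in>{l<..<n}. 1 / real (i - l)) \<le> H"
        unfolding H_def by (rule sum_shift_le) simp
      fix i assume i: "i \<in> {l<..<n}"
      show "(1 / real (i - l)) powr (1 - q) \<le> real (i - l) powr (q - 1)"
        using i powr_minus_divide[of "real (i - l)" "1 - q"] by (simp add: powr_divide)
      have "?z i x powr q = ?z i x powr (q - 1) * ?z i x"
        by (cases "?z i x = 0") (auto simp: powr_diff)
      also have "\<dots> \<le> (2 * K) powr (q - 1) * ?z i x"
        using i x q cond_bound[of "n - i" "n - l" x] by (intro mult_right_mono powr_mono2) auto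
      finally show "?z i x powr q \<le> (2 * K) powr (q - 1) * ?z i x" .
    qed (use q in \<open>auto intro!: sum_nonneg\<close>)
    finally show ?thesis by (simp add: sum_distrib_left mult_ac)
  qed
  have "(\<integral>x. (\<Sum>i\<in>{l<..<n}. ?z i x) powr q \<partial>weighted)
      \<le> (\<integral>x. H powr (q - 1) * ((2 * K) powr (q - 1) * (\<Sum>i\<in>{l<..<n}. real (i - l) powr (q - 1) * ?z i x)) \<partial>weighted)"
  proof (rule integral_mono)
    show "integrable weighted (\<lambda>x. H powr (q - 1) * ((2 * K) powr (q - 1) * (\<Sum>i\<in>{l<..<n}. real (i - l) powr (q - 1) * ?z i x)))"
      using z_int by (intro integrable_mult_right Bochner_Integration.integrable_sum) auto
    then show "integrable weighted (\<lambda>x. (\<Sum>i\<in>{l<..<n}. ?z i x) powr q)"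
    proof (rule Bochner_Integration.integrable_bound)
      show "(\<lambda>x. (\<Sum>i\<in>{l<..<n}. ?z i x) powr q) \<in> borel_measurable weighted"
        using z_meas by measurable
    qed (use pw in \<open>auto intro!: AE_I2 order_trans[OF _ abs_ge_self]\<close>)
  qed (use pw in auto)
  also have "\<dots> = H powr (q - 1) * ((2 * K) powr (q - 1) * (\<Sum>i\<in>{l<..<n}. real (i - l) powr (q - 1) * (\<integral>x. ?z i x \<partial>weighted)))"
    using z_int by (simp add: Bochner_Integration.integral_sum)
  also have "\<dots> \<le> H powr (q - 1) * ((2 * K) powr (q - 1) * (\<Sum>i\<in>{l<..<n}. C * real (i - l) powr (q - 1 - decay_exp)))"
  proof (intro mult_left_mono sum_mono)
    fix i assume i: "i \<in> {l<..<n}"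
    have "(\<integral>x. ?z i x \<partial>weighted) = (\<integral>x. h x * ?z i x \<partial>unit_borel)"
      by (rule integral_weighted) measurable
    also have "\<dots> = (\<integral>y. \<bar>corr (n - i) (n - l) y\<bar> \<partial>unit_borel)"
      by (rule cond_integral(3)[of _ _ "\<lambda>_. 0" 0]) (use i in auto)
    also have "\<dots> \<le> C * real ((n - l) - (n - i)) powr (- decay_exp)"
      unfolding C_def by (rule corr_integral_le[OF D]) (use i in auto)
    also have "(n - l) - (n - i) = i - l" using i by auto
    finally have "real (i - l) powr (q - 1) * (\<integral>x. ?z i x \<partial>weighted) \<le> real (i - l) powr (q - 1) * (C * real (i - l) powr (- decay_exp))"
      by (rule mult_left_mono) simp
    also have "\<dots> = C * real (i - l) powr (q - 1 - decay_exp)"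
      using powr_add[of "real (i - l)" "q - 1" "- decay_exp"] by simp
    finally show "real (i - l) powr (q - 1) * (\<integral>x. ?z i x \<partial>weighted) \<le> C * real (i - l) powr (q - 1 - decay_exp)" .
  qed auto
  also have "\<dots> \<le> H powr (q - 1) * ((2 * K) powr (q - 1) * (\<Sum>d=1..n. C * real d powr (q - 1 - decay_exp)))"
    using C by (intro mult_left_mono sum_shift_le) auto
  finally show ?thesis by (simp add: H_def C_def sum_distrib_left)
qed

text \<open>Indices run backwards: every j < k satisfies n - j \<ge> n - l, so the partial sum is a
  function of the iterate at time n - l, on which the conditional expectation is taken.\<close>

lemma cond_pairing:
  assumes l: "l < i" "i < n" and k: "k \<in> {l, Suc l}" and G: "continuous_on UNIV G"
  shows "(\<integral>x. G (\<Sum>j<k. X (n - j) x) * X (n - i) x \<partial>weighted)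
       = (\<integral>x. G (\<Sum>j<k. X (n - j) x) * cond (n - i) (n - l) x \<partial>weighted)"
proof -
  define s where "s y = (\<Sum>j<k. psi (n - j) (seq_map (\<lambda>m. a (m + (n - l))) (n - j - (n - l)) y))" for y
  define g where "g y = G (s y)" for y
  have [measurable]: "G \<in> borel_measurable borel" using G by (rule borel_measurable_continuous_onI)
  have sb[measurable]: "s \<in> borel_measurable borel" unfolding s_def[abs_def] by measurable
  have [measurable]: "g \<in> borel_measurable unit_borel"
    unfolding g_def[abs_def] by (rule borel_measurable_unit_borel) measurable
  have s_bound: "\<bar>s y\<bar> \<le> real k * (2 * K)" if y: "y \<in> {0<..1}" for y
  proof -
    have "seq_map (\<lambda>m. a (m + (n - l))) r y \<in> {0<..1}" for r
      using y by (intro seq_map_unit) (auto intro: a_pos)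
    hence "norm (s y) \<le> of_nat (card {..<k}) * (2 * K)"
      unfolding s_def by (intro sum_norm_bound) (auto intro: psi_bound)
    thus ?thesis by simp
  qed
  \<comment> \<open>\<open>cond_integral\<close> needs a bounded test function; G is merely
    continuous, but the partial sums range in a compact interval.\<close>
  have "compact (G ` {- (real k * (2 * K))..real k * (2 * K)})"
    by (intro compact_continuous_image continuous_on_subset[OF G]) auto
  then obtain B where "\<forall>z\<in>{- (real k * (2 * K))..real k * (2 * K)}. \<bar>G z\<bar> \<le> B"
    using compact_imp_bounded[of "G ` {- (real k * (2 * K))..real k * (2 * K)}"]
    unfolding bounded_iff by auto
  hence B: "\<bar>G z\<bar> \<le> B" if "z \<in> {- (real k * (2 * K))..real k * (2 * K)}" for z
    using that by blast
  have gB: "\<bar>g y\<bar> \<le> B" if "y \<in> {0<..1}" for y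
    unfolding g_def using s_bound[OF that] by (intro B) (auto simp: abs_le_iff)
  have Wg: "G (\<Sum>j<k. X (n - j) x) = g (seq_map a (n - l) x)" for x
  proof -
    have "(\<Sum>j<k. X (n - j) x) = s (seq_map a (n - l) x)"
      unfolding s_def
    proof (rule sum.cong)
      fix j assume "j \<in> {..<k}"
      hence "(n - l) + (n - j - (n - l)) = n - j" using k by auto
      thus "X (n - j) x = psi (n - j) (seq_map (\<lambda>m. a (m + (n - l))) (n - j - (n - l)) (seq_map a (n - l) x))"
        using seq_map_add[of a "n - l" "n - j - (n - l)" x] by (simp add: X_def)
    qed simp
    thus ?thesis by (simp add: g_def)
  qed
  have X_unit[measurable]: "X m \<in> borel_measurable unit_borel" for m
    by (rule borel_measurable_unit_borel[OF X_measurable])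
  have m: "n - i \<le> n - l" using l by auto
  note c = cond_integral[OF m \<open>g \<in> borel_measurable unit_borel\<close> gB]
  have "(\<integral>x. g (seq_map a (n - l) x) * X (n - i) x \<partial>weighted)
      = (\<integral>x. h x * (g (seq_map a (n - l) x) * X (n - i) x) \<partial>unit_borel)"
    by (rule integral_weighted) measurable
  also have "\<dots> = (\<integral>x. h x * (g (seq_map a (n - l) x) * cond (n - i) (n - l) x) \<partial>unit_borel)"
    using c(1,2) by simp
  also have "\<dots> = (\<integral>x. g (seq_map a (n - l) x) * cond (n - i) (n - l) x \<partial>weighted)"
    by (rule integral_weighted[symmetric]) measurable
  finally show ?thesis unfolding Wg .
qed

lemma moment_estimate:
  assumes D: "\<And>a A f g n. admissible a \<Longrightarrow> decr_cone A f \<Longrightarrow> decr_cone A g \<Longrightarrow>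
     integral\<^sup>L unit_borel f = integral\<^sup>L unit_borel g \<Longrightarrow> 1 \<le> n \<Longrightarrow>
     (\<integral>x. \<bar>transfers a n f x - transfers a n g x\<bar> \<partial>unit_borel) \<le> A * D * real n powr (- decay_exp)"
    and D0: "0 < D" and q: "1 \<le> q" and n: "1 \<le> n"
  shows "(\<integral>x. \<bar>\<Sum>j=1..n. X j x\<bar> powr (2 * q) \<partial>weighted)
     \<le> moment_const q * real n powr q * ((2 * K) powr (2 * q) * mass + (2 * K) powr q *
        ((\<Sum>d=1..n. 1 / real d) powr (q - 1) * ((2 * K) powr (q - 1) *
         (5 * K * start_const * D * (\<Sum>d=1..n. real d powr (q - 1 - decay_exp))))))"
proof -
  interpret W: finite_measure weighted by (rule finite_measure_weighted)
  interpret WD: weakly_dependent weighted "\<lambda>j. X (n - j)" "\<lambda>i l. cond (n - i) (n - l)" n "2 * K" "2 * K" q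
    "(\<Sum>d=1..n. 1 / real d) powr (q - 1) * ((2 * K) powr (q - 1) *
         (5 * K * start_const * D * (\<Sum>d=1..n. real d powr (q - 1 - decay_exp))))"
  proof unfold_locales
    show "\<bar>cond (n - i) (n - l) x\<bar> \<le> 2 * K" if "l < i" "i < n" "x \<in> space weighted" for i l x
      using that by (intro cond_bound) auto
    show "X (n - i) \<in> borel_measurable weighted" if "i < n" for i
      by (intro measurable_weighted borel_measurable_unit_borel[OF X_measurable])
    show "cond (n - i) (n - l) \<in> borel_measurable weighted" if "l < i" "i < n" for i l
      by (intro measurable_weighted cond_measurable)
    show "\<bar>X (n - i) x\<bar> \<le> 2 * K" if "i < n" "x \<in> space weighted" for i x
      using that by (intro X_bound) simp
    show "(\<integral>x. (\<Sum>i\<in>{l<..<n}. \<bar>cond (n - i) (n - l) x\<bar>) powr q \<partial>weighted)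
     \<le> (\<Sum>d=1..n. 1 / real d) powr (q - 1) * ((2 * K) powr (q - 1) *
         (5 * K * start_const * D * (\<Sum>d=1..n. real d powr (q - 1 - decay_exp))))" if "l < n" for l
      by (rule cond_moment[OF D D0 q that])
  qed (simp_all add: K_pos q cond_pairing)
  have "WD.W n x = (\<Sum>j=1..n. X j x)" for x
    unfolding WD.W_def by (rule sum.reindex_bij_witness[of _ "\<lambda>j. n - j" "\<lambda>j. n - j"]) auto
  thus ?thesis using WD.moment_bound[OF n] by (simp add: measure_weighted)
qed

end

section \<open>Markov's inequality and the deviation constants\<close>

lemma sum_inverse_le_ln: "1 \<le> n \<Longrightarrow> (\<Sum>d=1..n. 1 / real d) \<le> 1 + ln (real n)"
proof (induction n rule: nat_induct_at_least)
  case (Suc n)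
  have "ln (real n / real (Suc n)) \<le> real n / real (Suc n) - 1"
    using Suc.hyps by (intro ln_le_minus_one) auto
  hence "1 / real (Suc n) \<le> ln (real (Suc n)) - ln (real n)"
    using Suc.hyps by (simp add: ln_div field_simps)
  thus ?case using Suc.IH by simp
qed simp

text \<open>Young's inequality against 1 yields s d^(s - 1) \<le> d^s - (d - 1)^s, and the
  right-hand side telescopes.\<close>

lemma sum_powr_le:
  assumes s: "0 < s" "s \<le> 1" shows "(\<Sum>d=1..n. real d powr (s - 1)) \<le> real n powr s / s"
proof (induction n)
  case (Suc n)
  define d where "d = real (Suc n)"
  have d: "1 \<le> d" by (simp add: d_def)
  have "(1 - 1 / d) powr s \<le> 1 - s / d"
  proof (cases "d = 1")
    case False
    hence "(1 - 1 / d) powr s * 1 powr (1 - s) \<le> s * (1 - 1 / d) + (1 - s) * 1"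
      using s d by (intro Youngs_inequality_0) auto
    thus ?thesis by (simp add: algebra_simps)
  qed (use s in simp)
  hence "d powr s * (1 - 1 / d) powr s \<le> d powr s * (1 - s / d)" by (rule mult_left_mono) simp
  also have "d powr s * (1 - 1 / d) powr s = (d * (1 - 1 / d)) powr s" by (rule powr_mult[symmetric])
  also have "d * (1 - 1 / d) = real n" using d by (simp add: d_def field_simps)
  also have "d powr s * (1 - s / d) = d powr s - s * d powr (s - 1)"
    using d by (simp add: right_diff_distrib powr_diff)
  finally have "s * d powr (s - 1) \<le> d powr s - real n powr s" by simp
  hence "d powr (s - 1) \<le> d powr s / s - real n powr s / s" using s by (simp add: field_simps)
  thus ?case using Suc.IH by (simp add: d_def)
qed simp

lemma (in observable) tail_bound:
  assumes q: "1 \<le> q" and s: "0 < s"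
  shows "measure weighted {x \<in> {0<..1}. s < \<bar>\<Sum>j=1..n. X j x\<bar>}
     \<le> s powr (- (2 * q)) * (\<integral>x. \<bar>\<Sum>j=1..n. X j x\<bar> powr (2 * q) \<partial>weighted)"
proof -
  interpret W: finite_measure weighted by (rule finite_measure_weighted)
  define S where "S x = (\<Sum>j=1..n. X j x)" for x
  have Sb[measurable]: "S \<in> borel_measurable borel" unfolding S_def[abs_def] by measurable
  have [measurable]: "S \<in> borel_measurable weighted"
    by (intro measurable_weighted borel_measurable_unit_borel Sb)
  let ?E = "{x \<in> space weighted. s < \<bar>S x\<bar>}"
  have E: "?E \<in> sets weighted" by measurable
  have S_bound: "\<bar>S x\<bar> \<le> real n * (2 * K)" if "x \<in> {0<..1}" for x
    unfolding S_def using sum_norm_bound[of "{1..n}" "\<lambda>j. X j x" "2 * K"] X_bound[OF that] by simp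
  have i: "integrable weighted (\<lambda>x. \<bar>S x\<bar> powr (2 * q))"
    using S_bound q by (intro W.integrable_const_bound[where B="(real n * (2 * K)) powr (2 * q)"] AE_I2)
      (auto intro!: powr_mono2)
  have "measure weighted ?E = (\<integral>x. indicator ?E x \<partial>weighted)"
    using sets.sets_into_space[OF E] by (simp add: Int_absorb2)
  also have "\<dots> \<le> (\<integral>x. s powr (- (2 * q)) * \<bar>S x\<bar> powr (2 * q) \<partial>weighted)"
  proof (rule integral_mono)
    show "integrable weighted (indicat_real ?E)" 
      by (intro W.integrable_const_bound[where B=1] borel_measurable_indicator E) (simp add: indicator_le_1)
    show "integrable weighted (\<lambda>x. s powr (- (2 * q)) * \<bar>S x\<bar> powr (2 * q))" using i by simp
    fix x assume "x \<in> space weighted"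
    show "indicat_real ?E x \<le> s powr (- (2 * q)) * \<bar>S x\<bar> powr (2 * q)"
    proof (cases "x \<in> ?E")
      case True
      hence "s powr (2 * q) \<le> \<bar>S x\<bar> powr (2 * q)" using s q by (intro powr_mono2) auto
      hence "s powr (- (2 * q)) * s powr (2 * q) \<le> s powr (- (2 * q)) * \<bar>S x\<bar> powr (2 * q)"
        by (rule mult_left_mono) simp
      moreover have "s powr (- (2 * q)) * s powr (2 * q) = 1"
        using s by (simp add: powr_add[symmetric])
      ultimately show ?thesis using True by simp
    qed auto
  qed
  finally show ?thesis by (simp add: S_def)
qed

context intermittent_family begin

definition loss_const :: real where
  "loss_const = (SOME D. 0 < D \<and> (\<forall>a A f g n. admissible a \<longrightarrow> decr_cone A f \<longrightarrow> decr_cone A g \<longrightarrow>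
     integral\<^sup>L unit_borel f = integral\<^sup>L unit_borel g \<longrightarrow> 1 \<le> n \<longrightarrow>
     (\<integral>x. \<bar>transfers a n f x - transfers a n g x\<bar> \<partial>unit_borel) \<le> A * D * real n powr (- decay_exp)))"

lemma
  shows loss_const_pos: "0 < loss_const"
    and loss_const_bound: "admissible a \<Longrightarrow> decr_cone A f \<Longrightarrow> decr_cone A g \<Longrightarrow>
     integral\<^sup>L unit_borel f = integral\<^sup>L unit_borel g \<Longrightarrow> 1 \<le> n \<Longrightarrow>
     (\<integral>x. \<bar>transfers a n f x - transfers a n g x\<bar> \<partial>unit_borel) \<le> A * loss_const * real n powr (- decay_exp)"
proof -
  have "0 < loss_const \<and> (\<forall>a A f g n. admissible a \<longrightarrow> decr_cone A f \<longrightarrow> decr_cone A g \<longrightarrow>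
     integral\<^sup>L unit_borel f = integral\<^sup>L unit_borel g \<longrightarrow> 1 \<le> n \<longrightarrow>
     (\<integral>x. \<bar>transfers a n f x - transfers a n g x\<bar> \<partial>unit_borel) \<le> A * loss_const * real n powr (- decay_exp))"
    unfolding loss_const_def by (rule someI_ex) (use memory_loss in blast)
  thus "0 < loss_const" "admissible a \<Longrightarrow> decr_cone A f \<Longrightarrow> decr_cone A g \<Longrightarrow>
     integral\<^sup>L unit_borel f = integral\<^sup>L unit_borel g \<Longrightarrow> 1 \<le> n \<Longrightarrow>
     (\<integral>x. \<bar>transfers a n f x - transfers a n g x\<bar> \<partial>unit_borel) \<le> A * loss_const * real n powr (- decay_exp)"
    by blast+
qed

lemma start_const_pos: "0 < start_const"
  using cone_const_ge_1 alpha_less_1 by (simp add: start_const_def)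

definition corr_const :: "real \<Rightarrow> real" where
  "corr_const K = 5 * K * start_const * loss_const"

lemma corr_const_pos: "0 < K \<Longrightarrow> 0 < corr_const K"
  using start_const_pos loss_const_pos by (simp add: corr_const_def)

text \<open>The constants of the moment bounds, with 1/(1 - \<alpha>) standing for the mass of h.
  The powers of 2 and 6 make the logarithms available from n = 2 on, through 2 ln n \<ge> 1 and the
  bound 6 ln n for the harmonic sum. The root 1/\<beta> compensates the power \<beta> to which the
  constant is raised for \<alpha> \<le> 1/2.\<close>

definition dev_const :: "real \<Rightarrow> real" where
  "dev_const K = (if 1/2 < \<alpha>
     then moment_const 1 * 2 powr (1 / \<alpha>) * ((2 * K)\<^sup>2 / (1 - \<alpha>) + 2 * K * (corr_const K / (1 - decay_exp)))
     else (moment_const decay_exp * 6 powr (2 * decay_exp + 1) * ((2 * K) powr (2 * decay_exp) / (1 - \<alpha>)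
        + (2 * K) powr decay_exp * ((2 * K) powr (decay_exp - 1) * corr_const K))) powr (1 / decay_exp))"

lemma dev_const_pos:
  assumes K: "0 < K" shows "0 < dev_const K"
proof (cases "1/2 < \<alpha>")
  case True
  hence "decay_exp < 1" using alpha_pos by (simp add: decay_exp_def field_simps)
  thus ?thesis using True K corr_const_pos[OF K] alpha_less_1 moment_const_pos[of 1]
    by (auto simp: dev_const_def intro!: mult_pos_pos add_pos_pos)
next
  case False
  hence "1 \<le> decay_exp" using alpha_pos by (simp add: decay_exp_def field_simps)
  thus ?thesis using False K corr_const_pos[OF K] alpha_less_1 moment_const_pos[of decay_exp]
    by (auto simp: dev_const_def intro!: mult_pos_pos add_pos_pos less_imp_neq[THEN not_sym])
qed

end

context observable begin

text \<open>Here \<beta> < 1, so correlations of order d^-\<beta> sum to order n^(1 - \<beta>) and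
  the second moment has order n^(2 - \<beta>). Division by the squared threshold gives the power of
  n. The factors 4/(2 - 1/\<alpha>) and (2 ln n)^(1/\<alpha>) are at least 1 and are inserted at the
  end.\<close>

lemma deviation_large_alpha:
  assumes al: "1/2 < \<alpha>" and t: "0 < t" and n: "2 \<le> n"
  shows "measure weighted {x \<in> {0<..1}. real n powr \<tau> * t < \<bar>\<Sum>j=1..n. X j x\<bar>}
     \<le> 4 / (2 - 1/\<alpha>) * dev_const K * real n powr (- decay_exp + 2 * (1 - \<tau>)) * ln (real n) powr (1/\<alpha>) * t powr (-2)"
proof -
  let ?b = decay_exp
  define E where "E = {x \<in> {0<..1}. real n powr \<tau> * t < \<bar>\<Sum>j=1..n. X j x\<bar>}"
  have b: "0 < ?b" "?b < 1" using al alpha_pos decay_exp_pos by (simp_all add: decay_exp_def field_simps)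
  have s: "0 < real n powr \<tau> * t" using t n by simp
  have cc: "0 < corr_const K" by (rule corr_const_pos[OF K_pos])
  have sum: "(\<Sum>d=1..n. real d powr (1 - 1 - ?b)) \<le> real n powr (1 - ?b) / (1 - ?b)"
    using sum_powr_le[of "1 - ?b" n] b by simp
  have n1: "1 \<le> real n powr (1 - ?b)" using n b by (intro ge_one_powr_ge_zero) auto
  have "(\<integral>x. \<bar>\<Sum>j=1..n. X j x\<bar> powr (2 * 1) \<partial>weighted)
     \<le> moment_const 1 * real n powr 1 * ((2 * K) powr (2 * 1) * mass + (2 * K) powr 1 *
        ((\<Sum>d=1..n. 1 / real d) powr (1 - 1) * ((2 * K) powr (1 - 1) *
         (5 * K * start_const * loss_const * (\<Sum>d=1..n. real d powr (1 - 1 - ?b))))))"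
    using n by (intro moment_estimate loss_const_bound loss_const_pos) auto
  also have "\<dots> \<le> moment_const 1 * real n powr 1 * ((2 * K)\<^sup>2 / (1 - \<alpha>) * real n powr (1 - ?b) + 2 * K *
        (corr_const K / (1 - ?b) * real n powr (1 - ?b)))"
  proof (intro mult_left_mono add_mono)
    have "(2 * K)\<^sup>2 * mass \<le> (2 * K)\<^sup>2 * (1 / (1 - \<alpha>))" by (intro mult_left_mono mass_le) auto
    also have "\<dots> \<le> (2 * K)\<^sup>2 * (1 / (1 - \<alpha>)) * real n powr (1 - ?b)"
      using mult_left_mono[OF n1, of "(2 * K)\<^sup>2 * (1 / (1 - \<alpha>))"] alpha_less_1 by simp
    finally show "(2 * K) powr (2 * 1) * mass \<le> (2 * K)\<^sup>2 / (1 - \<alpha>) * real n powr (1 - ?b)"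
      using K_pos by simp
    have "0 < (\<Sum>d=1..n. 1 / real d)" using n by (intro sum_pos) auto
    hence "(2 * K) powr 1 * ((\<Sum>d=1..n. 1 / real d) powr (1 - 1) * ((2 * K) powr (1 - 1) *
         (5 * K * start_const * loss_const * (\<Sum>d=1..n. real d powr (1 - 1 - ?b)))))
      = 2 * K * (corr_const K * (\<Sum>d=1..n. real d powr (1 - 1 - ?b)))"
      using K_pos by (simp add: corr_const_def)
    also have "\<dots> \<le> 2 * K * (corr_const K * (real n powr (1 - ?b) / (1 - ?b)))"
      using K_pos cc by (intro mult_left_mono sum) auto
    finally show "(2 * K) powr 1 * ((\<Sum>d=1..n. 1 / real d) powr (1 - 1) * ((2 * K) powr (1 - 1) *
         (5 * K * start_const * loss_const * (\<Sum>d=1..n. real d powr (1 - 1 - ?b)))))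
      \<le> 2 * K * (corr_const K / (1 - ?b) * real n powr (1 - ?b))" by simp
  qed (use moment_const_pos[of 1] in auto)
  also have "\<dots> = (moment_const 1 * ((2 * K)\<^sup>2 / (1 - \<alpha>) + 2 * K * (corr_const K / (1 - ?b)))) * (real n powr 1 * real n powr (1 - ?b))"
    by (simp only: algebra_simps)
  finally have m: "(\<integral>x. \<bar>\<Sum>j=1..n. X j x\<bar> powr (2 * 1) \<partial>weighted)
     \<le> (moment_const 1 * ((2 * K)\<^sup>2 / (1 - \<alpha>) + 2 * K * (corr_const K / (1 - ?b)))) * (real n powr 1 * real n powr (1 - ?b))" .
  define P where "P = moment_const 1 * ((2 * K)\<^sup>2 / (1 - \<alpha>) + 2 * K * (corr_const K / (1 - ?b)))"
  have P: "0 \<le> P" unfolding P_def using moment_const_pos[of 1] b alpha_less_1 K_pos cc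
    by (intro mult_nonneg_nonneg add_nonneg_nonneg) auto
  have dc: "dev_const K = 2 powr (1/\<alpha>) * P" using al by (simp add: dev_const_def P_def)
  have "ln 2 \<le> ln (real n)" using n by simp
  hence ln: "1/2 \<le> ln (real n)" using ln2_ge_two_thirds by linarith
  have "1 \<le> (2 * ln (real n)) powr (1/\<alpha>)" using ln alpha_pos by (intro ge_one_powr_ge_zero) auto
  hence lnp: "1 \<le> 2 powr (1/\<alpha>) * ln (real n) powr (1/\<alpha>)" by (simp only: powr_mult)
  have four: "1 \<le> 4 / (2 - 1/\<alpha>)" using al alpha_pos alpha_less_1 by (simp add: field_simps)
  have "measure weighted E \<le> (real n powr \<tau> * t) powr (- (2 * 1)) * (P * (real n powr 1 * real n powr (1 - ?b)))"
    unfolding E_def P_def by (rule order_trans[OF tail_bound[OF _ s] mult_left_mono[OF m]]) auto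
  also have "(real n powr \<tau> * t) powr (- (2 * 1)) = real n powr (\<tau> * (- 2)) * t powr (-2)"
    by (simp only: powr_mult powr_powr mult_1_right)
  also have "real n powr (\<tau> * (- 2)) * t powr (-2) * (P * (real n powr 1 * real n powr (1 - ?b)))
      = P * (real n powr (\<tau> * (- 2)) * real n powr 1 * real n powr (1 - ?b)) * t powr (-2)"
    by (simp only: mult_ac)
  also have "real n powr (\<tau> * (- 2)) * real n powr 1 * real n powr (1 - ?b) = real n powr (- ?b + 2 * (1 - \<tau>))"
    unfolding powr_add[symmetric] by (simp add: algebra_simps)
  finally have "measure weighted E \<le> P * real n powr (- ?b + 2 * (1 - \<tau>)) * t powr (-2)" .
  also have "\<dots> = (1 * 1) * (P * real n powr (- ?b + 2 * (1 - \<tau>)) * t powr (-2))" by simp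
  also have "\<dots> \<le> (4 / (2 - 1/\<alpha>) * (2 powr (1/\<alpha>) * ln (real n) powr (1/\<alpha>))) * (P * real n powr (- ?b + 2 * (1 - \<tau>)) * t powr (-2))"
    using P by (intro mult_right_mono mult_mono four lnp order_trans[OF zero_le_one four]) auto
  also have "\<dots> = 4 / (2 - 1/\<alpha>) * dev_const K * real n powr (- decay_exp + 2 * (1 - \<tau>)) * ln (real n) powr (1/\<alpha>) * t powr (-2)"
    unfolding dc by (simp only: mult_ac)
  finally show ?thesis unfolding E_def .
qed

text \<open>With q = \<beta> the decay sum is the harmonic sum H, and the weights contribute
  H^(\<beta> - 1), so the moment of order 2 \<beta> is at most of order n^\<beta> H^\<beta>. The
  logarithmic exponent in the claim is 2/\<alpha> - 1 = 2 \<beta> + 1.\<close>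

lemma deviation_small_alpha:
  assumes al: "\<alpha> \<le> 1/2" and t: "0 < t" and n: "2 \<le> n"
  shows "measure weighted {x \<in> {0<..1}. real n powr \<tau> * t < \<bar>\<Sum>j=1..n. X j x\<bar>}
     \<le> (4 * decay_exp) powr decay_exp * dev_const K powr decay_exp * ln (real n) powr (2/\<alpha> - 1)
        * real n powr (- decay_exp * (2 * \<tau> - 1)) * t powr (- 2 * decay_exp)"
proof -
  let ?b = decay_exp
  define E where "E = {x \<in> {0<..1}. real n powr \<tau> * t < \<bar>\<Sum>j=1..n. X j x\<bar>}"
  have b: "1 \<le> ?b" using al alpha_pos by (simp add: decay_exp_def field_simps)
  have s: "0 < real n powr \<tau> * t" using t n by simp
  have cc: "0 < corr_const K" by (rule corr_const_pos[OF K_pos])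
  define H where "H = (\<Sum>d=1..n. 1 / real d)"
  have H0: "0 < H" unfolding H_def using n by (intro sum_pos) auto
  have "ln 2 \<le> ln (real n)" using n by simp
  hence ln: "1/2 \<le> ln (real n)" using ln2_ge_two_thirds by linarith
  have H6: "H \<le> 6 * ln (real n)" using sum_inverse_le_ln[of n] n ln by (simp add: H_def)
  \<comment> \<open>A common bound for 1, which multiplies the mass term, and for
    \<open>H powr ?b\<close>, which multiplies the correlation term.\<close>
  define Q where "Q = (6 * ln (real n)) powr (2 * ?b + 1)"
  have Q1: "1 \<le> Q" unfolding Q_def using ln b by (intro ge_one_powr_ge_zero) auto
  have "H powr ?b \<le> (6 * ln (real n)) powr ?b" using H0 H6 b by (intro powr_mono2) auto
  also have "\<dots> \<le> Q" unfolding Q_def using ln b by (intro powr_mono) auto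
  finally have HQ: "H powr ?b \<le> Q" .
  have sum: "(\<Sum>d=1..n. real d powr (?b - 1 - ?b)) = H"
    unfolding H_def by (intro sum.cong) (auto simp: powr_minus_divide)
  have HH: "H powr (?b - 1) * H = H powr ?b" using H0 by (simp add: powr_diff)
  define R where "R = (2 * K) powr (2 * ?b) / (1 - \<alpha>) + (2 * K) powr ?b * ((2 * K) powr (?b - 1) * corr_const K)"
  have R: "0 \<le> R" unfolding R_def using alpha_less_1 cc by (intro add_nonneg_nonneg mult_nonneg_nonneg) auto
  have "(\<integral>x. \<bar>\<Sum>j=1..n. X j x\<bar> powr (2 * ?b) \<partial>weighted)
     \<le> moment_const ?b * real n powr ?b * ((2 * K) powr (2 * ?b) * mass + (2 * K) powr ?b *
        ((\<Sum>d=1..n. 1 / real d) powr (?b - 1) * ((2 * K) powr (?b - 1) *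
         (5 * K * start_const * loss_const * (\<Sum>d=1..n. real d powr (?b - 1 - ?b))))))"
    using n b by (intro moment_estimate loss_const_bound loss_const_pos) auto
  also have "\<dots> = moment_const ?b * real n powr ?b * ((2 * K) powr (2 * ?b) * mass + (2 * K) powr ?b * ((2 * K) powr (?b - 1) * corr_const K) * H powr ?b)"
    unfolding sum H_def[symmetric] HH[symmetric] corr_const_def by (simp only: mult_ac)
  also have "\<dots> \<le> moment_const ?b * real n powr ?b * (R * Q)"
  proof (rule mult_left_mono)
    have "(2 * K) powr (2 * ?b) * mass \<le> (2 * K) powr (2 * ?b) * (1 / (1 - \<alpha>))" by (intro mult_left_mono mass_le) auto
    also have "\<dots> \<le> (2 * K) powr (2 * ?b) * (1 / (1 - \<alpha>)) * Q"
      using mult_left_mono[OF Q1, of "(2 * K) powr (2 * ?b) * (1 / (1 - \<alpha>))"] alpha_less_1 by simp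
    finally have 1: "(2 * K) powr (2 * ?b) * mass \<le> (2 * K) powr (2 * ?b) / (1 - \<alpha>) * Q" by simp
    have 2: "(2 * K) powr ?b * ((2 * K) powr (?b - 1) * corr_const K) * H powr ?b
       \<le> (2 * K) powr ?b * ((2 * K) powr (?b - 1) * corr_const K) * Q"
      using cc by (intro mult_left_mono HQ) auto
    show "(2 * K) powr (2 * ?b) * mass + (2 * K) powr ?b * ((2 * K) powr (?b - 1) * corr_const K) * H powr ?b \<le> R * Q"
      using add_mono[OF 1 2] by (simp only: R_def distrib_right)
  qed (use moment_const_pos[OF b] in auto)
  finally have m: "(\<integral>x. \<bar>\<Sum>j=1..n. X j x\<bar> powr (2 * ?b) \<partial>weighted) \<le> moment_const ?b * real n powr ?b * (R * Q)" .
  define P where "P = moment_const ?b * 6 powr (2 * ?b + 1) * R"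
  have P: "0 \<le> P" unfolding P_def using moment_const_pos[OF b] R by simp
  have dc: "dev_const K powr ?b = P" using al b P by (simp add: dev_const_def P_def R_def powr_powr)
  have four: "1 \<le> (4 * ?b) powr ?b" using b by (intro ge_one_powr_ge_zero) auto
  have QP: "moment_const ?b * real n powr ?b * (R * Q) = P * ln (real n) powr (2 * ?b + 1) * real n powr ?b"
    unfolding Q_def P_def powr_mult by (simp only: mult_ac)
  have e: "2 * ?b + 1 = 2 / \<alpha> - 1" by (simp add: decay_exp_def)
  have "measure weighted E \<le> (real n powr \<tau> * t) powr (- (2 * ?b)) * (P * ln (real n) powr (2 * ?b + 1) * real n powr ?b)"
    unfolding E_def QP[symmetric] by (rule order_trans[OF tail_bound[OF b s] mult_left_mono[OF m]]) auto
  also have "(real n powr \<tau> * t) powr (- (2 * ?b)) = real n powr (\<tau> * (- (2 * ?b))) * t powr (- 2 * ?b)"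
    by (simp add: powr_mult powr_powr)
  also have "real n powr (\<tau> * (- (2 * ?b))) * t powr (- 2 * ?b) * (P * ln (real n) powr (2 * ?b + 1) * real n powr ?b)
      = P * ln (real n) powr (2 * ?b + 1) * (real n powr (\<tau> * (- (2 * ?b))) * real n powr ?b) * t powr (- 2 * ?b)"
    by (simp only: mult_ac)
  also have "real n powr (\<tau> * (- (2 * ?b))) * real n powr ?b = real n powr (- ?b * (2 * \<tau> - 1))"
    unfolding powr_add[symmetric] by (simp add: algebra_simps)
  finally have "measure weighted E \<le> 1 * (P * ln (real n) powr (2 * ?b + 1) * real n powr (- ?b * (2 * \<tau> - 1)) * t powr (- 2 * ?b))"
    by simp
  also have "\<dots> \<le> (4 * ?b) powr ?b * (P * ln (real n) powr (2 * ?b + 1) * real n powr (- ?b * (2 * \<tau> - 1)) * t powr (- 2 * ?b))"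
    using four P by (intro mult_right_mono) auto
  finally show ?thesis unfolding E_def dc e by (simp only: mult_ac)
qed

end

section \<open>Passage to the two measures and to C1 observables\<close>

lemma space_m01 [simp]: "space m01 = {0..1}"
  by (simp add: m01_def)

lemma measurable_m01: "f \<in> borel_measurable borel \<Longrightarrow> f \<in> borel_measurable m01"
  unfolding m01_def
  by (intro measurable_restrict_space1 measurable_completion) simp

lemma integral_m01:
  fixes f :: "real \<Rightarrow> real"
  assumes [measurable]: "f \<in> borel_measurable borel"
  shows "integral\<^sup>L m01 f = integral\<^sup>L unit_borel f"
proof -
  have "integral\<^sup>L m01 f = (\<integral>x. indicator {0..1} x *\<^sub>R f x \<partial>lebesgue)"
    unfolding m01_def by (rule integral_restrict_space) simp
  also have "\<dots> = (\<integral>x. indicator {0..1} x *\<^sub>R f x \<partial>lborel)"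
    by (rule integral_completion) measurable
  also have "\<dots> = (\<integral>x. indicator {0<..1} x *\<^sub>R f x \<partial>lborel)"
  proof (rule integral_cong_AE)
    have "AE x in lborel. x \<noteq> (0::real)" by (rule AE_lborel_singleton)
    thus "AE x in lborel. indicator {0..1} x *\<^sub>R f x = indicator {0<..1} x *\<^sub>R f x"
      by eventually_elim (auto simp: indicator_def)
  qed measurable
  also have "\<dots> = integral\<^sup>L unit_borel f"
    unfolding unit_borel_def by (rule integral_restrict_space[symmetric]) simp
  finally show ?thesis .
qed

lemma integral_m_tilde:
  fixes f :: "real \<Rightarrow> real"
  assumes [measurable]: "f \<in> borel_measurable borel"
  shows "integral\<^sup>L (m_tilde \<alpha>) f = (\<integral>x. x powr (- \<alpha>) * f x \<partial>unit_borel)"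
proof -
  have "(\<lambda>x::real. x powr (- \<alpha>)) \<in> borel_measurable m01" "f \<in> borel_measurable m01"
    by (rule measurable_m01; measurable)+
  hence "integral\<^sup>L (m_tilde \<alpha>) f = (\<integral>x. x powr (- \<alpha>) *\<^sub>R f x \<partial>m01)"
    unfolding m_tilde_def by (intro integral_density) auto
  also have "\<dots> = (\<integral>x. x powr (- \<alpha>) * f x \<partial>unit_borel)"
    by (subst integral_m01) auto
  finally show ?thesis .
qed

text \<open>The measure M enters only through its integrals of Borel functions, so one argument
  covers both measures although their sigma-algebras contain more than Borel sets.\<close>

lemma measure_eq_weighted:
  assumes M: "\<And>f :: real \<Rightarrow> real. f \<in> borel_measurable borel \<Longrightarrow> integral\<^sup>L M f = (\<integral>x. h x * f x \<partial>unit_borel)"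
    and sp: "space M = {0..1}" and E: "E \<in> sets borel" "E \<subseteq> {0..1}"
    and h: "h \<in> borel_measurable unit_borel" "\<And>x. x \<in> {0<..1} \<Longrightarrow> 0 \<le> h x"
  shows "measure M E = measure (density unit_borel (\<lambda>x. ennreal (h x))) (E \<inter> {0<..1})"
proof -
  let ?W = "density unit_borel (\<lambda>x. ennreal (h x))"
  have i: "indicat_real E \<in> borel_measurable borel" using E by simp
  have "measure M E = integral\<^sup>L M (indicat_real E)"
    using E sp by (simp add: Int_absorb2)
  also have "\<dots> = (\<integral>x. h x *\<^sub>R indicat_real E x \<partial>unit_borel)" using M[OF i] by simp
  also have "\<dots> = integral\<^sup>L ?W (indicat_real E)"
    using h(2) by (intro integral_density[symmetric] borel_measurable_unit_borel[OF i] h(1) AE_I2) auto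
  also have "\<dots> = measure ?W (E \<inter> {0<..1})" by simp
  finally show ?thesis .
qed

lemma C1_unit_bounds:
  assumes "C1_unit \<phi>"
  shows "continuous_on {0..1} \<phi>" and "0 \<le> C1_norm \<phi>"
    and "x \<in> {0..1} \<Longrightarrow> \<bar>\<phi> x\<bar> \<le> C1_norm \<phi>"
    and "x \<in> {0..1} \<Longrightarrow> y \<in> {0..1} \<Longrightarrow> \<bar>\<phi> y - \<phi> x\<bar> \<le> C1_norm \<phi> * \<bar>y - x\<bar>"
proof -
  define d where "d x = vector_derivative \<phi> (at x within {0..1})" for x
  have df: "\<phi> differentiable_on {0..1}" and dc: "continuous_on {0..1} d"
    using assms by (auto simp: C1_unit_def d_def[abs_def])
  show c: "continuous_on {0..1} \<phi>" by (rule differentiable_imp_continuous_on[OF df])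
  have bdd: "bdd_above ((\<lambda>x. \<bar>f x\<bar>) ` {0..1})" if "continuous_on {0..1} f" for f :: "real \<Rightarrow> real"
    using that by (intro bounded_imp_bdd_above compact_imp_bounded compact_continuous_image continuous_intros) auto
  have 1: "\<bar>\<phi> x\<bar> \<le> (SUP x\<in>{0..1}. \<bar>\<phi> x\<bar>)" if "x \<in> {0..1}" for x
    using that by (intro cSUP_upper bdd[OF c])
  have 2: "\<bar>d x\<bar> \<le> (SUP x\<in>{0..1}. \<bar>d x\<bar>)" if "x \<in> {0..1}" for x
    using that by (intro cSUP_upper bdd[OF dc])
  have N: "C1_norm \<phi> = (SUP x\<in>{0..1}. \<bar>\<phi> x\<bar>) + (SUP x\<in>{0..1}. \<bar>d x\<bar>)"
    by (simp add: C1_norm_def d_def)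
  have p: "0 \<le> (SUP x\<in>{0..1}. \<bar>\<phi> x\<bar>)" "0 \<le> (SUP x\<in>{0..1}. \<bar>d x\<bar>)"
    using 1[of 0] 2[of 0] by (auto intro: order_trans[OF abs_ge_zero])
  show "0 \<le> C1_norm \<phi>" using N p by simp
  show "x \<in> {0..1} \<Longrightarrow> \<bar>\<phi> x\<bar> \<le> C1_norm \<phi>" using N p 1[of x] by simp
  assume xy: "x \<in> {0..1}" "y \<in> {0..1}"
  have "(\<phi> has_real_derivative d z) (at z within {0..1})" if "z \<in> {0..1}" for z
    using df that vector_derivative_works[of \<phi> "at z within {0..1}"]
    by (simp add: differentiable_on_def d_def has_real_derivative_iff_has_vector_derivative)
  moreover have "norm (d z) \<le> C1_norm \<phi>" if "z \<in> {0..1}" for z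
    using 2[OF that] N p by simp
  ultimately have "norm (\<phi> y - \<phi> x) \<le> C1_norm \<phi> * norm (y - x)"
    using xy by (intro field_differentiable_bound[where S="{0..1}" and f'=d]) auto
  thus "\<bar>\<phi> y - \<phi> x\<bar> \<le> C1_norm \<phi> * \<bar>y - x\<bar>" by simp
qed

lemma seq_map_closed_unit:
  assumes "\<forall>j\<ge>1. 0 < a j" "x \<in> {0..1}" shows "seq_map a n x \<in> {0..1}"
proof (cases "x = 0")
  case True
  have "seq_map a n 0 = 0" by (induction n) (simp_all add: intermittent_map_def)
  thus ?thesis using True by simp
next
  case False
  thus ?thesis using seq_map_unit[of a x n] assms by auto
qed

context intermittent_family begin

lemma deviation_transfer:
  fixes M :: "real measure" and h \<phi> :: "real \<Rightarrow> real" and \<tau> t :: real and a :: "nat \<Rightarrow> real" and n :: nat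
  assumes M: "\<And>f :: real \<Rightarrow> real. f \<in> borel_measurable borel \<Longrightarrow> integral\<^sup>L M f = (\<integral>x. h x * f x \<partial>unit_borel)"
    and sp: "space M = {0..1}"
    and h: "\<And>x y. 0 < x \<Longrightarrow> x \<le> y \<Longrightarrow> y \<le> 1 \<Longrightarrow> h y \<le> h x" "\<And>x. x \<in> {0<..1} \<Longrightarrow> 1 \<le> h x"
      "\<And>x. x \<in> {0<..1} \<Longrightarrow> h x \<le> x powr (- \<alpha>)"
    and phi: "C1_unit \<phi>" and a: "\<forall>j\<ge>1. 0 < a j \<and> a j \<le> \<alpha>" and t: "0 < t" and n: "2 \<le> n"
  defines "E \<equiv> {x \<in> {0..1}. \<bar>\<Sum>j=1..n. \<phi> (seq_map a j x) - 1 / measure M {0..1} * (\<integral>y. \<phi> (seq_map a j y) \<partial>M)\<bar> > real n powr \<tau> * t}"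
  shows "1/2 < \<alpha> \<Longrightarrow> measure M E \<le> 4 / (2 - 1/\<alpha>) * dev_const (C1_norm \<phi> + 1)
      * real n powr (- (1/\<alpha> - 1) + 2 * (1 - \<tau>)) * ln (real n) powr (1/\<alpha>) * t powr (-2)"
    and "\<alpha> \<le> 1/2 \<Longrightarrow> measure M E \<le> (4 * (1/\<alpha> - 1)) powr (1/\<alpha> - 1) * dev_const (C1_norm \<phi> + 1) powr (1/\<alpha> - 1)
      * ln (real n) powr (2/\<alpha> - 1) * real n powr (- (1/\<alpha> - 1) * (2 * \<tau> - 1)) * t powr (- 2 * (1/\<alpha> - 1))"
proof -
  \<comment> \<open>Outside the unit interval \<phi> is arbitrary. The constant extension is
    continuous on the line, hence Borel, and agrees with \<phi> along all orbits in the
    interval.\<close>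
  define \<phi>0 where "\<phi>0 x = \<phi> (max 0 (min 1 x))" for x
  note C1 = C1_unit_bounds[OF phi]
  have cont: "continuous_on UNIV \<phi>0"
    unfolding \<phi>0_def[abs_def] by (rule continuous_on_compose2[OF C1(1)]) (auto intro!: continuous_intros)
  have eq0: "\<phi>0 x = \<phi> x" if "x \<in> {0..1}" for x using that by (simp add: \<phi>0_def)
  \<comment> \<open>The added 1 makes the bound strictly positive even when \<phi> vanishes.\<close>
  interpret observable \<alpha> h \<phi>0 "C1_norm \<phi> + 1" a
  proof unfold_locales
    show "\<phi>0 \<in> borel_measurable borel" by (rule borel_measurable_continuous_onI[OF cont])
    show "0 < C1_norm \<phi> + 1" using C1(2) by simp
    show "\<bar>\<phi>0 x\<bar> \<le> C1_norm \<phi> + 1" if "x \<in> {0<..1}" for x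
      using C1(3)[of x] that eq0[of x] by auto
    show "\<bar>\<phi>0 y - \<phi>0 x\<bar> \<le> (C1_norm \<phi> + 1) * (y - x)" if "0 < x" "x \<le> y" "y \<le> 1" for x y
      using C1(4)[of x y] that eq0[of x] eq0[of y] by (auto simp: distrib_right)
    show "admissible a" using a by (simp add: admissible_def)
  qed (use h in auto)
  have ap: "\<forall>j\<ge>1. 0 < a j" using a by auto
  have m: "measure M {0..1} = mass"
  proof -
    have "measure M {0..1} = integral\<^sup>L M (\<lambda>x. 1)" using sp by simp
    also have "\<dots> = mass" by (subst M) (auto simp: mass_def)
    finally show ?thesis .
  qed
  have mn: "1 / measure M {0..1} * (\<integral>y. \<phi> (seq_map a j y) \<partial>M) = mean j" for j
  proof -
    have "(\<integral>y. \<phi> (seq_map a j y) \<partial>M) = (\<integral>y. \<phi>0 (seq_map a j y) \<partial>M)"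
      using seq_map_closed_unit[OF ap] eq0 by (intro Bochner_Integration.integral_cong) (auto simp: sp)
    also have "\<dots> = (\<integral>x. h x * \<phi>0 (seq_map a j x) \<partial>unit_borel)" by (rule M) measurable
    finally show ?thesis by (simp add: m mean_def)
  qed
  have E: "E = {x \<in> {0..1}. real n powr \<tau> * t < \<bar>\<Sum>j=1..n. X j x\<bar>}"
  proof -
    have "(\<Sum>j=1..n. \<phi> (seq_map a j x) - mean j) = (\<Sum>j=1..n. X j x)" if "x \<in> {0..1}" for x
      unfolding X_def psi_def by (simp only: eq0[OF seq_map_closed_unit[OF ap that]])
    thus ?thesis unfolding E_def mn by (intro Collect_cong conj_cong refl) simp
  qed
  have "{x \<in> space borel. x \<in> {0..1} \<and> real n powr \<tau> * t < \<bar>\<Sum>j=1..n. X j x\<bar>} \<in> sets borel"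
    by measurable
  hence Eb: "E \<in> sets borel" by (simp add: E)
  have "measure M E = measure weighted (E \<inter> {0<..1})"
    unfolding weighted_def
    by (rule measure_eq_weighted[OF M sp Eb]) (use h_ge_1 in \<open>auto simp: E dest: order_trans[OF zero_le_one]\<close>)
  also have "E \<inter> {0<..1} = {x \<in> {0<..1}. real n powr \<tau> * t < \<bar>\<Sum>j=1..n. X j x\<bar>}"
    by (auto simp: E)
  finally have me: "measure M E = measure weighted {x \<in> {0<..1}. real n powr \<tau> * t < \<bar>\<Sum>j=1..n. X j x\<bar>}" .
  show "1/2 < \<alpha> \<Longrightarrow> measure M E \<le> 4 / (2 - 1/\<alpha>) * dev_const (C1_norm \<phi> + 1)
      * real n powr (- (1/\<alpha> - 1) + 2 * (1 - \<tau>)) * ln (real n) powr (1/\<alpha>) * t powr (-2)"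
    using deviation_large_alpha[OF _ t n, of \<tau>] unfolding me decay_exp_def .
  show "\<alpha> \<le> 1/2 \<Longrightarrow> measure M E \<le> (4 * (1/\<alpha> - 1)) powr (1/\<alpha> - 1) * dev_const (C1_norm \<phi> + 1) powr (1/\<alpha> - 1)
      * ln (real n) powr (2/\<alpha> - 1) * real n powr (- (1/\<alpha> - 1) * (2 * \<tau> - 1)) * t powr (- 2 * (1/\<alpha> - 1))"
    using deviation_small_alpha[OF _ t n, of \<tau>] unfolding me decay_exp_def .
qed

end

theorem theorem4p4:
  fixes \<alpha> :: real
  assumes "0 < \<alpha>" and "\<alpha> < 1"
  shows "\<exists>C C' :: real \<Rightarrow> real. (\<forall>K. C K > 0 \<and> C' K > 0) \<and>
    (\<forall>(\<phi> :: real \<Rightarrow> real) (\<tau> :: real) (a :: nat \<Rightarrow> real) (t :: real) (n :: nat).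
       C1_unit \<phi> \<longrightarrow> 1/2 < \<tau> \<longrightarrow> \<tau> \<le> 1 \<longrightarrow> (\<forall>j\<ge>1. 0 < a j \<and> a j \<le> \<alpha>) \<longrightarrow> t > 0 \<longrightarrow> n \<ge> 2 \<longrightarrow>
       (let \<beta> = 1/\<alpha> - 1;
            E = {x \<in> {0..1}. \<bar>\<Sum>j=1..n. \<phi> (seq_map a j x)
                   - (\<integral>y. \<phi> (seq_map a j y) \<partial>m01)\<bar> > real n powr \<tau> * t};
            E' = {x \<in> {0..1}. \<bar>\<Sum>j=1..n. \<phi> (seq_map a j x)
                   - 1 / measure (m_tilde \<alpha>) {0..1} * (\<integral>y. \<phi> (seq_map a j y) \<partial>m_tilde \<alpha>)\<bar>
                   > real n powr \<tau> * t}
        in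
          (\<alpha> > 1/2 \<longrightarrow>
             measure m01 E \<le> 4 / (2 - 1/\<alpha>) * C (C1_norm \<phi>)
               * real n powr (- \<beta> + 2 * (1 - \<tau>)) * ln (real n) powr (1/\<alpha>) * t powr (-2)) \<and>
          (\<alpha> \<le> 1/2 \<longrightarrow>
             measure m01 E \<le> (4 * \<beta>) powr \<beta> * C (C1_norm \<phi>) powr \<beta>
               * ln (real n) powr (2/\<alpha> - 1) * real n powr (- \<beta> * (2 * \<tau> - 1))
               * t powr (- 2 * \<beta>)) \<and>
          (\<alpha> > 1/2 \<longrightarrow>
             measure (m_tilde \<alpha>) E' \<le> 4 / (2 - 1/\<alpha>) * C' (C1_norm \<phi>)
               * real n powr (- \<beta> + 2 * (1 - \<tau>)) * ln (real n) powr (1/\<alpha>) * t powr (-2)) \<and>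
          (\<alpha> \<le> 1/2 \<longrightarrow>
             measure (m_tilde \<alpha>) E' \<le> (4 * \<beta>) powr \<beta> * C' (C1_norm \<phi>) powr \<beta>
               * ln (real n) powr (2/\<alpha> - 1) * real n powr (- \<beta> * (2 * \<tau> - 1))
               * t powr (- 2 * \<beta>))))"
proof -
  interpret intermittent_family \<alpha> by unfold_locales fact+
  \<comment> \<open>Positivity is claimed at every real K, so negative arguments, which are not
    norms, receive the default 1. The same function serves for both measures because the estimates
    are uniform over the densities h.\<close>
  define C where "C K = (if 0 \<le> K then dev_const (K + 1) else 1)" for K
  have C_pos: "0 < C K" for K by (simp add: C_def dev_const_pos)
  have pw: "1 \<le> x powr (- \<alpha>)" if "x \<in> {0<..1}" for x :: real
    using that alpha_pos powr_mono2'[of "- \<alpha>" x 1] by simp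
  have m1: "measure m01 {0..1} = 1"
  proof -
    have "measure m01 {0..1} = integral\<^sup>L m01 (\<lambda>x. 1)" by simp
    also have "\<dots> = 1" by (subst integral_m01) auto
    finally show ?thesis .
  qed
  have space_mt: "space (m_tilde \<alpha>) = {0..1}" by (simp add: m_tilde_def)
  \<comment> \<open>Lebesgue measure has mass 1; unfolding this removes the normalizing factor and
    gives the centering in the form of the claim.\<close>
  note m01_bounds = deviation_transfer[where h="\<lambda>_. 1" and M=m01, unfolded m1 div_by_1 mult_1]
  note mt_bounds = deviation_transfer[where h="\<lambda>x. x powr (- \<alpha>)" and M="m_tilde \<alpha>"]
  have mono: "y powr (- \<alpha>) \<le> x powr (- \<alpha>)" if "0 < x" "x \<le> y" "y \<le> 1" for x y :: real
    using that alpha_pos by (intro powr_mono2') auto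
  show ?thesis
  proof (rule exI[of _ C], rule exI[of _ C], intro conjI allI impI)
    show "0 < C K" "0 < C K" for K by (rule C_pos)+
    fix \<phi> :: "real \<Rightarrow> real" and \<tau> t :: real and a :: "nat \<Rightarrow> real" and n :: nat
    assume H: "C1_unit \<phi>" "1/2 < \<tau>" "\<tau> \<le> 1" "\<forall>j\<ge>1. 0 < a j \<and> a j \<le> \<alpha>" "0 < t" "2 \<le> n"
    have C: "C (C1_norm \<phi>) = dev_const (C1_norm \<phi> + 1)" using C1_unit_bounds(2)[OF H(1)] by (simp add: C_def)
    show "let \<beta> = 1/\<alpha> - 1;
            E = {x \<in> {0..1}. \<bar>\<Sum>j=1..n. \<phi> (seq_map a j x)
                   - (\<integral>y. \<phi> (seq_map a j y) \<partial>m01)\<bar> > real n powr \<tau> * t};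
            E' = {x \<in> {0..1}. \<bar>\<Sum>j=1..n. \<phi> (seq_map a j x)
                   - 1 / measure (m_tilde \<alpha>) {0..1} * (\<integral>y. \<phi> (seq_map a j y) \<partial>m_tilde \<alpha>)\<bar>
                   > real n powr \<tau> * t}
        in
          (\<alpha> > 1/2 \<longrightarrow>
             measure m01 E \<le> 4 / (2 - 1/\<alpha>) * C (C1_norm \<phi>)
               * real n powr (- \<beta> + 2 * (1 - \<tau>)) * ln (real n) powr (1/\<alpha>) * t powr (-2)) \<and>
          (\<alpha> \<le> 1/2 \<longrightarrow>
             measure m01 E \<le> (4 * \<beta>) powr \<beta> * C (C1_norm \<phi>) powr \<beta>
               * ln (real n) powr (2/\<alpha> - 1) * real n powr (- \<beta> * (2 * \<tau> - 1))
               * t powr (- 2 * \<beta>)) \<and>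
          (\<alpha> > 1/2 \<longrightarrow>
             measure (m_tilde \<alpha>) E' \<le> 4 / (2 - 1/\<alpha>) * C (C1_norm \<phi>)
               * real n powr (- \<beta> + 2 * (1 - \<tau>)) * ln (real n) powr (1/\<alpha>) * t powr (-2)) \<and>
          (\<alpha> \<le> 1/2 \<longrightarrow>
             measure (m_tilde \<alpha>) E' \<le> (4 * \<beta>) powr \<beta> * C (C1_norm \<phi>) powr \<beta>
               * ln (real n) powr (2/\<alpha> - 1) * real n powr (- \<beta> * (2 * \<tau> - 1))
               * t powr (- 2 * \<beta>))"
      unfolding Let_def C
      by (intro conjI impI m01_bounds mt_bounds H space_mt)
        (auto intro: pw mono integral_m01 integral_m_tilde)
  qed
qed

end
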